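(* There is a one-to-one correspondence between Manin triples of averaging pre-Lie algebras and averaging pre-Lie bialgebras $(A,\circ,\Delta,P,S)$.
   Context: All vector spaces are finite-dimensional over a fixed field $\mathbf k$ of characteristic $0$. For a vector space $V$, $V^*$ is its dual, and $\tau(x\otimes y)=y\otimes x$. A pre-Lie algebra $(A,\circ)$ is a vector space $A$ with a bilinear product $\circ$ satisfying $(x\circ y)\circ z-x\circ(y\circ z)=(y\circ x)\circ z-y\circ(x\circ z)$ for all $x,y,z\in A$. Write $L_xy=x\circ y$ and $R_xy=y\circ x$. An averaging operator on $(A,\circ)$ is a linear map $P:A\to A$ with $P(x)\circ P(y)=P(P(x)\circ y)=P(x\circ P(y))$ for all $x,y\in A$; the pair $((A,\circ),P)$ is then called an averaging pre-Lie algebra. A pre-Lie coalgebra $(A,\Delta)$ is a vector space $A$ with a linear map $\Delta:A\to A\otimes A$ such that $(\Delta\otimes\mathrm{id})\Delta(x)-(\mathrm{id}\otimes\Delta)\Delta(x)=(\tau\otimes\mathrm{id})(\Delta\otimes\mathrm{id})\Delta(x)-(\tau\otimes\mathrm{id})(\mathrm{id}\otimes\Delta)\Delta(x)$ for all $x\in A$. A pre-Lie bialgebra $(A,\circ,\Delta)$ consists of a pre-Lie algebra $(A,\circ)$ and a pre-Lie coalgebra $(A,\Delta)$ such that for all $x,y\in A$: $$\Delta(x\circ y-y\circ x)=(L_x\otimes\mathrm{id}+\mathrm{id}\otimes(L_x-R_x))\Delta(y)-(L_y\otimes\mathrm{id}+\mathrm{id}\otimes(L_y-R_y))\Delta(x),$$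 $$\Delta(x\circ y)-\tau(\Delta(x\circ y))=(\mathrm{id}\otimes R_y)\Delta(x)-\tau\bigl((\mathrm{id}\otimes R_y)\Delta(x)\bigr)+(L_x\otimes\mathrm{id}+\mathrm{id}\otimes L_x)\Delta(y)-\tau\bigl((L_x\otimes\mathrm{id}+\mathrm{id}\otimes L_x)\Delta(y)\bigr).$$ An averaging pre-Lie coalgebra $((A,\Delta),S)$ is a pre-Lie coalgebra $(A,\Delta)$ with a linear map $S:A\to A$ such that $(S\otimes S)\Delta(x)=(S\otimes\mathrm{id})\Delta(S(x))=(\mathrm{id}\otimes S)\Delta(S(x))$ for all $x\in A$. An averaging pre-Lie bialgebra is a quintuple $(A,\circ,\Delta,P,S)$ such that $((A,\circ),P)$ is an averaging pre-Lie algebra, $((A,\Delta),S)$ is an averaging pre-Lie coalgebra, $(A,\circ,\Delta)$ is a pre-Lie bialgebra, and for all $x,y\in A$: $P(x)\circ S(y)=S(P(x)\circ y)=S(x\circ S(y))$; $S(x)\circ P(y)=S(x\circ P(y))=S(S(x)\circ y)$; $(P\otimes S)\Delta(x)=(\mathrm{id}\otimes S)\Delta(P(x))=(P\otimes\mathrm{id})\Delta(P(x))$; $(S\otimes P)\Delta(x)=(S\otimes\mathrm{id})\Delta(P(x))=(\mathrm{id}\otimes P)\Delta(P(x))$. A quadratic averaging pre-Lie algebra $((A,\circ),P,\omega)$ is an averaging pre-Lie algebra $((A,\circ),P)$ with a nondegenerate skew-symmetric bilinear form $\omega\in\wedge^2A^*$ such that $\omega(x\circ y,z)+\omega(y,x\circ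 z-z\circ x)=0$ and $\omega(Px,y)-\omega(x,Py)=0$ for all $x,y,z\in A$. A Manin triple of averaging pre-Lie algebras is a triple $\bigl(((\mathcal A,\circ_{\mathcal A}),\mathcal P,\omega),((A,\circ_A),P_A),((\mathfrak b,\circ_{\mathfrak b}),P_{\mathfrak b})\bigr)$, where $((\mathcal A,\circ_{\mathcal A}),\mathcal P,\omega)$ is an even-dimensional quadratic averaging pre-Lie algebra; $((A,\circ_A),P_A)$ and $((\mathfrak b,\circ_{\mathfrak b}),P_{\mathfrak b})$ are averaging pre-Lie subalgebras, i.e. $A$ and $\mathfrak b$ are pre-Lie subalgebras of $\mathcal A$ with $\mathcal P|_A=P_A$ and $\mathcal P|_{\mathfrak b}=P_{\mathfrak b}$; both $A$ and $\mathfrak b$ are isotropic with respect to $\omega$; and $\mathcal A=A\oplus\mathfrak b$ as vector spaces.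
   Formalization: Up to isomorphism, the natural correspondence is proved for S = P, which ω(Px,y) = ω(x,Py) forces (zero products with S ≠ P come from no Manin triple); for arbitrary S only a bijection of isomorphism classes matching the underlying pre-Lie bialgebras is given. *)

theory Defs
  imports Complex_Main "HOL-Library.Function_Algebras"
begin

text \<open>
  A vector space over \<open>'k\<close> is a type \<open>'a\<close> with a scalar multiplication \<open>s\<close> satisfying
  \<^locale>\<open>vector_space\<close>; \<^const>\<open>Vector_Spaces.linear\<close> includes that both sides are vector spaces.
  Functions are added pointwise (\<open>HOL-Library.Function_Algebras\<close>).
\<close>

section \<open>Tensors\<close>

text \<open>
  A tensor is represented by its evaluations on tuples of linear functionals: the canonical map
  from \<open>A \<otimes> A\<close> to the bilinear forms on \<open>A\<^sup>* \<times> A\<^sup>*\<close> is injective over a field, and \<open>A \<otimes> A\<close> is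
  identified with its image, the set of finite sums of pure tensors. Likewise elements of
  \<open>A \<otimes> A \<otimes> A\<close> are functions of three functionals. Functions that are not linear functionals are
  irrelevant; on them every tensor takes the value 0.
\<close>

type_synonym ('k, 'a) tensor2 = "('a \<Rightarrow> 'k) \<Rightarrow> ('a \<Rightarrow> 'k) \<Rightarrow> 'k"
type_synonym ('k, 'a) tensor3 = "('a \<Rightarrow> 'k) \<Rightarrow> ('a \<Rightarrow> 'k) \<Rightarrow> ('a \<Rightarrow> 'k) \<Rightarrow> 'k"

definition dual_space :: "('k::field \<Rightarrow> 'a::ab_group_add \<Rightarrow> 'a) \<Rightarrow> ('a \<Rightarrow> 'k) set" where
  "dual_space s = {f. Vector_Spaces.linear s (*) f}"

definition pure_tensor ::
    "('k::field \<Rightarrow> 'a::ab_group_add \<Rightarrow> 'a) \<Rightarrow> 'a \<Rightarrow> 'a \<Rightarrow> ('k, 'a) tensor2" where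
  "pure_tensor s x y =
    (\<lambda>f g. if f \<in> dual_space s \<and> g \<in> dual_space s then f x * g y else 0)"

definition tensor_space ::
    "('k::field \<Rightarrow> 'a::ab_group_add \<Rightarrow> 'a) \<Rightarrow> ('k, 'a) tensor2 set" where
  "tensor_space s = {t. \<exists>(n::nat) x y. t = (\<Sum>i<n. pure_tensor s (x i) (y i))}"

definition tensor_scale :: "'k::field \<Rightarrow> ('k, 'a) tensor2 \<Rightarrow> ('k, 'a) tensor2" where
  "tensor_scale c t = (\<lambda>f g. c * t f g)"

text \<open>The map \<open>\<phi> \<otimes> \<psi>\<close> on \<open>A \<otimes> A\<close>, and the flip \<open>\<tau>\<close>.\<close>

definition tensor_map ::
    "('k::field \<Rightarrow> 'a::ab_group_add \<Rightarrow> 'a) \<Rightarrow> ('a \<Rightarrow> 'a) \<Rightarrow> ('a \<Rightarrow> 'a)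
      \<Rightarrow> ('k, 'a) tensor2 \<Rightarrow> ('k, 'a) tensor2" where
  "tensor_map s \<phi> \<psi> t =
    (\<lambda>f g. if f \<in> dual_space s \<and> g \<in> dual_space s then t (f \<circ> \<phi>) (g \<circ> \<psi>) else 0)"

definition flip :: "('k, 'a) tensor2 \<Rightarrow> ('k, 'a) tensor2" where
  "flip t = (\<lambda>f g. t g f)"

text \<open>The maps \<open>\<Delta> \<otimes> id\<close> and \<open>id \<otimes> \<Delta>\<close> from \<open>A \<otimes> A\<close> to \<open>A \<otimes> A \<otimes> A\<close>, and \<open>\<tau> \<otimes> id\<close>.\<close>

definition comult_left ::
    "('a \<Rightarrow> ('k, 'a) tensor2) \<Rightarrow> ('k, 'a) tensor2 \<Rightarrow> ('k, 'a) tensor3" where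
  "comult_left \<Delta> t = (\<lambda>f g h. t (\<lambda>x. \<Delta> x f g) h)"

definition comult_right ::
    "('a \<Rightarrow> ('k, 'a) tensor2) \<Rightarrow> ('k, 'a) tensor2 \<Rightarrow> ('k, 'a) tensor3" where
  "comult_right \<Delta> t = (\<lambda>f g h. t f (\<lambda>x. \<Delta> x g h))"

definition flip_left :: "('k, 'a) tensor3 \<Rightarrow> ('k, 'a) tensor3" where
  "flip_left u = (\<lambda>f g h. u g f h)"

lemma tensor_map_pure_tensor:
  assumes "Vector_Spaces.linear s s \<phi>" "Vector_Spaces.linear s s \<psi>"
  shows "tensor_map s \<phi> \<psi> (pure_tensor s x y) = pure_tensor s (\<phi> x) (\<psi> y)"
  using assms
  by (auto simp: tensor_map_def pure_tensor_def dual_space_def fun_eq_iff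
      intro: Vector_Spaces.linear_compose)

lemma flip_pure_tensor: "flip (pure_tensor s x y) = pure_tensor s y x"
  by (auto simp: flip_def pure_tensor_def fun_eq_iff)

section \<open>Averaging pre-Lie algebras, coalgebras and bialgebras\<close>

definition bilinear_map ::
    "('k::field \<Rightarrow> 'a::ab_group_add \<Rightarrow> 'a) \<Rightarrow> ('k \<Rightarrow> 'b::ab_group_add \<Rightarrow> 'b)
      \<Rightarrow> ('a \<Rightarrow> 'a \<Rightarrow> 'b) \<Rightarrow> bool" where
  "bilinear_map s s' m \<longleftrightarrow>
    (\<forall>x. Vector_Spaces.linear s s' (\<lambda>y. m x y)) \<and>
    (\<forall>y. Vector_Spaces.linear s s' (\<lambda>x. m x y))"

definition pre_lie_algebra ::
    "('k::field \<Rightarrow> 'a::ab_group_add \<Rightarrow> 'a) \<Rightarrow> ('a \<Rightarrow> 'a \<Rightarrow> 'a) \<Rightarrow> bool" where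
  "pre_lie_algebra s m \<longleftrightarrow>
    bilinear_map s s m \<and>
    (\<forall>x y z. m (m x y) z - m x (m y z) = m (m y x) z - m y (m x z))"

definition averaging_pre_lie_algebra ::
    "('k::field \<Rightarrow> 'a::ab_group_add \<Rightarrow> 'a) \<Rightarrow> ('a \<Rightarrow> 'a \<Rightarrow> 'a) \<Rightarrow> ('a \<Rightarrow> 'a) \<Rightarrow> bool" where
  "averaging_pre_lie_algebra s m P \<longleftrightarrow>
    pre_lie_algebra s m \<and> Vector_Spaces.linear s s P \<and>
    (\<forall>x y. m (P x) (P y) = P (m (P x) y) \<and> m (P x) (P y) = P (m x (P y)))"

definition pre_lie_coalgebra ::
    "('k::field \<Rightarrow> 'a::ab_group_add \<Rightarrow> 'a) \<Rightarrow> ('a \<Rightarrow> ('k, 'a) tensor2) \<Rightarrow> bool" where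
  "pre_lie_coalgebra s \<Delta> \<longleftrightarrow>
    Vector_Spaces.linear s tensor_scale \<Delta> \<and> (\<forall>x. \<Delta> x \<in> tensor_space s) \<and>
    (\<forall>x. comult_left \<Delta> (\<Delta> x) - comult_right \<Delta> (\<Delta> x) =
         flip_left (comult_left \<Delta> (\<Delta> x)) - flip_left (comult_right \<Delta> (\<Delta> x)))"

definition averaging_pre_lie_coalgebra ::
    "('k::field \<Rightarrow> 'a::ab_group_add \<Rightarrow> 'a) \<Rightarrow> ('a \<Rightarrow> ('k, 'a) tensor2) \<Rightarrow> ('a \<Rightarrow> 'a) \<Rightarrow> bool"
  where
  "averaging_pre_lie_coalgebra s \<Delta> S \<longleftrightarrow>
    pre_lie_coalgebra s \<Delta> \<and> Vector_Spaces.linear s s S \<and>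
    (\<forall>x. tensor_map s S S (\<Delta> x) = tensor_map s S id (\<Delta> (S x)) \<and>
         tensor_map s S S (\<Delta> x) = tensor_map s id S (\<Delta> (S x)))"

definition pre_lie_bialgebra ::
    "('k::field \<Rightarrow> 'a::ab_group_add \<Rightarrow> 'a) \<Rightarrow> ('a \<Rightarrow> 'a \<Rightarrow> 'a) \<Rightarrow> ('a \<Rightarrow> ('k, 'a) tensor2) \<Rightarrow> bool"
  where
  "pre_lie_bialgebra s m \<Delta> \<longleftrightarrow>
    pre_lie_algebra s m \<and> pre_lie_coalgebra s \<Delta> \<and>
    (let L = (\<lambda>x y. m x y); R = (\<lambda>x y. m y x) in
      \<forall>x y.
        \<Delta> (m x y - m y x) =
          (tensor_map s (L x) id (\<Delta> y) + tensor_map s id (L x - R x) (\<Delta> y))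
          - (tensor_map s (L y) id (\<Delta> x) + tensor_map s id (L y - R y) (\<Delta> x)) \<and>
        \<Delta> (m x y) - flip (\<Delta> (m x y)) =
          tensor_map s id (R y) (\<Delta> x) - flip (tensor_map s id (R y) (\<Delta> x))
          + (tensor_map s (L x) id (\<Delta> y) + tensor_map s id (L x) (\<Delta> y))
          - flip (tensor_map s (L x) id (\<Delta> y) + tensor_map s id (L x) (\<Delta> y)))"

record ('k, 'a) bialgebra_data =
  bi_mult :: "'a \<Rightarrow> 'a \<Rightarrow> 'a"
  bi_comult :: "'a \<Rightarrow> ('k, 'a) tensor2"
  bi_P :: "'a \<Rightarrow> 'a"
  bi_S :: "'a \<Rightarrow> 'a"

definition averaging_pre_lie_bialgebras ::
    "('k::field \<Rightarrow> 'a::ab_group_add \<Rightarrow> 'a) \<Rightarrow> ('k, 'a) bialgebra_data set" where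
  "averaging_pre_lie_bialgebras s =
    {B. let m = bi_mult B; \<Delta> = bi_comult B; P = bi_P B; S = bi_S B in
      averaging_pre_lie_algebra s m P \<and>
      averaging_pre_lie_coalgebra s \<Delta> S \<and>
      pre_lie_bialgebra s m \<Delta> \<and>
      (\<forall>x y. m (P x) (S y) = S (m (P x) y) \<and> m (P x) (S y) = S (m x (S y))) \<and>
      (\<forall>x y. m (S x) (P y) = S (m x (P y)) \<and> m (S x) (P y) = S (m (S x) y)) \<and>
      (\<forall>x. tensor_map s P S (\<Delta> x) = tensor_map s id S (\<Delta> (P x)) \<and>
           tensor_map s P S (\<Delta> x) = tensor_map s P id (\<Delta> (P x))) \<and>
      (\<forall>x. tensor_map s S P (\<Delta> x) = tensor_map s S id (\<Delta> (P x)) \<and>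
           tensor_map s S P (\<Delta> x) = tensor_map s id P (\<Delta> (P x)))}"

definition bialgebra_iso ::
    "('k::field \<Rightarrow> 'a::ab_group_add \<Rightarrow> 'a)
      \<Rightarrow> (('k, 'a) bialgebra_data \<times> ('k, 'a) bialgebra_data) set" where
  "bialgebra_iso s =
    {(B, B'). B \<in> averaging_pre_lie_bialgebras s \<and> B' \<in> averaging_pre_lie_bialgebras s \<and>
      (\<exists>\<phi>. Vector_Spaces.linear s s \<phi> \<and> bij \<phi> \<and>
        (\<forall>x y. \<phi> (bi_mult B x y) = bi_mult B' (\<phi> x) (\<phi> y)) \<and>
        (\<forall>x. tensor_map s \<phi> \<phi> (bi_comult B x) = bi_comult B' (\<phi> x)) \<and>
        (\<forall>x. \<phi> (bi_P B x) = bi_P B' (\<phi> x)) \<and>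
        (\<forall>x. \<phi> (bi_S B x) = bi_S B' (\<phi> x)))}"

section \<open>Manin triples\<close>

definition quadratic_averaging_pre_lie_algebra ::
    "('k::field \<Rightarrow> 'v::ab_group_add \<Rightarrow> 'v) \<Rightarrow> ('v \<Rightarrow> 'v \<Rightarrow> 'v) \<Rightarrow> ('v \<Rightarrow> 'v)
      \<Rightarrow> ('v \<Rightarrow> 'v \<Rightarrow> 'k) \<Rightarrow> bool" where
  "quadratic_averaging_pre_lie_algebra s m P \<omega> \<longleftrightarrow>
    averaging_pre_lie_algebra s m P \<and>
    bilinear_map s (*) \<omega> \<and>
    (\<forall>x y. \<omega> x y = - \<omega> y x) \<and>
    (\<forall>x. (\<forall>y. \<omega> x y = 0) \<longrightarrow> x = 0) \<and>
    (\<forall>x y z. \<omega> (m x y) z + \<omega> y (m x z - m z x) = 0) \<and>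
    (\<forall>x y. \<omega> (P x) y - \<omega> x (P y) = 0)"

text \<open>
  The products and operators of the two subalgebras of a Manin triple are the restrictions of
  the ambient ones, so only the underlying subspaces are recorded.
\<close>

definition averaging_pre_lie_subalgebra ::
    "('k::field \<Rightarrow> 'v::ab_group_add \<Rightarrow> 'v) \<Rightarrow> ('v \<Rightarrow> 'v \<Rightarrow> 'v) \<Rightarrow> ('v \<Rightarrow> 'v) \<Rightarrow> 'v set \<Rightarrow> bool"
  where
  "averaging_pre_lie_subalgebra s m P U \<longleftrightarrow>
    module.subspace s U \<and> (\<forall>x\<in>U. \<forall>y\<in>U. m x y \<in> U) \<and> (\<forall>x\<in>U. P x \<in> U)"

record ('k, 'v) manin_data =
  mt_mult :: "'v \<Rightarrow> 'v \<Rightarrow> 'v"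
  mt_P :: "'v \<Rightarrow> 'v"
  mt_form :: "'v \<Rightarrow> 'v \<Rightarrow> 'k"
  mt_A :: "'v set"
  mt_b :: "'v set"

definition manin_triples ::
    "('k::field \<Rightarrow> 'v::ab_group_add \<Rightarrow> 'v) \<Rightarrow> ('k, 'v) manin_data set" where
  "manin_triples s =
    {M. let m = mt_mult M; P = mt_P M; \<omega> = mt_form M; A = mt_A M; b = mt_b M in
      quadratic_averaging_pre_lie_algebra s m P \<omega> \<and>
      even (vector_space.dim s (UNIV :: 'v set)) \<and>
      averaging_pre_lie_subalgebra s m P A \<and>
      averaging_pre_lie_subalgebra s m P b \<and>
      (\<forall>x\<in>A. \<forall>y\<in>A. \<omega> x y = 0) \<and>
      (\<forall>x\<in>b. \<forall>y\<in>b. \<omega> x y = 0) \<and>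
      A \<inter> b = {0} \<and> (\<forall>v. \<exists>x\<in>A. \<exists>y\<in>b. v = x + y)}"

definition manin_iso ::
    "('k::field \<Rightarrow> 'v::ab_group_add \<Rightarrow> 'v)
      \<Rightarrow> (('k, 'v) manin_data \<times> ('k, 'v) manin_data) set" where
  "manin_iso s =
    {(M, M'). M \<in> manin_triples s \<and> M' \<in> manin_triples s \<and>
      (\<exists>\<phi>. Vector_Spaces.linear s s \<phi> \<and> bij \<phi> \<and>
        (\<forall>x y. \<phi> (mt_mult M x y) = mt_mult M' (\<phi> x) (\<phi> y)) \<and>
        (\<forall>x. \<phi> (mt_P M x) = mt_P M' (\<phi> x)) \<and>
        (\<forall>x y. mt_form M' (\<phi> x) (\<phi> y) = mt_form M x y) \<and>
        \<phi> ` mt_A M = mt_A M' \<and> \<phi> ` mt_b M = mt_b M')}"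

section \<open>The bialgebra of a Manin triple\<close>

text \<open>
  Let \<open>(\<A>, A, b)\<close> be a Manin triple and let \<open>i\<close> identify the carrier of a bialgebra with \<open>A\<close>.
  The form identifies \<open>u \<in> b\<close> with the functional \<open>x \<mapsto> \<omega> (u, i x)\<close>, that is \<open>b\<close> with the dual
  of \<open>A\<close>. The comultiplication is dual to the product of \<open>b\<close>,
  \<open>\<langle>u \<circ> v, x\<rangle> = \<langle>u \<otimes> v, \<Delta> x\<rangle>\<close>, and \<open>S\<close> is dual to the averaging operator of \<open>b\<close>.
  The opposite sign of the identification would replace \<open>\<Delta>\<close> by \<open>- \<Delta>\<close>.

  Since the averaging operator of a quadratic averaging pre-Lie algebra is self-adjoint for
  \<open>\<omega>\<close>, the dual of the averaging operator of \<open>b\<close> is that of \<open>A\<close>: an associated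
  bialgebra has \<open>S = P\<close>. The relation \<open>pre_lie_associated\<close> ignores \<open>P\<close> and \<open>S\<close>.
\<close>

definition dual_functional ::
    "('k, 'v) manin_data \<Rightarrow> ('a \<Rightarrow> 'v) \<Rightarrow> 'v \<Rightarrow> 'a \<Rightarrow> 'k" where
  "dual_functional M i u = (\<lambda>x. mt_form M u (i x))"

definition pre_lie_associated_via ::
    "('k::field \<Rightarrow> 'v::ab_group_add \<Rightarrow> 'v) \<Rightarrow> ('k \<Rightarrow> 'a::ab_group_add \<Rightarrow> 'a)
      \<Rightarrow> ('a \<Rightarrow> 'v) \<Rightarrow> ('k, 'v) manin_data \<Rightarrow> ('k, 'a) bialgebra_data \<Rightarrow> bool" where
  "pre_lie_associated_via sV sA i M B \<longleftrightarrow>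
    Vector_Spaces.linear sA sV i \<and> inj i \<and> range i = mt_A M \<and>
    (\<forall>x y. i (bi_mult B x y) = mt_mult M (i x) (i y)) \<and>
    (\<forall>x. bi_comult B x \<in> tensor_space sA) \<and>
    (\<forall>x. \<forall>u\<in>mt_b M. \<forall>v\<in>mt_b M.
      bi_comult B x (dual_functional M i u) (dual_functional M i v) =
      dual_functional M i (mt_mult M u v) x)"

definition pre_lie_associated ::
    "('k::field \<Rightarrow> 'v::ab_group_add \<Rightarrow> 'v) \<Rightarrow> ('k \<Rightarrow> 'a::ab_group_add \<Rightarrow> 'a)
      \<Rightarrow> ('k, 'v) manin_data \<Rightarrow> ('k, 'a) bialgebra_data \<Rightarrow> bool" where
  "pre_lie_associated sV sA M B \<longleftrightarrow> (\<exists>i. pre_lie_associated_via sV sA i M B)"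

definition associated ::
    "('k::field \<Rightarrow> 'v::ab_group_add \<Rightarrow> 'v) \<Rightarrow> ('k \<Rightarrow> 'a::ab_group_add \<Rightarrow> 'a)
      \<Rightarrow> ('k, 'v) manin_data \<Rightarrow> ('k, 'a) bialgebra_data \<Rightarrow> bool" where
  "associated sV sA M B \<longleftrightarrow>
    (\<exists>i. pre_lie_associated_via sV sA i M B \<and>
      (\<forall>x. i (bi_P B x) = mt_P M (i x)) \<and>
      (\<forall>x. \<forall>u\<in>mt_b M. dual_functional M i u (bi_S B x) = dual_functional M i (mt_P M u) x))"

end

theory Submission
  imports Defs "HOL-Library.Equipollence"
begin

text \<open>
  Let \<open>\<beta>\<close> be the coordinate form of a basis of \<open>A\<close>. It turns a comultiplication \<open>\<Delta>\<close> into a product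
  \<open>n\<close> on \<open>A\<close>, the product of the dual, by \<open>\<Delta> x (\<beta> a) (\<beta> b) = \<beta> (n a b) x\<close>. A Manin triple is
  \<open>V = i A + j A\<close> with \<open>\<omega> (j a, i x) = \<beta> a x\<close>, and invariance gives \<open>\<omega> (x y, z) = \<omega> (x, z y)\<close>, so
  the whole product of \<open>V\<close> is determined by \<open>m\<close> and \<open>n\<close>. By invariance the pre-Lie identity of \<open>V\<close>,
  paired with a fourth vector \<open>w\<close>, becomes
  \<open>\<omega> ([x, y], w z) + \<omega> ([y, w], x z) + \<omega> ([w, x], y z) = \<omega> (z, [w, [x, y]] + [x, [y, w]] + [y, [w, x]])\<close>,
  which is alternating in \<open>x, y, w\<close>. Evaluated on vectors from \<open>i A\<close> and \<open>j A\<close>, it reduces to the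
  pre-Lie (hence Jacobi) identities of \<open>m\<close> and \<open>n\<close> and the two compatibility conditions of a
  bialgebra. As the averaging operator is self-adjoint, it contributes \<open>S = P\<close>.

  This is the second bijection. The first one allows an arbitrary \<open>S\<close> and only requires the
  underlying pre-Lie bialgebras to agree; there it suffices to compare, over each isomorphism class
  of pre-Lie bialgebras, the cardinalities of the two sets of classes of averaging structures.
\<close>

section \<open>Linear maps and the dual space\<close>

text \<open>The obstacle is that a triple carries one operator where a bialgebra has two. Invariance
  of the form makes the operator on \<open>b\<close> the transpose of the one on \<open>A\<close>,
  so a bialgebra with \<open>S\<close> different from \<open>P\<close> is \<open>associated\<close>
  to no triple, and only its pre-Lie part can be compared with one. A bijection that reaches such
  bialgebras is therefore not natural: it is glued from arbitrarily chosen bijections of fibres,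
  obtained by Cantor-Bernstein. One inequality comes from the natural bijection onto the bialgebras
  with \<open>S = P\<close>. The other is a count: a field of characteristic 0 is infinite, finitely
  many structure constants give no more bialgebras than there are scalars, and for nonzero
  \<open>A\<close> the scalar operators alone give that many triples over each pre-Lie bialgebra.
  Labelling functionals by vectors through a basis puts \<open>A\<close>, its dual and
  \<open>b\<close> on one type. Products, coproducts and operators on any of them become functions
  on that type, and tensor identities become scalar identities in \<open>a, b, x\<close>.\<close>

lemma linear_simps:
  assumes "Vector_Spaces.linear s t f"
  shows "f (x + y) = f x + f y" and "f (x - y) = f x - f y" and "f (- x) = - f x"
    and "f 0 = 0" and "f (s c x) = t c (f x)" and "f (\<Sum>i\<in>I. g i) = (\<Sum>i\<in>I. f (g i))"
proof -
  interpret module_hom s t f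
    using assms by (simp add: module_hom_iff_linear)
  show "f (x + y) = f x + f y" "f (x - y) = f x - f y" "f (- x) = - f x" "f 0 = 0"
    "f (s c x) = t c (f x)" "f (\<Sum>i\<in>I. g i) = (\<Sum>i\<in>I. f (g i))"
    by (fact add diff neg zero scale sum)+
qed

lemma linear_vector_spaces:
  assumes "Vector_Spaces.linear s t f"
  shows "vector_space s" and "vector_space t"
  using assms by (auto simp: Vector_Spaces.linear_iff)

lemma linearI:
  assumes "vector_space s" "vector_space t"
    and "\<And>x y. f (x + y) = f x + f y" "\<And>c x. f (s c x) = t c (f x)"
  shows "Vector_Spaces.linear s t f"
  using assms by (simp add: Vector_Spaces.linear_iff)

lemma linear_inv:
  assumes "Vector_Spaces.linear s t f" "bij f"
  shows "Vector_Spaces.linear t s (inv f)"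
proof (rule linearI)
  have inv: "f (inv f x) = x" for x
    using assms(2) by (simp add: bij_is_surj surj_f_inv_f)
  have inj: "inv f (f x) = x" for x
    using assms(2) by (simp add: bij_is_inj)
  show "inv f (x + y) = inv f x + inv f y" for x y
    using inj[of "inv f x + inv f y"] by (simp add: linear_simps[OF assms(1)] inv)
  show "inv f (t c x) = s c (inv f x)" for c x
    using inj[of "s c (inv f x)"] by (simp add: linear_simps[OF assms(1)] inv)
qed (use assms linear_vector_spaces in auto)

lemma vector_space_mult: "vector_space ((*) :: 'k::field \<Rightarrow> 'k \<Rightarrow> 'k)"
  by unfold_locales (auto simp: algebra_simps)

lemma vector_space_tensor_scale: "vector_space (tensor_scale :: 'k::field \<Rightarrow> _)"
  by unfold_locales (auto simp: tensor_scale_def fun_eq_iff algebra_simps)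

lemma sum_tensor_apply: "(\<Sum>i\<in>I. t i :: ('k::field, 'a) tensor2) f g = (\<Sum>i\<in>I. t i f g)"
  by (induction I rule: infinite_finite_induct) auto

lemma dual_space_compose:
  assumes "Vector_Spaces.linear s t \<phi>" "f \<in> dual_space t"
  shows "f \<circ> \<phi> \<in> dual_space s"
  using assms by (auto simp: dual_space_def intro: Vector_Spaces.linear_compose)

lemma bilinear_map_simps:
  assumes "bilinear_map s t m"
  shows "m (x + y) z = m x z + m y z" "m z (x + y) = m z x + m z y"
    "m (x - y) z = m x z - m y z" "m z (x - y) = m z x - m z y"
    "m (- x) z = - m x z" "m z (- x) = - m z x"
    "m 0 z = 0" "m z 0 = 0"
    "m (s c x) z = t c (m x z)" "m z (s c x) = t c (m z x)"
proof -
  have l: "Vector_Spaces.linear s t (\<lambda>x. m x z)" and r: "Vector_Spaces.linear s t (\<lambda>x. m z x)"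
    using assms by (auto simp: bilinear_map_def)
  show "m (x + y) z = m x z + m y z" "m z (x + y) = m z x + m z y"
    "m (x - y) z = m x z - m y z" "m z (x - y) = m z x - m z y"
    "m (- x) z = - m x z" "m z (- x) = - m z x"
    "m 0 z = 0" "m z 0 = 0"
    "m (s c x) z = t c (m x z)" "m z (s c x) = t c (m z x)"
    using linear_simps[OF l] linear_simps[OF r] by simp_all
qed

lemma bilinear_mapD:
  assumes "bilinear_map s t m"
  shows "Vector_Spaces.linear s t (\<lambda>x. m x z)" "Vector_Spaces.linear s t (\<lambda>x. m z x)"
    "Vector_Spaces.linear s t (m z)"
  using assms by (auto simp: bilinear_map_def)

lemma bilinear_map_commutator:
  assumes "bilinear_map s s m"
  shows "bilinear_map s s (\<lambda>x y. m x y - m y x)"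
proof -
  have v: "vector_space s"
    using assms linear_vector_spaces(1)[of s s "m undefined"] by (auto simp: bilinear_map_def)
  then interpret vector_space s .
  show ?thesis
    unfolding bilinear_map_def
    by (auto intro!: linearI v simp: bilinear_map_simps[OF assms] scale_right_diff_distrib)
qed

section \<open>A finite-dimensional space identified with its dual by a basis\<close>

context finite_dimensional_vector_space
begin

text \<open>The symmetric form for which the chosen basis is orthonormal. It depends on the basis,
  but it is nondegenerate over every field, so every functional is \<open>coord_form a\<close> for
  exactly one \<open>a\<close>.\<close>

definition coord_form :: "'b \<Rightarrow> 'b \<Rightarrow> 'a" where
  "coord_form x y = (\<Sum>e\<in>Basis. representation Basis x e * representation Basis y e)"

lemma representation_Basis_simps:
  "representation Basis (x + y) e = representation Basis x e + representation Basis y e"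
  "representation Basis (c *s x) e = c * representation Basis x e"
  by (simp_all add: representation_add representation_scale independent_Basis span_Basis)

lemma bilinear_coord_form: "bilinear_map scale (*) coord_form"
  unfolding bilinear_map_def
  by (auto intro!: linearI vector_space_mult vector_space_axioms
      simp: coord_form_def representation_Basis_simps algebra_simps sum.distrib sum_distrib_left)

lemmas form_simps = bilinear_map_simps[OF bilinear_coord_form]

lemma coord_form_commute: "coord_form x y = coord_form y x"
  by (simp add: coord_form_def mult.commute)

lemma coord_form_basis: "e \<in> Basis \<Longrightarrow> coord_form x e = representation Basis x e"
  by (simp add: coord_form_def representation_basis independent_Basis finite_Basis if_distrib
      sum.delta cong: if_cong)

lemma coord_form_expand: "x = (\<Sum>e\<in>Basis. coord_form x e *s e)"
proof -
  have "(\<Sum>e\<in>Basis. representation Basis x e *s e) = x"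
    by (rule sum_representation_eq) (auto simp: independent_Basis span_Basis finite_Basis)
  then show ?thesis
    by (simp add: coord_form_basis)
qed

lemma coord_form_eqI: "(\<And>z. coord_form x z = coord_form y z) \<Longrightarrow> x = y"
  using coord_form_expand[of x] coord_form_expand[of y] by simp

lemma coord_form_eqI': "(\<And>z. coord_form z x = coord_form z y) \<Longrightarrow> x = y"
  using coord_form_eqI[of x y] by (simp add: coord_form_commute)

lemma coord_form_dual [simp]: "coord_form a \<in> dual_space scale"
  using bilinear_coord_form by (auto simp: dual_space_def bilinear_map_def)

lemma dual_eq_coord_form:
  assumes "f \<in> dual_space scale"
  shows "f = coord_form (\<Sum>e\<in>Basis. f e *s e)"
proof
  fix x
  have l: "Vector_Spaces.linear scale (*) f"
    using assms by (simp add: dual_space_def)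
  have l': "Vector_Spaces.linear scale (*) (\<lambda>a. coord_form a x)"
    using bilinear_coord_form by (simp add: bilinear_map_def)
  show "f x = coord_form (\<Sum>e\<in>Basis. f e *s e) x"
    by (subst coord_form_expand[of x])
      (simp add: linear_simps[OF l] linear_simps[OF l'] mult.commute coord_form_commute[of x])
qed

definition sharp :: "('b \<Rightarrow> 'a) \<Rightarrow> 'b" where
  "sharp f = (\<Sum>e\<in>Basis. f e *s e)"

lemma coord_form_sharp: "f \<in> dual_space scale \<Longrightarrow> coord_form (sharp f) = f"
  by (simp add: sharp_def dual_eq_coord_form[symmetric])

lemma sharp_coord_form [simp]: "sharp (coord_form a) = a"
  by (simp add: sharp_def coord_form_expand[symmetric])

lemma dual_cases:
  assumes "f \<in> dual_space scale"
  obtains a where "f = coord_form a"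
  using dual_eq_coord_form[OF assms] by blast

text \<open>The transpose of a linear map, carried from the dual to the space by
  \<open>coord_form\<close>; in other words its adjoint for that form.\<close>

definition dual_map :: "('b \<Rightarrow> 'b) \<Rightarrow> 'b \<Rightarrow> 'b" where
  "dual_map \<phi> a = sharp (coord_form a \<circ> \<phi>)"

lemma coord_form_compose:
  assumes "Vector_Spaces.linear scale scale \<phi>"
  shows "coord_form a \<circ> \<phi> = coord_form (dual_map \<phi> a)"
  unfolding dual_map_def
  by (rule coord_form_sharp[symmetric]) (rule dual_space_compose[OF assms], simp)

lemma coord_form_dual_map:
  assumes "Vector_Spaces.linear scale scale \<phi>"
  shows "coord_form (dual_map \<phi> a) x = coord_form a (\<phi> x)"
    and "coord_form x (dual_map \<phi> a) = coord_form (\<phi> x) a"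
  using coord_form_compose[OF assms, of a]
  by (auto simp: fun_eq_iff coord_form_commute)

lemma linear_dual_map:
  assumes "Vector_Spaces.linear scale scale \<phi>"
  shows "Vector_Spaces.linear scale scale (dual_map \<phi>)"
  by (intro linearI vector_space_axioms)
    (rule coord_form_eqI, simp add: coord_form_dual_map[OF assms] form_simps)+

section \<open>Comultiplications as products on the dual\<close>

text \<open>The value 0 off the dual space is the convention of \<open>tensor_space\<close>. With it
  a comultiplication is equal to some \<open>comul n\<close> as a function, not merely on
  functionals.\<close>

definition comul :: "('b \<Rightarrow> 'b \<Rightarrow> 'b) \<Rightarrow> 'b \<Rightarrow> ('a, 'b) tensor2" where
  "comul n x f g =
    (if f \<in> dual_space scale \<and> g \<in> dual_space scale then coord_form (n (sharp f) (sharp g)) x else 0)"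

lemma comul_coord_form [simp]: "comul n x (coord_form a) (coord_form b) = coord_form (n a b) x"
  by (simp add: comul_def)

lemma tensor_space_outside:
  assumes "t \<in> tensor_space scale" "f \<notin> dual_space scale \<or> g \<notin> dual_space scale"
  shows "t f g = 0"
  using assms by (auto simp: tensor_space_def pure_tensor_def sum_tensor_apply)


lemma tensor_eqI:
  assumes "\<And>f g. f \<notin> dual_space scale \<or> g \<notin> dual_space scale \<Longrightarrow> t f g = 0"
    and "\<And>f g. f \<notin> dual_space scale \<or> g \<notin> dual_space scale \<Longrightarrow> u f g = 0"
    and "\<And>a b. t (coord_form a) (coord_form b) = u (coord_form a) (coord_form b)"
  shows "t = u"
proof (intro ext)
  fix f g
  show "t f g = u f g"
  proof (cases "f \<in> dual_space scale \<and> g \<in> dual_space scale")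
    case True
    then show ?thesis
      using assms(3) dual_cases[of f] dual_cases[of g] by metis
  next
    case False
    then show ?thesis
      using assms(1,2) by simp
  qed
qed

lemma tensor_bilinear:
  assumes "t \<in> tensor_space scale"
  shows "bilinear_map scale (*) (\<lambda>a b. t (coord_form a) (coord_form b))"
  using assms unfolding bilinear_map_def tensor_space_def
  by (auto intro!: linearI vector_space_mult vector_space_axioms
      simp: pure_tensor_def sum_tensor_apply form_simps algebra_simps sum.distrib sum_distrib_left)

text \<open>Expanding both functionals in the basis writes a bilinear form as a finite combination
  of pure tensors of basis vectors.\<close>

lemma tensor_spaceI:
  assumes out: "\<And>f g. f \<notin> dual_space scale \<or> g \<notin> dual_space scale \<Longrightarrow> t f g = 0"
    and bil: "bilinear_map scale (*) (\<lambda>a b. t (coord_form a) (coord_form b))"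
  shows "t \<in> tensor_space scale"
proof -
  define K where "K = Basis \<times> Basis"
  have "finite K"
    by (simp add: K_def finite_Basis)
  then obtain h where h: "bij_betw h {..<card K} K"
    using ex_bij_betw_nat_finite[of K] by (auto simp: atLeast0LessThan)
  \<comment> \<open>\<open>tensor_space\<close> consists of sums of pure tensors without
    coefficients, so the coefficient is absorbed into the first factor.\<close>
  define c where "c = (\<lambda>(e, e'). t (coord_form e) (coord_form e') *s e)"
  have l: "Vector_Spaces.linear scale (*) (\<lambda>a. t (coord_form a) (coord_form b))"
    and r: "Vector_Spaces.linear scale (*) (\<lambda>b. t (coord_form a) (coord_form b))" for a b
    using bil by (auto simp: bilinear_map_def)
  have "t = (\<Sum>k\<in>K. pure_tensor scale (c k) (snd k))"
  proof (rule tensor_eqI)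
    fix a b
    have expand: "t (coord_form e) (coord_form b)
        = (\<Sum>e'\<in>Basis. coord_form b e' * t (coord_form e) (coord_form e'))" for e
    proof -
      have "t (coord_form e) (coord_form b)
          = t (coord_form e) (coord_form (\<Sum>e'\<in>Basis. coord_form b e' *s e'))"
        by (simp only: coord_form_expand[symmetric])
      then show ?thesis
        by (simp add: linear_simps[OF r])
    qed
    have "t (coord_form a) (coord_form b)
        = t (coord_form (\<Sum>e\<in>Basis. coord_form a e *s e)) (coord_form b)"
      by (simp only: coord_form_expand[symmetric])
    also have "\<dots> = (\<Sum>e\<in>Basis. coord_form a e * t (coord_form e) (coord_form b))"
      by (simp add: linear_simps[OF l])
    also have "\<dots> = (\<Sum>e\<in>Basis. \<Sum>e'\<in>Basis.
        coord_form a e * (coord_form b e' * t (coord_form e) (coord_form e')))"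
      by (simp only: expand sum_distrib_left)
    also have "\<dots> = (\<Sum>k\<in>K. coord_form a (c k) * coord_form b (snd k))"
      unfolding K_def by (simp add: sum.cartesian_product c_def case_prod_beta form_simps mult_ac)
    finally show "t (coord_form a) (coord_form b)
        = (\<Sum>k\<in>K. pure_tensor scale (c k) (snd k)) (coord_form a) (coord_form b)"
      by (simp add: sum_tensor_apply pure_tensor_def)
  qed (auto simp: out sum_tensor_apply pure_tensor_def)
  also have "\<dots> = (\<Sum>i<card K. pure_tensor scale (c (h i)) (snd (h i)))"
    by (rule sum.reindex_bij_betw[OF h, symmetric])
  finally show ?thesis
    unfolding tensor_space_def mem_Collect_eq by (intro exI)
qed

lemma comul_outside [simp]:
  "f \<notin> dual_space scale \<or> g \<notin> dual_space scale \<Longrightarrow> comul n x f g = 0"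
  by (auto simp: comul_def)

lemma comul_linear:
  assumes "bilinear_map scale scale n"
  shows "Vector_Spaces.linear scale tensor_scale (comul n)" "comul n x \<in> tensor_space scale"
proof -
  show "Vector_Spaces.linear scale tensor_scale (comul n)"
    by (auto intro!: linearI vector_space_tensor_scale vector_space_axioms
        simp: fun_eq_iff comul_def tensor_scale_def form_simps)
  show "comul n x \<in> tensor_space scale"
    unfolding bilinear_map_def
    by (rule tensor_spaceI) (auto intro!: linearI vector_space_mult vector_space_axioms
        simp: bilinear_map_def bilinear_map_simps[OF assms] form_simps)
qed

text \<open>For fixed functionals the value of \<open>\<Delta> x\<close> is linear in
  \<open>x\<close>, hence is itself \<open>coord_form\<close> of a vector, which is taken as the
  product. With \<open>comul_inject\<close> this makes comultiplications and bilinear products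
  interchangeable.\<close>

lemma comul_exists:
  assumes lin: "Vector_Spaces.linear scale tensor_scale \<Delta>"
    and tens: "\<And>x. \<Delta> x \<in> tensor_space scale"
  obtains n where "bilinear_map scale scale n" "\<Delta> = comul n"
proof -
  define n where "n a b = sharp (\<lambda>x. \<Delta> x (coord_form a) (coord_form b))" for a b
  have "(\<lambda>x. \<Delta> x (coord_form a) (coord_form b)) \<in> dual_space scale" for a b
    unfolding dual_space_def
    by (auto intro!: linearI vector_space_mult vector_space_axioms
        simp: linear_simps[OF lin] tensor_scale_def)
  then have n: "coord_form (n a b) x = \<Delta> x (coord_form a) (coord_form b)" for a b x
    by (simp add: n_def coord_form_sharp)
  have "bilinear_map scale scale n"
    unfolding bilinear_map_def
    by (auto intro!: linearI vector_space_axioms coord_form_eqI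
        simp: form_simps n bilinear_map_simps[OF tensor_bilinear[OF tens]])
  moreover have "\<Delta> = comul n"
    by (rule ext, rule tensor_eqI) (auto simp: n tensor_space_outside[OF tens])
  ultimately show ?thesis
    by (rule that)
qed

lemma comul_inject: "comul n = comul n' \<Longrightarrow> n = n'"
  by (intro ext coord_form_eqI) (metis comul_coord_form)

lemma tensor_map_comul:
  assumes "Vector_Spaces.linear scale scale \<phi>" "Vector_Spaces.linear scale scale \<psi>"
  shows "tensor_map scale \<phi> \<psi> (comul n x) (coord_form a) (coord_form b)
    = coord_form (n (dual_map \<phi> a) (dual_map \<psi> b)) x"
  using assms by (simp add: tensor_map_def coord_form_compose)

lemma tensor_map_outside [simp]:
  "f \<notin> dual_space scale \<or> g \<notin> dual_space scale \<Longrightarrow> tensor_map scale \<phi> \<psi> t f g = 0"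
  by (auto simp: tensor_map_def)

lemma dual_map_id [simp]: "dual_map id a = a" "dual_map (\<lambda>x. x) a = a"
  by (simp_all add: dual_map_def comp_def)

text \<open>Evaluated on three functionals, the two iterated coproducts become
  \<open>n (n a b) c\<close> and \<open>n a (n b c)\<close> paired with \<open>x\<close>, and the
  flip exchanges \<open>a\<close> and \<open>b\<close>. The coalgebra identity is thus the pre-Lie
  identity of \<open>n\<close> tested against every \<open>x\<close>.\<close>

lemma pre_lie_coalgebra_comul:
  assumes "bilinear_map scale scale n"
  shows "pre_lie_coalgebra scale (comul n) \<longleftrightarrow> pre_lie_algebra scale n"
proof -
  note n = bilinear_map_simps[OF assms]
  \<comment> \<open>If an argument is not a functional, the inner coproduct can become the zero
    function. That one is a functional, so the vanishing comes from bilinearity of \<open>n\<close>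
    and not from the default value.\<close>
  have zero: "comul n x (\<lambda>y. 0) h = 0" "comul n x h (\<lambda>y. 0) = 0" for x h
  proof -
    have "(\<lambda>y. 0) = coord_form 0"
      by (simp add: fun_eq_iff form_simps)
    then show "comul n x (\<lambda>y. 0) h = 0" "comul n x h (\<lambda>y. 0) = 0"
      by (cases "h \<in> dual_space scale"; auto simp: n form_simps elim!: dual_cases)+
  qed
  have eval: "comul n x (\<lambda>x. comul n x (coord_form a) (coord_form b)) (coord_form c)
      = coord_form (n (n a b) c) x"
    "comul n x (coord_form a) (\<lambda>x. comul n x (coord_form b) (coord_form c))
      = coord_form (n a (n b c)) x" for x a b c
    by simp_all
  have "(comult_left (comul n) (comul n x) - comult_right (comul n) (comul n x) =
      flip_left (comult_left (comul n) (comul n x)) - flip_left (comult_right (comul n) (comul n x)))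
    \<longleftrightarrow> (\<forall>a b c. coord_form (n (n a b) c - n a (n b c)) x = coord_form (n (n b a) c - n b (n a c)) x)"
    (is "?l \<longleftrightarrow> ?r") for x
  proof
    assume eq: "?l"
    show ?r
    proof (intro allI)
      fix a b c
      show "coord_form (n (n a b) c - n a (n b c)) x = coord_form (n (n b a) c - n b (n a c)) x"
        using fun_cong[OF fun_cong[OF fun_cong[OF eq, of "coord_form a"], of "coord_form b"],
            of "coord_form c"]
        by (simp add: comult_left_def comult_right_def flip_left_def form_simps)
    qed
  next
    assume r: ?r
    show ?l
    proof (intro ext)
      fix f g h
      show "(comult_left (comul n) (comul n x) - comult_right (comul n) (comul n x)) f g h =
          (flip_left (comult_left (comul n) (comul n x))
            - flip_left (comult_right (comul n) (comul n x))) f g h"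
      proof (cases "f \<in> dual_space scale \<and> g \<in> dual_space scale \<and> h \<in> dual_space scale")
        case True
        then obtain a b c where "f = coord_form a" "g = coord_form b" "h = coord_form c"
          by (meson dual_cases)
        then show ?thesis
          using r by (simp add: comult_left_def comult_right_def flip_left_def form_simps)
      next
        case False
        then show ?thesis
          by (auto simp: comult_left_def comult_right_def flip_left_def zero)
      qed
    qed
  qed
  then have "pre_lie_coalgebra scale (comul n) \<longleftrightarrow>
      (\<forall>x a b c. coord_form (n (n a b) c - n a (n b c)) x = coord_form (n (n b a) c - n b (n a c)) x)"
    using comul_linear[OF assms] by (auto simp: pre_lie_coalgebra_def)
  also have "\<dots> \<longleftrightarrow> pre_lie_algebra scale n"
    using assms by (auto simp: pre_lie_algebra_def intro: coord_form_eqI)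
  finally show ?thesis .
qed

text \<open>Transposition moves \<open>S\<close> from the tensor factors to the arguments of
  \<open>n\<close>, and from the argument of the coproduct to the value of \<open>n\<close>.\<close>

lemma averaging_coalgebra_comul:
  assumes n: "bilinear_map scale scale n" and S: "Vector_Spaces.linear scale scale S"
  shows "averaging_pre_lie_coalgebra scale (comul n) S \<longleftrightarrow>
    averaging_pre_lie_algebra scale n (dual_map S)"
proof -
  have "(tensor_map scale S S (comul n x) = tensor_map scale S id (comul n (S x))) \<longleftrightarrow>
      (\<forall>a b. coord_form (n (dual_map S a) (dual_map S b)) x = coord_form (dual_map S (n (dual_map S a) b)) x)"
    (is "?l \<longleftrightarrow> ?r") for x
  proof
    assume ?l
    then show ?r
      using tensor_map_comul[OF S S, of n x] tensor_map_comul[OF S linear_id, of n "S x"]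
      by (simp add: coord_form_dual_map[OF S])
  next
    assume ?r
    then show ?l
      by (intro tensor_eqI)
        (auto simp: tensor_map_comul[OF S S] tensor_map_comul[OF S linear_id] coord_form_dual_map[OF S])
  qed
  moreover have "(tensor_map scale S S (comul n x) = tensor_map scale id S (comul n (S x))) \<longleftrightarrow>
      (\<forall>a b. coord_form (n (dual_map S a) (dual_map S b)) x = coord_form (dual_map S (n a (dual_map S b))) x)"
    (is "?l \<longleftrightarrow> ?r") for x
  proof
    assume ?l
    then show ?r
      using tensor_map_comul[OF S S, of n x] tensor_map_comul[OF linear_id S, of n "S x"]
      by (simp add: coord_form_dual_map[OF S])
  next
    assume ?r
    then show ?l
      by (intro tensor_eqI)
        (auto simp: tensor_map_comul[OF S S] tensor_map_comul[OF linear_id S] coord_form_dual_map[OF S])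
  qed
  ultimately have "averaging_pre_lie_coalgebra scale (comul n) S \<longleftrightarrow> pre_lie_algebra scale n \<and>
      (\<forall>x a b. coord_form (n (dual_map S a) (dual_map S b)) x = coord_form (dual_map S (n (dual_map S a) b)) x)
      \<and> (\<forall>x a b. coord_form (n (dual_map S a) (dual_map S b)) x = coord_form (dual_map S (n a (dual_map S b))) x)"
    using S unfolding averaging_pre_lie_coalgebra_def pre_lie_coalgebra_comul[OF n] by blast
  also have "\<dots> \<longleftrightarrow> averaging_pre_lie_algebra scale n (dual_map S)"
    using linear_dual_map[OF S] unfolding averaging_pre_lie_algebra_def
    by (metis coord_form_eqI)
  finally show ?thesis .
qed

text \<open>The two compatibility conditions of a pre-Lie bialgebra, evaluated on the functionals of
  \<open>a\<close> and \<open>b\<close>. The operators acting on tensor factors appear as transposes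
  inside \<open>n\<close>.\<close>

definition dual_products :: "('b \<Rightarrow> 'b \<Rightarrow> 'b) \<Rightarrow> ('b \<Rightarrow> 'b \<Rightarrow> 'b) \<Rightarrow> bool" where
  "dual_products m n \<longleftrightarrow> pre_lie_algebra scale m \<and> pre_lie_algebra scale n \<and>
    (\<forall>x y a b.
      coord_form (n a b) (m x y - m y x) =
        coord_form (n (dual_map (m x) a) b + n a (dual_map (\<lambda>z. m x z - m z x) b)) y
        - coord_form (n (dual_map (m y) a) b + n a (dual_map (\<lambda>z. m y z - m z y) b)) x) \<and>
    (\<forall>x y a b.
      coord_form (n a b - n b a) (m x y) =
        coord_form (n a (dual_map (\<lambda>z. m z y) b) - n b (dual_map (\<lambda>z. m z y) a)) x
        + coord_form (n (dual_map (m x) a) b + n a (dual_map (m x) b)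
            - n (dual_map (m x) b) a - n b (dual_map (m x) a)) y)"

lemma pre_lie_bialgebra_comul:
  assumes n: "bilinear_map scale scale n"
  shows "pre_lie_bialgebra scale m (comul n) \<longleftrightarrow> dual_products m n"
\<comment> \<open>The transposes of the multiplications are meaningful for bilinear
  \<open>m\<close>; for any other \<open>m\<close> both sides are false.\<close>
proof (cases "bilinear_map scale scale m")
  case True
  note l = bilinear_mapD[OF True] bilinear_mapD(3)[OF bilinear_map_commutator[OF True]]
  have minus: "m x - (\<lambda>z. m z x) = (\<lambda>z. m x z - m z x)" for x
    by (simp add: fun_eq_iff)
  note ev = tensor_map_comul[OF l(1) linear_id] tensor_map_comul[OF l(3) linear_id]
    tensor_map_comul[OF linear_id l(1)] tensor_map_comul[OF linear_id l(3)]
    tensor_map_comul[OF linear_id l(4)]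
  have eq1: "(comul n (m x y - m y x) =
      (tensor_map scale (m x) id (comul n y) + tensor_map scale id (m x - (\<lambda>z. m z x)) (comul n y))
      - (tensor_map scale (m y) id (comul n x) + tensor_map scale id (m y - (\<lambda>z. m z y)) (comul n x)))
    \<longleftrightarrow> (\<forall>a b. coord_form (n a b) (m x y - m y x) =
        coord_form (n (dual_map (m x) a) b + n a (dual_map (\<lambda>z. m x z - m z x) b)) y
        - coord_form (n (dual_map (m y) a) b + n a (dual_map (\<lambda>z. m y z - m z y) b)) x)"
    (is "?l = ?u \<longleftrightarrow> ?r") for x y
  proof
    assume eq: "?l = ?u"
    show ?r
    proof (intro allI)
      fix a b
      have "?l (coord_form a) (coord_form b) = ?u (coord_form a) (coord_form b)"
        by (simp only: eq)
      then show "coord_form (n a b) (m x y - m y x) =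
        coord_form (n (dual_map (m x) a) b + n a (dual_map (\<lambda>z. m x z - m z x) b)) y
        - coord_form (n (dual_map (m y) a) b + n a (dual_map (\<lambda>z. m y z - m z y) b)) x"
        by (simp add: minus ev form_simps)
    qed
  next
    assume ?r
    then show "?l = ?u"
      by (intro tensor_eqI) (auto simp: minus ev form_simps)
  qed
  have eq2: "(comul n (m x y) - flip (comul n (m x y)) =
      tensor_map scale id (\<lambda>z. m z y) (comul n x) - flip (tensor_map scale id (\<lambda>z. m z y) (comul n x))
      + (tensor_map scale (m x) id (comul n y) + tensor_map scale id (m x) (comul n y))
      - flip (tensor_map scale (m x) id (comul n y) + tensor_map scale id (m x) (comul n y)))
    \<longleftrightarrow> (\<forall>a b. coord_form (n a b - n b a) (m x y) =
        coord_form (n a (dual_map (\<lambda>z. m z y) b) - n b (dual_map (\<lambda>z. m z y) a)) x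
        + coord_form (n (dual_map (m x) a) b + n a (dual_map (m x) b)
            - n (dual_map (m x) b) a - n b (dual_map (m x) a)) y)"
    (is "?l = ?u \<longleftrightarrow> ?r") for x y
  proof
    assume eq: "?l = ?u"
    show ?r
    proof (intro allI)
      fix a b
      have "?l (coord_form a) (coord_form b) = ?u (coord_form a) (coord_form b)"
        by (simp only: eq)
      then show "coord_form (n a b - n b a) (m x y) =
        coord_form (n a (dual_map (\<lambda>z. m z y) b) - n b (dual_map (\<lambda>z. m z y) a)) x
        + coord_form (n (dual_map (m x) a) b + n a (dual_map (m x) b)
            - n (dual_map (m x) b) a - n b (dual_map (m x) a)) y"
        by (simp add: flip_def ev form_simps algebra_simps)
    qed
  next
    assume ?r
    then show "?l = ?u"
      by (intro tensor_eqI) (auto simp: flip_def ev form_simps algebra_simps)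
  qed
  show ?thesis
    unfolding pre_lie_bialgebra_def dual_products_def Let_def pre_lie_coalgebra_comul[OF n]
    unfolding eq1 eq2 by blast
next
  case False
  then show ?thesis
    by (simp add: pre_lie_bialgebra_def dual_products_def pre_lie_algebra_def)
qed

end

section \<open>Products on a hyperbolic space\<close>

text \<open>The Jacobi sum of the commutator is minus the cyclic sum of the associator differences
  \<open>D\<close>.\<close>

lemma pre_lie_jacobi:
  assumes "pre_lie_algebra s f"
  shows "f w (f x y - f y x) - f (f x y - f y x) w + (f x (f y w - f w y) - f (f y w - f w y) x)
    + (f y (f w x - f x w) - f (f w x - f x w) y) = 0"
proof -
  note f = bilinear_map_simps[OF assms[unfolded pre_lie_algebra_def, THEN conjunct1]]
  define D where "D x y z = f (f x y) z - f x (f y z) - (f (f y x) z - f y (f x z))" for x y z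
  have "D x y z = 0" for x y z
    using assms by (simp add: pre_lie_algebra_def D_def)
  then have "- (D x y w + D y w x + D w x y) = 0"
    by simp
  then show ?thesis
    by (simp add: D_def f algebra_simps)
qed

text \<open>Two copies of \<open>A\<close> in \<open>V\<close>, with coordinates \<open>p\<close>
  and \<open>q\<close>. The copy under \<open>j\<close> is meant as the dual of \<open>A\<close>,
  its vectors labelled by \<open>A\<close> through \<open>coord_form\<close>; this is the role of
  \<open>b\<close> in a Manin triple.\<close>

locale framed = A: finite_dimensional_vector_space sA basisA + V: vector_space sV
  for sA :: "'k::field \<Rightarrow> 'a::ab_group_add \<Rightarrow> 'a" and basisA
    and sV :: "'k \<Rightarrow> 'v::ab_group_add \<Rightarrow> 'v" +
  fixes i j :: "'a \<Rightarrow> 'v" and p q :: "'v \<Rightarrow> 'a"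
  assumes linear_frame: "Vector_Spaces.linear sA sV i" "Vector_Spaces.linear sA sV j"
      "Vector_Spaces.linear sV sA p" "Vector_Spaces.linear sV sA q"
    and frame_simps [simp]: "p (i x) = x" "p (j x) = 0" "q (i x) = 0" "q (j x) = x"
    and frame_decomp: "i (p v) + j (q v) = v"
begin

lemmas frame_linear_simps =
  linear_frame[THEN linear_simps(1)] linear_frame[THEN linear_simps(2)]
  linear_frame[THEN linear_simps(3)] linear_frame[THEN linear_simps(4)]
  linear_frame[THEN linear_simps(5)]

lemma frame_eqI: "p v = p w \<Longrightarrow> q v = q w \<Longrightarrow> v = w"
  by (metis frame_decomp)

lemma frame_inj: "i x = i y \<longleftrightarrow> x = y" "j x = j y \<longleftrightarrow> x = y"
  by (metis frame_simps(1)) (metis frame_simps(4))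

text \<open>The standard symplectic form on the sum of a space and its dual. The sign is chosen so
  that \<open>j a\<close> induces the functional \<open>coord_form a\<close> on \<open>A\<close>, in
  agreement with \<open>dual_functional\<close>.\<close>

definition hyp :: "'v \<Rightarrow> 'v \<Rightarrow> 'k" where
  "hyp v w = A.coord_form (q v) (p w) - A.coord_form (q w) (p v)"

lemma bilinear_hyp: "bilinear_map sV (*) hyp"
  unfolding bilinear_map_def
  by (auto intro!: linearI vector_space_mult V.vector_space_axioms
      simp: hyp_def frame_linear_simps A.form_simps algebra_simps)

lemmas hyp_linear_simps = bilinear_map_simps[OF bilinear_hyp]

lemma hyp_skew: "hyp v w = - hyp w v"
  by (simp add: hyp_def)

lemma hyp_simps [simp]: "hyp (i x) (i y) = 0" "hyp (j a) (j b) = 0"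
    "hyp (j a) (i x) = A.coord_form a x" "hyp (i x) (j a) = - A.coord_form a x"
  by (simp_all add: hyp_def A.form_simps)

lemma form_q: "A.coord_form (q v) x = hyp v (i x)"
  and form_p: "A.coord_form a (p v) = hyp (j a) v"
  by (simp_all add: hyp_def A.form_simps)

lemma hyp_nondegenerate:
  assumes "\<And>u. hyp v u = hyp w u"
  shows "v = w"
proof (rule frame_eqI)
  show "q v = q w"
    by (rule A.coord_form_eqI) (simp add: form_q assms)
  show "p v = p w"
    using assms by (intro A.coord_form_eqI') (simp add: form_p hyp_skew[of "j _"])
qed

end

text \<open>The pre-Lie identity is deliberately not assumed: the aim is to characterise it by
  conditions on \<open>m\<close> and \<open>n\<close>.\<close>

locale framed_product = framed sA basisA sV i j p q
  for sA :: "'k::field \<Rightarrow> 'a::ab_group_add \<Rightarrow> 'a" and basisA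
    and sV :: "'k \<Rightarrow> 'v::ab_group_add \<Rightarrow> 'v" and i j p q +
  fixes mult :: "'v \<Rightarrow> 'v \<Rightarrow> 'v" and m n :: "'a \<Rightarrow> 'a \<Rightarrow> 'a"
  assumes bilinear_mult: "bilinear_map sV sV mult"
    and invariant: "hyp (mult u v) w + hyp v (mult u w - mult w u) = 0"
    and mult_i: "mult (i x) (i y) = i (m x y)"
    and mult_j: "mult (j a) (j b) = j (n a b)"
begin

lemmas mult_simps = bilinear_map_simps[OF bilinear_mult]

abbreviation comm where "comm x y \<equiv> mult x y - mult y x"

lemma bilinear_m: "bilinear_map sA sA m"
proof -
  have "m = (\<lambda>x y. p (mult (i x) (i y)))"
    by (simp add: mult_i)
  then show ?thesis
    by (auto simp: bilinear_map_def frame_linear_simps mult_simps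
        intro!: linearI A.vector_space_axioms)
qed

lemma bilinear_n: "bilinear_map sA sA n"
proof -
  have "n = (\<lambda>x y. q (mult (j x) (j y)))"
    by (simp add: mult_j)
  then show ?thesis
    by (auto simp: bilinear_map_def frame_linear_simps mult_simps
        intro!: linearI A.vector_space_axioms)
qed

lemmas m_simps = bilinear_map_simps[OF bilinear_m]
lemmas n_simps = bilinear_map_simps[OF bilinear_n]

lemma hyp_left_mult: "hyp (mult x y) z = - hyp y (comm x z)"
  using invariant[of x y z] by (simp add: eq_neg_iff_add_eq_0)

lemma hyp_right_mult: "hyp (mult x y) z = hyp x (mult z y)"
proof -
  have "hyp (mult x y) z = - hyp (mult z y) x"
    by (simp add: hyp_left_mult hyp_linear_simps)
  then show ?thesis
    by (simp add: hyp_skew[of x])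
qed

lemma hyp_mult_swap: "hyp (mult x y) z = - hyp (mult z y) x"
  by (simp add: hyp_left_mult hyp_linear_simps)

lemma hyp_mult_cyclic: "hyp (mult x y) z = hyp (mult x z) y - hyp (mult z x) y"
  by (simp add: hyp_left_mult[of x y z] hyp_skew[of y] hyp_linear_simps)

text \<open>The swap and cyclic rules bring every mixed value of the trilinear form to one in which
  both factors of the product lie in the same copy, where \<open>m\<close> or \<open>n\<close> is
  known. Hence \<open>mult\<close> is determined by \<open>m\<close> and \<open>n\<close>, which
  later yields uniqueness of the triple.\<close>

lemma hyp_mult:
  "hyp (mult v w) u =
    A.coord_form (q v) (m (p u) (p w)) - A.coord_form (q w) (m (p v) (p u) - m (p u) (p v))
    - A.coord_form (q u) (m (p v) (p w))
    + A.coord_form (n (q v) (q w)) (p u) + A.coord_form (n (q v) (q u) - n (q u) (q v)) (p w)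
    - A.coord_form (n (q u) (q w)) (p v)"
proof -
  have 1: "hyp (mult (i x) (i y)) (j c) = - A.coord_form c (m x y)" for x y c
    by (simp add: mult_i)
  have 2: "hyp (mult (j a) (i y)) (i z) = A.coord_form a (m z y)" for a y z
    by (subst hyp_mult_swap) (simp add: 1)
  have 3: "hyp (mult (i x) (j b)) (i z) = - A.coord_form b (m x z - m z x)" for x b z
    by (subst hyp_mult_cyclic) (simp add: 1 A.form_simps)
  have 4: "hyp (mult (j a) (j b)) (i z) = A.coord_form (n a b) z" for a b z
    by (simp add: mult_j)
  have 5: "hyp (mult (i x) (j b)) (j c) = - A.coord_form (n c b) x" for x b c
    by (subst hyp_mult_swap) (simp add: 4)
  have 6: "hyp (mult (j a) (i y)) (j c) = A.coord_form (n a c - n c a) y" for a y c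
    by (subst hyp_mult_cyclic) (simp add: 4 A.form_simps)
  have 7: "hyp (mult (i x) (i y)) (i z) = 0" "hyp (mult (j a) (j b)) (j c) = 0" for x y z a b c
    by (simp_all add: mult_i mult_j)
  have "hyp (mult v w) u = hyp (mult (i (p v) + j (q v)) (i (p w) + j (q w))) (i (p u) + j (q u))"
    by (simp add: frame_decomp)
  then show ?thesis
    by (simp add: mult_simps hyp_linear_simps 1 2 3 4 5 6 7 A.form_simps)
qed

text \<open>The deviation of \<open>mult\<close> from being pre-Lie at \<open>x, y, z\<close>, paired with \<open>w\<close>; in this form
  the invariance under cyclic permutations of \<open>x, y, w\<close> is visible.\<close>

definition defect :: "'v \<Rightarrow> 'v \<Rightarrow> 'v \<Rightarrow> 'v \<Rightarrow> 'k" where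
  "defect x y z w = hyp (comm x y) (mult w z) + hyp (comm y w) (mult x z) + hyp (comm w x) (mult y z)"

lemma defect_pre_lie:
  "hyp (mult (mult x y) z - mult x (mult y z) - (mult (mult y x) z - mult y (mult x z))) w = defect x y z w"
  by (simp add: defect_def hyp_linear_simps hyp_right_mult[of "mult _ _" z w] hyp_left_mult[of _ "mult _ _" w]
      hyp_skew[of "mult x w"] hyp_skew[of "mult w x"] hyp_skew[of "mult y w"] hyp_skew[of "mult w y"])

text \<open>This form serves when \<open>x, y, w\<close> lie in one copy: the Jacobi identity there
  kills the defect for every \<open>z\<close>, even one from the other copy.\<close>

lemma defect_jacobi: "defect x y z w = hyp z (comm w (comm x y) + comm x (comm y w) + comm y (comm w x))"
proof -
  have "hyp (comm x y) (mult w z) = hyp z (comm w (comm x y))" for x y w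
    by (subst hyp_skew) (simp only: hyp_left_mult minus_minus)
  then show ?thesis
    by (simp add: defect_def hyp_linear_simps)
qed

lemma defect_cyclic: "defect x y z w = defect y w z x"
  by (simp add: defect_def)

lemma defect_add:
  "defect (x + x') y z w = defect x y z w + defect x' y z w" "defect x (y + y') z w = defect x y z w + defect x y' z w"
  "defect x y (z + z') w = defect x y z w + defect x y z' w" "defect x y z (w + w') = defect x y z w + defect x y z w'"
  by (simp_all add: defect_def mult_simps hyp_linear_simps algebra_simps)

lemma pre_lie_iff_defect: "pre_lie_algebra sV mult \<longleftrightarrow> (\<forall>x y z w. defect x y z w = 0)"
proof
  assume "pre_lie_algebra sV mult"
  then show "\<forall>x y z w. defect x y z w = 0"
    unfolding defect_pre_lie[symmetric] by (simp add: pre_lie_algebra_def hyp_linear_simps(7))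
next
  assume defect: "\<forall>x y z w. defect x y z w = 0"
  have "mult (mult x y) z - mult x (mult y z) - (mult (mult y x) z - mult y (mult x z)) = 0" for x y z
    by (rule hyp_nondegenerate) (simp only: defect_pre_lie defect hyp_linear_simps(7))
  then show "pre_lie_algebra sV mult"
    using bilinear_mult by (simp add: pre_lie_algebra_def)
qed

lemma dual_map_eqs:
  "A.coord_form x (A.dual_map (\<lambda>c. n c b) y) = A.coord_form (n x b) y"
  "A.coord_form x (A.dual_map (n b) y) = A.coord_form (n b x) y"
  "A.coord_form x (A.dual_map (\<lambda>c. n b c - n c b) y) = A.coord_form (n b x - n x b) y"
  using A.coord_form_dual_map(2)[OF bilinear_mapD(1)[OF bilinear_n]]
    A.coord_form_dual_map(2)[OF bilinear_mapD(3)[OF bilinear_n]]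
    A.coord_form_dual_map(2)[OF bilinear_mapD(3)[OF bilinear_map_commutator[OF bilinear_n]]]
  by auto

lemma dual_map_eqs':
  "A.coord_form (A.dual_map (\<lambda>c. m c b) y) x = A.coord_form y (m x b)"
  "A.coord_form (A.dual_map (m b) y) x = A.coord_form y (m b x)"
  "A.coord_form (A.dual_map (\<lambda>c. m b c - m c b) y) x = A.coord_form y (m b x - m x b)"
  using A.coord_form_dual_map(1)[OF bilinear_mapD(1)[OF bilinear_m]]
    A.coord_form_dual_map(1)[OF bilinear_mapD(3)[OF bilinear_m]]
    A.coord_form_dual_map(1)[OF bilinear_mapD(3)[OF bilinear_map_commutator[OF bilinear_m]]]
  by auto

text \<open>The products between the copies are, up to sign, transposes of multiplications and
  commutators, as in the matched pair of a double. These formulas dictate the construction of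
  \<open>double_mult\<close>.\<close>

lemma mixed_components:
  "p (mult (i x) (j b)) = A.dual_map (\<lambda>c. n c b) x"
  "q (mult (i x) (j b)) = - A.dual_map (\<lambda>z. m x z - m z x) b"
  "p (mult (j a) (i y)) = - A.dual_map (\<lambda>c. n a c - n c a) y"
  "q (mult (j a) (i y)) = A.dual_map (\<lambda>z. m z y) a"
  "p (comm (i x) (j a)) = A.dual_map (n a) x"
  "q (comm (i x) (j a)) = - A.dual_map (m x) a"
  "p (comm (j a) (i x)) = - A.dual_map (n a) x"
  "q (comm (j a) (i x)) = A.dual_map (m x) a"
  \<comment> \<open>\<open>form_q\<close> has its vector in the first slot of the form and
    \<open>form_p\<close> in the second, so the components need different extensionality rules;
    backtracking selects the right one.\<close>
  by (rule A.coord_form_eqI A.coord_form_eqI',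
      simp add: form_p form_q hyp_skew[of "j _" "mult _ _"] hyp_mult hyp_linear_simps frame_linear_simps
        m_simps n_simps A.form_simps dual_map_eqs dual_map_eqs')+

lemma hyp_comm_mult:
  "hyp (comm (i x) (j a)) (mult (j b) (i y)) =
    A.coord_form (n b (A.dual_map (m x) a) - n (A.dual_map (m x) a) b) y
    - A.coord_form (n a (A.dual_map (\<lambda>z. m z y) b)) x"
  "hyp (comm (i x) (j a)) (mult (i y) (j b)) =
    A.coord_form (n a (A.dual_map (\<lambda>z. m y z - m z y) b)) x
    - A.coord_form (n (A.dual_map (m x) a) b) y"
  "hyp (comm (j a) (i x)) u = - hyp (comm (i x) (j a)) u"
proof -
  show "hyp (comm (j a) (i x)) u = - hyp (comm (i x) (j a)) u"
    by (simp add: hyp_linear_simps)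
qed (simp_all add: hyp_def mixed_components A.form_simps n_simps dual_map_eqs)

text \<open>With two arguments from each copy the defect is, up to sign, one of the compatibility
  conditions. With \<open>z\<close> in the copy of \<open>A\<close> it is the condition on the
  antisymmetrised coproduct; with \<open>z\<close> in the dual copy, in
  \<open>defect_cross_j\<close>, it is the one on commutators.\<close>

lemma defect_cross_i:
  "defect (j a) (j b) (i y) (i x) =
    A.coord_form (n a b - n b a) (m x y)
    - (A.coord_form (n a (A.dual_map (\<lambda>z. m z y) b) - n b (A.dual_map (\<lambda>z. m z y) a)) x
        + A.coord_form (n (A.dual_map (m x) a) b + n a (A.dual_map (m x) b)
            - n (A.dual_map (m x) b) a - n b (A.dual_map (m x) a)) y)"
  unfolding defect_def hyp_comm_mult mult_i mult_j
  by (simp add: A.form_simps hyp_linear_simps)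

lemma defect_cross_j:
  "defect (i x) (i y) (j b) (j a) =
    (A.coord_form (n (A.dual_map (m x) a) b + n a (A.dual_map (\<lambda>z. m x z - m z x) b)) y
        - A.coord_form (n (A.dual_map (m y) a) b + n a (A.dual_map (\<lambda>z. m y z - m z y) b)) x)
    - A.coord_form (n a b) (m x y - m y x)"
  unfolding defect_def hyp_comm_mult mult_i mult_j
  by (simp add: A.form_simps hyp_linear_simps)

lemma pre_lie_iff_dual_products: "pre_lie_algebra sV mult \<longleftrightarrow> A.dual_products m n"
proof
  assume pl: "pre_lie_algebra sV mult"
  have assoc: "mult (mult u v) w - mult u (mult v w) = mult (mult v u) w - mult v (mult u w)" for u v w
    using pl by (simp add: pre_lie_algebra_def)
  have "pre_lie_algebra sA m"
    unfolding pre_lie_algebra_def frame_inj(1)[symmetric]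
    using bilinear_m assoc[of "i _" "i _" "i _"] by (simp add: mult_i frame_linear_simps)
  moreover have "pre_lie_algebra sA n"
    unfolding pre_lie_algebra_def frame_inj(2)[symmetric]
    using bilinear_n assoc[of "j _" "j _" "j _"] by (simp add: mult_j frame_linear_simps)
  moreover have defect: "defect u v w z = 0" for u v w z
    using pl by (simp add: pre_lie_iff_defect)
  ultimately show "A.dual_products m n"
    using defect_cross_i defect_cross_j by (simp add: A.dual_products_def)
next
  assume d: "A.dual_products m n"
  then have plm: "pre_lie_algebra sA m" and pln: "pre_lie_algebra sA n"
    by (auto simp: A.dual_products_def)
  have assoc_m: "m (m x y) z - m x (m y z) - (m (m y x) z - m y (m x z)) = 0" for x y z
    using plm by (simp add: pre_lie_algebra_def)
  have assoc_n: "n (n x y) z - n x (n y z) - (n (n y x) z - n y (n x z)) = 0" for x y z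
    using pln by (simp add: pre_lie_algebra_def)
  have t1: "defect (i x) (i y) (i z) w = 0" for x y z w
  proof -
    have "mult (mult (i x) (i y)) (i z) - mult (i x) (mult (i y) (i z))
        - (mult (mult (i y) (i x)) (i z) - mult (i y) (mult (i x) (i z)))
      = i (m (m x y) z - m x (m y z) - (m (m y x) z - m y (m x z)))"
      by (simp only: mult_i frame_linear_simps)
    then show ?thesis
      by (simp only: defect_pre_lie[symmetric] assoc_m frame_linear_simps hyp_linear_simps)
  qed
  have t3: "defect (i x) (i y) z (i w) = 0" for x y z w
  proof -
    have "comm (i w) (comm (i x) (i y)) + comm (i x) (comm (i y) (i w))
        + comm (i y) (comm (i w) (i x))
      = i (m w (m x y - m y x) - m (m x y - m y x) w
        + (m x (m y w - m w y) - m (m y w - m w y) x)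
        + (m y (m w x - m x w) - m (m w x - m x w) y))"
      by (simp only: mult_i mult_simps m_simps frame_linear_simps)
    then show ?thesis
      by (simp only: defect_jacobi pre_lie_jacobi[OF plm] frame_linear_simps hyp_linear_simps)
  qed
  have t2: "defect (j x) (j y) (j z) w = 0" for x y z w
  proof -
    have "mult (mult (j x) (j y)) (j z) - mult (j x) (mult (j y) (j z))
        - (mult (mult (j y) (j x)) (j z) - mult (j y) (mult (j x) (j z)))
      = j (n (n x y) z - n x (n y z) - (n (n y x) z - n y (n x z)))"
      by (simp only: mult_j frame_linear_simps)
    then show ?thesis
      by (simp only: defect_pre_lie[symmetric] assoc_n frame_linear_simps hyp_linear_simps)
  qed
  have t4: "defect (j x) (j y) z (j w) = 0" for x y z w
  proof -
    have "comm (j w) (comm (j x) (j y)) + comm (j x) (comm (j y) (j w))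
        + comm (j y) (comm (j w) (j x))
      = j (n w (n x y - n y x) - n (n x y - n y x) w
        + (n x (n y w - n w y) - n (n y w - n w y) x)
        + (n y (n w x - n x w) - n (n w x - n x w) y))"
      by (simp only: mult_j mult_simps n_simps frame_linear_simps)
    then show ?thesis
      by (simp only: defect_jacobi pre_lie_jacobi[OF pln] frame_linear_simps hyp_linear_simps)
  qed
  have t5: "defect (j a) (j b) (i y) (i x) = 0" for a b x y
    using d unfolding defect_cross_i A.dual_products_def by simp
  have t6: "defect (i x) (i y) (j b) (j a) = 0" for a b x y
    using d unfolding defect_cross_j A.dual_products_def by simp
  \<comment> \<open>Expansion gives sixteen terms, one for each choice of copies, and
    \<open>x, y, w\<close> may be rotated. If these three lie in one copy, \<open>t3\<close> or
    \<open>t4\<close> applies. Otherwise two of them share a copy and are moved to the front; then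
    \<open>z\<close> is in that copy (\<open>t1\<close>, \<open>t2\<close>) or in the other one
    (\<open>t5\<close>, \<open>t6\<close>).\<close>
  have "defect x y z w = 0" for x y z w
  proof -
    have "defect x y z w = defect (i (p x) + j (q x)) (i (p y) + j (q y)) (i (p z) + j (q z)) (i (p w) + j (q w))"
      by (simp add: frame_decomp)
    also have "\<dots> = 0"
      by (simp add: defect_add t1 t2 t3 t4 t5 t6 defect_cyclic[of "i _" "j _" _ "i _"]
         defect_cyclic[of "j _" "i _" _ "i _"] defect_cyclic[of "j _" "i _" _ "j _"] defect_cyclic[of "i _" "j _" _ "j _"])
    finally show ?thesis .
  qed
  then show "pre_lie_algebra sV mult"
    by (simp add: pre_lie_iff_defect)
qed

end

section \<open>Averaging operators on a hyperbolic space\<close>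

context framed_product
begin

lemma averaging_iff:
  assumes pl: "pre_lie_algebra sV mult"
    and P: "Vector_Spaces.linear sV sV P" and P': "Vector_Spaces.linear sA sA P'"
    and P_i: "\<And>x. P (i x) = i (P' x)" and P_j: "\<And>a. P (j a) = j (A.dual_map P' a)"
    and selfadj: "\<And>u v. hyp (P u) v = hyp u (P v)"
  shows "averaging_pre_lie_algebra sV mult P \<longleftrightarrow>
    averaging_pre_lie_algebra sA m P' \<and> averaging_pre_lie_algebra sA n (A.dual_map P')"
proof
  note avg = averaging_pre_lie_algebra_def
  have plm: "pre_lie_algebra sA m" and pln: "pre_lie_algebra sA n"
    using pl by (auto simp: pre_lie_iff_dual_products A.dual_products_def)
  note dual = A.coord_form_dual_map[OF P'] and P'' = A.linear_dual_map[OF P']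
  {
    assume "averaging_pre_lie_algebra sV mult P"
    then have *: "mult (P u) (P v) = P (mult (P u) v)" "mult (P u) (P v) = P (mult u (P v))" for u v
      unfolding avg by blast+
    show "averaging_pre_lie_algebra sA m P' \<and> averaging_pre_lie_algebra sA n (A.dual_map P')"
      using plm pln P' P'' *(1)[of "i _" "i _"] *(2)[of "i _" "i _"] *(1)[of "j _" "j _"] *(2)[of "j _" "j _"]
      by (simp add: avg P_i P_j mult_i mult_j frame_inj)
  next
    assume "averaging_pre_lie_algebra sA m P' \<and> averaging_pre_lie_algebra sA n (A.dual_map P')"
    then have am: "m (P' x) (P' y) = P' (m (P' x) y)" "P' (m x (P' y)) = P' (m (P' x) y)"
      and an: "n (A.dual_map P' x) (A.dual_map P' y) = A.dual_map P' (n (A.dual_map P' x) y)"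
        "A.dual_map P' (n x (A.dual_map P' y)) = A.dual_map P' (n (A.dual_map P' x) y)"
      for x y
      by (metis avg)+
    \<comment> \<open>By self-adjointness the averaging identity says that the three scalars
      obtained from the form of \<open>mult x y\<close> and \<open>z\<close> by applying
      \<open>P\<close> to two of the arguments coincide. This is stable under the swap and cyclic
      rules, so the eight choices of copies reduce to those whose first two arguments lie in one
      copy.\<close>
    define W where "W x y z \<longleftrightarrow> hyp (mult (P x) (P y)) z = hyp (mult (P x) y) (P z) \<and>
        hyp (mult (P x) (P y)) z = hyp (mult x (P y)) (P z)" for x y z
    note P_simps = linear_simps[OF P]
    have W_add: "W x y z \<Longrightarrow> W x' y z \<Longrightarrow> W (x + x') y z"
      "W x y z \<Longrightarrow> W x y' z \<Longrightarrow> W x (y + y') z"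
      "W x y z \<Longrightarrow> W x y z' \<Longrightarrow> W x y (z + z')" for x x' y y' z z'
      by (auto simp: W_def P_simps mult_simps hyp_linear_simps)
    have W_swap: "W z y x \<Longrightarrow> W x y z" for x y z
      unfolding W_def by (metis hyp_mult_swap)
    have W_cyclic: "W x z y \<Longrightarrow> W z x y \<Longrightarrow> W x y z" for x y z
      unfolding W_def
      using hyp_mult_cyclic[of "P x" "P y" z] hyp_mult_cyclic[of "P x" y "P z"]
        hyp_mult_cyclic[of x "P y" "P z"]
      by metis
    have iii: "W (i x) (i y) (i z)" and jjj: "W (j x) (j y) (j z)" for x y z
      by (simp_all add: W_def P_i P_j mult_i mult_j)
    have iij: "W (i x) (i y) (j z)" for x y z
      by (simp add: W_def P_i P_j mult_i dual am)
    have jji: "W (j x) (j y) (i z)" for x y z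
      by (simp add: W_def P_i P_j mult_j A.coord_form_dual_map(1)[OF P', symmetric] an)
    have jii: "W (j x) (i y) (i z)" and ijj: "W (i x) (j y) (j z)" for x y z
      by (simp_all add: W_swap iij jji)
    have iji: "W (i x) (j y) (i z)" and jij: "W (j x) (i y) (j z)" for x y z
      by (simp_all add: W_cyclic iij jji jii ijj)
    have W: "W x y z" for x y z
    proof -
      have "W (i (p x) + j (q x)) (i (p y) + j (q y)) (i (p z) + j (q z))"
        by (intro W_add iii iij iji ijj jii jij jji jjj)
      then show ?thesis
        by (simp add: frame_decomp)
    qed
    have "mult (P x) (P y) = P (mult (P x) y)" "mult (P x) (P y) = P (mult x (P y))" for x y
      by (rule hyp_nondegenerate, metis W W_def selfadj)+
    then show "averaging_pre_lie_algebra sV mult P"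
      using pl P by (simp add: avg)
  }
qed

end

section \<open>The double of two products\<close>

context framed
begin

text \<open>The only possible invariant product extending \<open>m\<close> and \<open>n\<close>: the
  mixed terms are those found in \<open>mixed_components\<close>.\<close>

definition double_mult :: "('a \<Rightarrow> 'a \<Rightarrow> 'a) \<Rightarrow> ('a \<Rightarrow> 'a \<Rightarrow> 'a) \<Rightarrow> 'v \<Rightarrow> 'v \<Rightarrow> 'v" where
  "double_mult m n v w =
    i (m (p v) (p w) + A.dual_map (\<lambda>c. n c (q w)) (p v) - A.dual_map (\<lambda>c. n (q v) c - n c (q v)) (p w))
    + j (n (q v) (q w) + A.dual_map (\<lambda>z. m z (p w)) (q v) - A.dual_map (\<lambda>z. m (p v) z - m z (p v)) (q w))"

definition double_op :: "('a \<Rightarrow> 'a) \<Rightarrow> 'v \<Rightarrow> 'v" where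
  "double_op P v = i (P (p v)) + j (A.dual_map P (q v))"

lemma framed_product_double_mult:
  assumes m: "bilinear_map sA sA m" and n: "bilinear_map sA sA n"
  shows "framed_product sA basisA sV i j p q (double_mult m n) m n"
proof
  note m_simps = bilinear_map_simps[OF m] and n_simps = bilinear_map_simps[OF n]
  note dual_m = A.coord_form_dual_map(1)[OF bilinear_mapD(1)[OF m]]
    A.coord_form_dual_map(1)[OF bilinear_mapD(3)[OF bilinear_map_commutator[OF m]]]
  note dual_n = A.coord_form_dual_map(1)[OF bilinear_mapD(1)[OF n]]
    A.coord_form_dual_map(1)[OF bilinear_mapD(3)[OF bilinear_map_commutator[OF n]]]
  have p: "A.coord_form (p (double_mult m n v w)) c = A.coord_form (m (p v) (p w)) c
      + A.coord_form (p v) (n c (q w)) - A.coord_form (p w) (n (q v) c - n c (q v))" for v w c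
    by (simp add: double_mult_def frame_linear_simps A.form_simps dual_n)
  have q: "A.coord_form (q (double_mult m n v w)) z = A.coord_form (n (q v) (q w)) z
      + A.coord_form (q v) (m z (p w)) - A.coord_form (q w) (m (p v) z - m z (p v))" for v w z
    by (simp add: double_mult_def frame_linear_simps A.form_simps dual_m)
  have eqI: "v = w" if "\<And>c. A.coord_form (p v) c = A.coord_form (p w) c"
    "\<And>c. A.coord_form (q v) c = A.coord_form (q w) c" for v w
    using that by (intro frame_eqI A.coord_form_eqI)
  show "bilinear_map sV sV (double_mult m n)"
    unfolding bilinear_map_def
    by (intro conjI allI linearI V.vector_space_axioms eqI;
        simp add: p q frame_linear_simps A.form_simps m_simps n_simps algebra_simps)
  show "double_mult m n (i x) (i y) = i (m x y)" for x y
    by (rule eqI) (simp_all add: p q A.form_simps m_simps n_simps)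
  show "double_mult m n (j x) (j y) = j (n x y)" for x y
    by (rule eqI) (simp_all add: p q A.form_simps m_simps n_simps)
  have p': "A.coord_form c (p (double_mult m n v w)) = A.coord_form (m (p v) (p w)) c
      + A.coord_form (p v) (n c (q w)) - A.coord_form (p w) (n (q v) c - n c (q v))" for v w c
    by (simp add: p A.coord_form_commute[of c "p _"])
  \<comment> \<open>Fixes the order of the arguments of the symmetric form, so that equal terms
    match and cancel.\<close>
  have flip: "A.coord_form (p v) (n b c) = A.coord_form (n b c) (p v)"
     "A.coord_form (m b c) (q v) = A.coord_form (q v) (m b c)" for v b c
    by (simp_all add: A.coord_form_commute)
  show "hyp (double_mult m n u v) w + hyp v (double_mult m n u w - double_mult m n w u) = 0" for u v w
    by (simp add: hyp_def frame_linear_simps A.form_simps p p' q flip)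
qed

lemma double_op:
  assumes P: "Vector_Spaces.linear sA sA P"
  shows "Vector_Spaces.linear sV sV (double_op P)"
    "double_op P (i x) = i (P x)" "double_op P (j x) = j (A.dual_map P x)"
    "hyp (double_op P v) w = hyp v (double_op P w)"
proof -
  note simps = linear_simps[OF P] linear_simps[OF A.linear_dual_map[OF P]] frame_linear_simps
  show "Vector_Spaces.linear sV sV (double_op P)"
    by (intro linearI V.vector_space_axioms)
      (simp_all add: double_op_def simps V.scale_right_distrib)
  show "double_op P (i x) = i (P x)" "double_op P (j x) = j (A.dual_map P x)"
    by (simp_all add: double_op_def simps)
  show "hyp (double_op P v) w = hyp v (double_op P w)"
    by (simp add: double_op_def hyp_def simps A.coord_form_dual_map[OF P])
qed

definition double :: "('a \<Rightarrow> 'a \<Rightarrow> 'a) \<Rightarrow> ('a \<Rightarrow> 'a \<Rightarrow> 'a) \<Rightarrow> ('a \<Rightarrow> 'a) \<Rightarrow> ('k, 'v) manin_data" where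
  "double m n P = \<lparr>mt_mult = double_mult m n, mt_P = double_op P, mt_form = hyp,
    mt_A = range i, mt_b = range j\<rparr>"

lemma subspace_range: "V.subspace (range i)" "V.subspace (range j)"
  using module_hom.subspace_image[OF linear_frame(1)[folded module_hom_iff_linear], of UNIV]
    module_hom.subspace_image[OF linear_frame(2)[folded module_hom_iff_linear], of UNIV]
  by simp_all

end

text \<open>A triple in coordinates, short of the pre-Lie and averaging identities, which
  \<open>manin_triple_iff\<close> translates into conditions on \<open>m\<close>, \<open>n\<close>
  and \<open>P\<close>. The operator on the dual copy is the transpose of \<open>P\<close>, as
  self-adjointness forces.\<close>

locale framed_manin = framed_product sA basisA sV i j p q "mt_mult M" m n
  for sA :: "'k::field \<Rightarrow> 'a::ab_group_add \<Rightarrow> 'a" and basisA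
    and sV :: "'k \<Rightarrow> 'v::ab_group_add \<Rightarrow> 'v" and i j p q
    and M :: "('k, 'v) manin_data" and m n +
  fixes P
  assumes form_M: "mt_form M = hyp" and A_M: "mt_A M = range i" and b_M: "mt_b M = range j"
    and linear_P: "Vector_Spaces.linear sA sA P"
    and linear_P_M: "Vector_Spaces.linear sV sV (mt_P M)"
    and P_i: "mt_P M (i x) = i (P x)" and P_j: "mt_P M (j a) = j (A.dual_map P a)"
begin

lemma P_M_components: "p (mt_P M v) = P (p v)" "q (mt_P M v) = A.dual_map P (q v)"
proof -
  have "mt_P M v = mt_P M (i (p v) + j (q v))"
    by (simp only: frame_decomp)
  then have "mt_P M v = i (P (p v)) + j (A.dual_map P (q v))"
    by (simp only: linear_simps(1)[OF linear_P_M] P_i P_j)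
  then show "p (mt_P M v) = P (p v)" "q (mt_P M v) = A.dual_map P (q v)"
    by (simp_all add: frame_linear_simps)
qed

lemma selfadjoint: "hyp (mt_P M v) w = hyp v (mt_P M w)"
  by (simp add: hyp_def P_M_components A.coord_form_dual_map[OF linear_P])

lemma manin_triple_iff:
  assumes ev: "even (vector_space.dim sV (UNIV :: 'v set))"
  shows "M \<in> manin_triples sV \<longleftrightarrow> A.dual_products m n \<and> averaging_pre_lie_algebra sA m P \<and>
      averaging_pre_lie_algebra sA n (A.dual_map P)"
proof -
  have nondeg: "v = 0" if "\<forall>u. hyp v u = 0" for v
    by (rule hyp_nondegenerate) (simp add: that hyp_linear_simps)
  have "v = 0" if "v = i x" "v = j a" for v x a
    using that frame_simps(1)[of x] frame_simps(2)[of a] frame_linear_simps(13) by simp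
  then have int: "range i \<inter> range j = {0}"
    using V.subspace_0[OF subspace_range(1)] V.subspace_0[OF subspace_range(2)] by blast
  have "averaging_pre_lie_algebra sV (mt_mult M) (mt_P M) \<longleftrightarrow> A.dual_products m n \<and>
      averaging_pre_lie_algebra sA m P \<and> averaging_pre_lie_algebra sA n (A.dual_map P)"
  proof (cases "pre_lie_algebra sV (mt_mult M)")
    case True
    then show ?thesis
      using averaging_iff[OF True linear_P_M linear_P P_i P_j selfadjoint] by (simp add: pre_lie_iff_dual_products)
  next
    case False
    then show ?thesis
      by (simp add: averaging_pre_lie_algebra_def pre_lie_iff_dual_products[symmetric])
  qed
  moreover have "\<exists>x\<in>range i. \<exists>y\<in>range j. v = x + y" for v
    using frame_decomp[of v, symmetric] by blast
  moreover have "averaging_pre_lie_subalgebra sV (mt_mult M) (mt_P M) (range i)"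
    "averaging_pre_lie_subalgebra sV (mt_mult M) (mt_P M) (range j)"
    by (auto simp: averaging_pre_lie_subalgebra_def subspace_range mult_i mult_j P_i P_j)
  moreover have "\<forall>x y. hyp x y = - hyp y x"
    using hyp_skew by blast
  moreover have "\<forall>x y. hyp (mt_P M x) y - hyp x (mt_P M y) = 0"
    by (simp add: selfadjoint)
  moreover have "\<forall>x\<in>range i. \<forall>y\<in>range i. hyp x y = 0" "\<forall>x\<in>range j. \<forall>y\<in>range j. hyp x y = 0"
    by simp_all
  ultimately show ?thesis
    using ev bilinear_hyp nondeg invariant int
    unfolding manin_triples_def quadratic_averaging_pre_lie_algebra_def Let_def mem_Collect_eq
      form_M A_M b_M by blast
qed

end

lemma (in framed) framed_manin_double:
  assumes "bilinear_map sA sA m" "bilinear_map sA sA n" "Vector_Spaces.linear sA sA P"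
  shows "framed_manin sA basisA sV i j p q (double m n P) m n P"
  using framed_product_double_mult[OF assms(1,2)] double_op[OF assms(3)] assms(3)
  by (auto simp: double_def framed_manin_def framed_manin_axioms_def)

section \<open>Frames of Manin triples\<close>

text \<open>When \<open>S = P\<close>, the mixed conditions on \<open>P\<close> and \<open>S\<close>
  repeat the averaging identities of the product and of the coproduct.\<close>

lemma (in finite_dimensional_vector_space) averaging_bialgebra_comul:
  assumes n: "bilinear_map scale scale n" and P: "Vector_Spaces.linear scale scale P"
  shows "\<lparr>bi_mult = m, bi_comult = comul n, bi_P = P, bi_S = P\<rparr> \<in> averaging_pre_lie_bialgebras scale
    \<longleftrightarrow> dual_products m n \<and> averaging_pre_lie_algebra scale m P \<and>
      averaging_pre_lie_algebra scale n (dual_map P)"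
  unfolding averaging_pre_lie_bialgebras_def Let_def mem_Collect_eq bialgebra_data.simps
    averaging_coalgebra_comul[OF n P, symmetric] pre_lie_bialgebra_comul[OF n]
  by (auto simp: averaging_pre_lie_algebra_def averaging_pre_lie_coalgebra_def)

section \<open>Manin triples on a space of twice the dimension of \<open>A\<close>\<close>

locale half_dimensional =
  A: finite_dimensional_vector_space sA basisA + V: finite_dimensional_vector_space sV basisV
  for sA :: "'k::field \<Rightarrow> 'a::ab_group_add \<Rightarrow> 'a" and basisA
    and sV :: "'k \<Rightarrow> 'v::ab_group_add \<Rightarrow> 'v" and basisV +
  assumes dim_double: "V.dim UNIV = 2 * A.dim UNIV"
begin

sublocale AV: finite_dimensional_vector_space_pair sA basisA sV basisV ..
sublocale VV: finite_dimensional_vector_space_pair sV basisV sV basisV ..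

text \<open>A basis of \<open>V\<close> is cut into two halves, each matched with the basis of
  \<open>A\<close>. This provides the space for the double when only a bialgebra is given.\<close>

lemma frame_exists: "\<exists>i j p q. framed sA basisA sV i j p q"
proof -
  have card: "card basisV = 2 * card basisA"
    using dim_double by simp
  then obtain B1 where B1: "B1 \<subseteq> basisV" "card B1 = card basisA"
    using obtain_subset_with_card_n[of "card basisA" basisV] by force
  define B2 where "B2 = basisV - B1"
  have fin: "finite B1" "finite B2"
    using B1 V.finite_Basis by (auto simp: B2_def intro: finite_subset)
  have B2: "card B2 = card basisA" "B2 \<subseteq> basisV" "B1 \<inter> B2 = {}" "basisV = B1 \<union> B2"
    using B1 card fin by (auto simp: B2_def card_Diff_subset)
  obtain e1 where e1: "bij_betw e1 basisA B1"
    using finite_same_card_bij[OF A.finite_Basis fin(1)] B1(2) by auto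
  obtain e2 where e2: "bij_betw e2 basisA B2"
    using finite_same_card_bij[OF A.finite_Basis fin(2)] B2(1) by auto
  have mem: "e1 b \<in> basisV" "e2 b \<in> basisV" if "b \<in> basisA" for b
    using that e1 e2 B1 B2 by (auto simp: bij_betw_def)
  have formV: "V.coord_form e e' = (if e = e' then 1 else 0)" if "e \<in> basisV" "e' \<in> basisV" for e e'
    using that by (simp add: V.coord_form_basis V.representation_basis V.independent_Basis)
  have inj: "e1 b = e1 b' \<longleftrightarrow> b = b'" "e2 b = e2 b' \<longleftrightarrow> b = b'" "e1 b \<noteq> e2 b'" "e2 b \<noteq> e1 b'"
    if "b \<in> basisA" "b' \<in> basisA" for b b'
    using that e1 e2 B2(3) by (auto simp: bij_betw_def inj_on_def)
  have form_e: "V.coord_form (e1 b) (e1 b') = (if b = b' then 1 else 0)"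
    "V.coord_form (e2 b) (e2 b') = (if b = b' then 1 else 0)"
    "V.coord_form (e1 b) (e2 b') = 0" "V.coord_form (e2 b) (e1 b') = 0"
    if "b \<in> basisA" "b' \<in> basisA" for b b'
    using that by (simp_all add: formV mem inj)
  have formA: "A.coord_form e e' = (if e = e' then 1 else 0)" if "e \<in> basisA" "e' \<in> basisA" for e e'
    using that by (simp add: A.coord_form_basis A.representation_basis A.independent_Basis)
  \<comment> \<open>\<open>up e\<close> extends a map of basis vectors linearly;
    \<open>down e\<close> reads off the coordinates along its image.\<close>
  define up where "up e x = (\<Sum>b\<in>basisA. sV (A.coord_form x b) (e b))" for e :: "'a \<Rightarrow> 'v" and x
  define down where "down e v = (\<Sum>b\<in>basisA. sA (V.coord_form v (e b)) b)" for e :: "'a \<Rightarrow> 'v" and v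
  have lin: "Vector_Spaces.linear sA sV (up e)" "Vector_Spaces.linear sV sA (down e)" for e
    by (auto intro!: linearI A.vector_space_axioms V.vector_space_axioms
        simp: up_def down_def A.form_simps V.form_simps V.scale_left_distrib A.scale_left_distrib
          sum.distrib A.scale_sum_right V.scale_sum_right)
  have Vsum: "V.coord_form (\<Sum>b\<in>I. f b) y = (\<Sum>b\<in>I. V.coord_form (f b) y)" for I and f :: "'a \<Rightarrow> 'v" and y
    using linear_simps(6)[OF bilinear_mapD(1)[OF V.bilinear_coord_form]] .
  have Asum: "A.coord_form (\<Sum>b\<in>I. f b) y = (\<Sum>b\<in>I. A.coord_form (f b) y)" for I and f :: "'a \<Rightarrow> 'a" and y
    using linear_simps(6)[OF bilinear_mapD(1)[OF A.bilinear_coord_form]] .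
  have down_up: "down e (up e' x) = (\<Sum>b\<in>basisA. sA (\<Sum>b'\<in>basisA. A.coord_form x b' * V.coord_form (e' b') (e b)) b)"
    for e e' x
    by (simp add: down_def up_def Vsum V.form_simps)
  have du: "down e1 (up e1 x) = x" "down e2 (up e2 x) = x" "down e1 (up e2 x) = 0" "down e2 (up e1 x) = 0" for x
    by (simp_all add: down_up form_e A.finite_Basis if_distrib sum.delta A.coord_form_expand[symmetric] cong: if_cong)
  have A_down: "A.coord_form (down e v) b = V.coord_form v (e b)" if "b \<in> basisA" for e v b
    using that by (simp add: down_def Asum A.form_simps formA A.finite_Basis if_distrib sum.delta cong: if_cong)
  have up_down: "up e (down e v) = (\<Sum>e'\<in>B. sV (V.coord_form v e') e')"
    if "bij_betw e basisA B" for e B v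
  proof -
    have "up e (down e v) = (\<Sum>b\<in>basisA. sV (V.coord_form v (e b)) (e b))"
      unfolding up_def by (rule sum.cong) (simp_all add: A_down)
    also have "\<dots> = (\<Sum>e'\<in>B. sV (V.coord_form v e') e')"
      by (rule sum.reindex_bij_betw[OF that])
    finally show ?thesis .
  qed
  have dec: "up e1 (down e1 v) + up e2 (down e2 v) = v" for v
  proof -
    have "up e1 (down e1 v) + up e2 (down e2 v) = (\<Sum>e\<in>B1 \<union> B2. sV (V.coord_form v e) e)"
      unfolding up_down[OF e1] up_down[OF e2] by (rule sum.union_disjoint[OF fin B2(3), symmetric])
    also have "B1 \<union> B2 = basisV"
      by (rule B2(4)[symmetric])
    finally show ?thesis
      by (simp only: V.coord_form_expand[symmetric])
  qed
  have "framed sA basisA sV (up e1) (up e2) (down e1) (down e2)"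
    by (intro framed.intro framed_axioms.intro A.finite_dimensional_vector_space_axioms
        V.vector_space_axioms lin du dec)
  then show ?thesis
    by blast
qed

section \<open>The two subspaces of a triple as dual halves\<close>

context
  fixes M :: "('k, 'v) manin_data"
  assumes M: "M \<in> manin_triples sV"
begin

lemma manin_form:
  "bilinear_map sV (*) (mt_form M)" "mt_form M v w = - mt_form M w v"
  "(\<And>w. mt_form M v w = 0) \<Longrightarrow> v = 0"
  and manin_split: "\<exists>x\<in>mt_A M. \<exists>y\<in>mt_b M. v = x + y" "mt_A M \<inter> mt_b M = {0}"
  and manin_isotropic: "x \<in> mt_A M \<Longrightarrow> y \<in> mt_A M \<Longrightarrow> mt_form M x y = 0"
  "x \<in> mt_b M \<Longrightarrow> y \<in> mt_b M \<Longrightarrow> mt_form M x y = 0"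
  and manin_subspace: "V.subspace (mt_A M)" "V.subspace (mt_b M)"
  and manin_closed: "x \<in> mt_A M \<Longrightarrow> y \<in> mt_A M \<Longrightarrow> mt_mult M x y \<in> mt_A M"
  "x \<in> mt_b M \<Longrightarrow> y \<in> mt_b M \<Longrightarrow> mt_mult M x y \<in> mt_b M"
  "x \<in> mt_A M \<Longrightarrow> mt_P M x \<in> mt_A M" "x \<in> mt_b M \<Longrightarrow> mt_P M x \<in> mt_b M"
  and manin_mult: "bilinear_map sV sV (mt_mult M)"
  "mt_form M (mt_mult M u v) w + mt_form M v (mt_mult M u w - mt_mult M w u) = 0"
  and manin_P: "Vector_Spaces.linear sV sV (mt_P M)" "mt_form M (mt_P M v) w = mt_form M v (mt_P M w)"
proof -
  note M' = M[unfolded manin_triples_def Let_def mem_Collect_eq quadratic_averaging_pre_lie_algebra_def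
      averaging_pre_lie_subalgebra_def averaging_pre_lie_algebra_def pre_lie_algebra_def]
  have "mt_form M (mt_P M v) w - mt_form M v (mt_P M w) = 0"
    using M' by blast
  then show "mt_form M (mt_P M v) w = mt_form M v (mt_P M w)"
    by simp
qed (use M[unfolded manin_triples_def Let_def mem_Collect_eq quadratic_averaging_pre_lie_algebra_def
      averaging_pre_lie_subalgebra_def averaging_pre_lie_algebra_def pre_lie_algebra_def] in blast)+

lemmas manin_form_simps = bilinear_map_simps[OF manin_form(1)]

text \<open>Pairing \<open>u\<close> with a basis of \<open>W\<close> is injective on
  \<open>U\<close>. The resulting scalars are used as coefficients of that basis, so that the
  injection takes its values in \<open>W\<close>.\<close>

lemma dim_le_if_separating:
  assumes U: "V.subspace U" and W: "V.subspace W"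
    and sep: "\<And>u. u \<in> U \<Longrightarrow> (\<And>w. w \<in> W \<Longrightarrow> mt_form M u w = 0) \<Longrightarrow> u = 0"
  shows "V.dim U \<le> V.dim W"
proof -
  obtain E where E: "E \<subseteq> W" "V.independent E" "W \<subseteq> V.span E" "card E = V.dim W"
    by (rule V.basis_exists)
  have fin: "finite E"
    using E(2) by (rule V.finiteI_independent)
  define f where "f u = (\<Sum>e\<in>E. sV (mt_form M u e) e)" for u
  have lin: "Vector_Spaces.linear sV sV f"
    by (intro linearI V.vector_space_axioms)
      (simp_all add: f_def manin_form_simps V.scale_left_distrib sum.distrib V.scale_sum_right)
  have "u = 0" if "u \<in> U" "f u = 0" for u
  proof (rule sep[OF that(1)])
    fix w
    assume "w \<in> W"
    have "mt_form M u e = 0" if "e \<in> E" for e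
      by (rule V.independentD[OF E(2) fin subset_refl _ that]) (use \<open>f u = 0\<close> in \<open>simp only: f_def\<close>)
    moreover have "module_hom sV (*) (mt_form M u)"
      using bilinear_mapD(3)[OF manin_form(1)] by (simp only: module_hom_iff_linear)
    ultimately show "mt_form M u w = 0"
      using module_hom.eq_0_on_span \<open>w \<in> W\<close> E(3) by blast
  qed
  then have "inj_on f (V.span U)"
    using module_hom.inj_on_iff_eq_0[OF lin[folded module_hom_iff_linear] U]
    by (simp only: V.span_subspace[OF subset_refl V.span_superset U]) blast
  then have "V.dim U = V.dim (f ` U)"
    using VV.dim_image_eq[OF lin] by simp
  also have "f ` U \<subseteq> W"
    unfolding f_def using E(1) W by (auto intro!: V.subspace_sum V.subspace_scale)
  then have "V.dim (f ` U) \<le> V.dim W"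
    by (rule V.dim_subset)
  finally show ?thesis .
qed

lemma manin_separates:
  "u \<in> mt_b M \<Longrightarrow> (\<And>x. x \<in> mt_A M \<Longrightarrow> mt_form M u x = 0) \<Longrightarrow> u = 0"
  "x \<in> mt_A M \<Longrightarrow> (\<And>u. u \<in> mt_b M \<Longrightarrow> mt_form M x u = 0) \<Longrightarrow> x = 0"
proof -
  show "u = 0" if "u \<in> mt_b M" "\<And>x. x \<in> mt_A M \<Longrightarrow> mt_form M u x = 0"
  proof (rule manin_form(3))
    fix w
    obtain x y where "x \<in> mt_A M" "y \<in> mt_b M" "w = x + y"
      using manin_split(1) by blast
    then show "mt_form M u w = 0"
      using that manin_isotropic(2) by (simp add: manin_form_simps)
  qed
  show "x = 0" if "x \<in> mt_A M" "\<And>u. u \<in> mt_b M \<Longrightarrow> mt_form M x u = 0"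
  proof (rule manin_form(3))
    fix w
    obtain y u where "y \<in> mt_A M" "u \<in> mt_b M" "w = y + u"
      using manin_split(1) by blast
    then show "mt_form M x w = 0"
      using that manin_isotropic(1) by (simp add: manin_form_simps)
  qed
qed

text \<open>Isotropy and nondegeneracy let the two subspaces separate each other's vectors, so they
  have equal dimension, half that of \<open>V\<close>. This allows the fixed carrier of the
  bialgebras to be identified with the first subspace of any triple.\<close>

lemma dim_mt_A: "V.dim (mt_A M) = A.dim UNIV"
proof -
  have "V.dim (mt_b M) \<le> V.dim (mt_A M)" "V.dim (mt_A M) \<le> V.dim (mt_b M)"
    using dim_le_if_separating manin_subspace manin_separates by blast+
  moreover have "{x + y |x y. x \<in> mt_A M \<and> y \<in> mt_b M} = UNIV"
    using manin_split(1) by blast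
  then have "V.dim UNIV = V.dim (mt_A M) + V.dim (mt_b M)"
    using V.dim_sums_Int[OF manin_subspace] manin_split(2) by (simp del: V.dim_UNIV)
  ultimately show ?thesis
    using dim_double by linarith
qed

lemma mt_A_isomorphism: "\<exists>i. Vector_Spaces.linear sA sV i \<and> inj i \<and> range i = mt_A M"
  using AV.subspace_isomorphism[OF A.subspace_UNIV manin_subspace(1)] dim_mt_A by auto

context
  fixes i
  assumes i: "Vector_Spaces.linear sA sV i" "inj i" "range i = mt_A M"
begin

lemma i_mem [simp]: "i x \<in> mt_A M"
  using i(3) by blast

lemma i_simps: "i (x + y) = i x + i y" "i (x - y) = i x - i y" "i 0 = 0" "i (sA c x) = sV c (i x)"
  using linear_simps[OF i(1)] by blast+

lemma complement_unique: "v - i x \<in> mt_b M \<Longrightarrow> v - i y \<in> mt_b M \<Longrightarrow> x = y"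
proof -
  assume "v - i x \<in> mt_b M" "v - i y \<in> mt_b M"
  then have "i (x - y) \<in> mt_b M"
    using V.subspace_diff[OF manin_subspace(2), of "v - i y" "v - i x"] by (simp add: i_simps)
  then have "i (x - y) = 0"
    using manin_split(2) by (metis IntI i_mem singletonD)
  then show "x = y"
    using i(2) by (metis i_simps(3) injD right_minus_eq)
qed

lemma manin_projection:
  "\<exists>p. Vector_Spaces.linear sV sA p \<and> (\<forall>v. v - i (p v) \<in> mt_b M)
    \<and> (\<forall>x. p (i x) = x) \<and> (\<forall>u\<in>mt_b M. p u = 0)"
proof -
  have "\<exists>x. v - i x \<in> mt_b M" for v
    using manin_split(1)[of v] i(3) by (metis add_diff_cancel_left' rangeE)
  then obtain p where p: "v - i (p v) \<in> mt_b M" for v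
    by metis
  have pI: "p v = x" if "v - i x \<in> mt_b M" for v x
    using that p complement_unique by blast
  have "Vector_Spaces.linear sV sA p"
  proof (intro linearI A.vector_space_axioms V.vector_space_axioms)
    show "p (v + w) = p v + p w" for v w
      using V.subspace_add[OF manin_subspace(2) p[of v] p[of w]]
      by (intro pI) (simp add: i_simps algebra_simps)
    show "p (sV c v) = sA c (p v)" for c v
      using V.subspace_scale[OF manin_subspace(2) p[of v]]
      by (intro pI) (simp add: i_simps V.scale_right_diff_distrib)
  qed
  moreover have "p (i x) = x" for x
    by (intro pI) (simp add: V.subspace_0 manin_subspace)
  moreover have "p u = 0" if "u \<in> mt_b M" for u
    using that by (intro pI) (simp add: i_simps)
  ultimately show ?thesis
    using p by blast
qed

text \<open>A functional on \<open>A\<close>, extended by zero on \<open>b\<close>, is represented by a vector of \<open>V\<close> whose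
  \<open>A\<close>-component vanishes since it is orthogonal to \<open>b\<close>.\<close>

lemma functional_representable:
  assumes f: "f \<in> dual_space sA"
  shows "\<exists>u\<in>mt_b M. dual_functional M i u = f"
proof -
  obtain p where p: "Vector_Spaces.linear sV sA p" "\<And>v. v - i (p v) \<in> mt_b M"
    "\<And>x. p (i x) = x" "\<And>u. u \<in> mt_b M \<Longrightarrow> p u = 0"
    using manin_projection by blast
  have form_dual: "mt_form M v \<in> dual_space sV" for v
    using manin_form(1) by (simp add: dual_space_def bilinear_map_def)
  \<comment> \<open>The form of the triple compared with the coordinate form of \<open>V\<close>.
    Nondegeneracy makes \<open>h\<close> injective, finite dimension makes it surjective, so every
    functional on \<open>V\<close> is represented.\<close>
  define h where "h v = V.sharp (mt_form M v)" for v
  have h: "V.coord_form (h v) w = mt_form M v w" for v w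
    by (simp add: h_def V.coord_form_sharp form_dual)
  have lin: "Vector_Spaces.linear sV sV h"
    by (intro linearI V.vector_space_axioms V.coord_form_eqI)
      (simp_all add: h V.form_simps manin_form_simps)
  have "inj h"
  proof (rule injI)
    fix v w
    assume "h v = h w"
    then have "mt_form M (v - w) u = 0" for u
      using h[of v u] h[of w u] by (simp add: manin_form_simps)
    then have "v - w = 0"
      by (rule manin_form(3))
    then show "v = w"
      by simp
  qed
  then have "surj h"
    by (rule V.linear_inj_imp_surj[OF lin])
  then obtain v where "h v = V.sharp (f \<circ> p)"
    by (metis surjD)
  then have v: "mt_form M v w = f (p w)" for w
    using h[of v w] V.coord_form_sharp[OF dual_space_compose[OF p(1) f]] by simp
  have f0: "f 0 = 0"
    using f linear_simps(4) by (auto simp: dual_space_def)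
  have "mt_form M (i (p v)) u = 0" if "u \<in> mt_b M" for u
    using manin_isotropic(2)[OF p(2)[of v] that] v[of u] p(4)[OF that] f0
    by (simp add: manin_form_simps)
  then have "i (p v) = 0"
    using manin_separates(2) i_mem by blast
  then have "v \<in> mt_b M"
    using p(2)[of v] by simp
  moreover have "dual_functional M i v = f"
    by (simp add: dual_functional_def v p(3))
  ultimately show ?thesis
    by blast
qed

lemma dual_functional_inject:
  assumes "u \<in> mt_b M" "u' \<in> mt_b M" "dual_functional M i u = dual_functional M i u'"
  shows "u = u'"
proof -
  have "mt_form M (u - u') x = 0" if x: "x \<in> mt_A M" for x
  proof -
    obtain y where "x = i y"
      using x i(3) by blast
    then show ?thesis
      using fun_cong[OF assms(3), of y] by (simp add: manin_form_simps dual_functional_def)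
  qed
  then have "u - u' = 0"
    using manin_separates(1) V.subspace_diff[OF manin_subspace(2) assms(1,2)] by blast
  then show ?thesis
    by simp
qed

lemma dual_functional_dual: "dual_functional M i u \<in> dual_space sA"
  unfolding dual_space_def dual_functional_def
  by (auto intro!: linearI vector_space_mult A.vector_space_axioms simp: manin_form_simps i_simps)

text \<open>Given \<open>i\<close>, the vector \<open>j a\<close> of \<open>b\<close> is the one
  that represents \<open>coord_form a\<close>. Isotropy leaves only the cross terms of the form,
  which then is \<open>hyp\<close>.\<close>

lemma manin_frame:
  obtains j p q where "framed sA basisA sV i j p q" "range j = mt_b M"
    "mt_form M = framed.hyp sA basisA p q"
proof -
  obtain p where p: "Vector_Spaces.linear sV sA p" "\<And>v. v - i (p v) \<in> mt_b M"
    "\<And>x. p (i x) = x" "\<And>u. u \<in> mt_b M \<Longrightarrow> p u = 0"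
    using manin_projection by blast
  have "\<exists>u\<in>mt_b M. dual_functional M i u = A.coord_form a" for a
    using functional_representable by simp
  then obtain j where j: "\<And>a. j a \<in> mt_b M" "\<And>a. dual_functional M i (j a) = A.coord_form a"
    by metis
  define q where "q v = A.sharp (dual_functional M i v)" for v
  have q: "A.coord_form (q v) x = mt_form M v (i x)" for v x
    by (simp add: q_def A.coord_form_sharp dual_functional_dual) (simp add: dual_functional_def)
  have j': "mt_form M (j a) (i x) = A.coord_form a x" for a x
    using j(2)[of a] by (simp add: dual_functional_def fun_eq_iff)
  have jI: "j a = u" if "u \<in> mt_b M" "q u = a" for a u
    using that by (intro dual_functional_inject j) (auto simp: j' q dual_functional_def)
  have qj: "q (j a) = a" for a
    by (rule A.coord_form_eqI) (simp add: q j')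
  have q_lin: "Vector_Spaces.linear sV sA q"
    by (intro linearI A.vector_space_axioms V.vector_space_axioms A.coord_form_eqI)
      (simp_all add: q A.form_simps manin_form_simps)
  have j_lin: "Vector_Spaces.linear sA sV j"
    by (intro linearI A.vector_space_axioms V.vector_space_axioms jI
          V.subspace_add[OF manin_subspace(2)] V.subspace_scale[OF manin_subspace(2)] j)
      (simp_all add: linear_simps[OF q_lin] qj)
  have qi: "q (i x) = 0" for x
    by (rule A.coord_form_eqI) (simp add: q A.form_simps manin_isotropic)
  have dec: "j (q v) = v - i (p v)" for v
    by (rule jI[OF p(2)]) (simp add: linear_simps[OF q_lin] qi)
  have fr: "framed sA basisA sV i j p q"
    by (intro framed.intro framed_axioms.intro A.finite_dimensional_vector_space_axioms
        V.vector_space_axioms i(1) p(1) p(3) p(4)[OF j(1)] j_lin q_lin qi qj) (simp add: dec)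
  interpret framed sA basisA sV i j p q
    by (rule fr)
  have "mt_form M v w = hyp v w" for v w
  proof -
    have "mt_form M v w = mt_form M (i (p v) + j (q v)) (i (p w) + j (q w))"
      by (simp add: frame_decomp)
    also have "\<dots> = mt_form M (j (q v)) (i (p w)) + mt_form M (i (p v)) (j (q w))"
      by (simp only: manin_form_simps manin_isotropic i_mem j(1)) simp
    also have "mt_form M (i (p v)) (j (q w)) = - mt_form M (j (q w)) (i (p v))"
      by (rule manin_form(2))
    finally show ?thesis
      by (simp add: j' hyp_def)
  qed
  moreover have "range j = mt_b M"
    using j(1) jI[OF _ refl] by (metis image_subsetI rangeI subsetI subset_antisym)
  ultimately show ?thesis
    using that[OF fr] by blast
qed

end
end
end

section \<open>The correspondence on isomorphism classes\<close>

context framed_manin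
begin

lemma dual_functional_j: "dual_functional M i (j a) = A.coord_form a"
  by (simp add: dual_functional_def form_M)

text \<open>As \<open>u\<close> runs through \<open>b\<close>, its dual functional runs through all
  functionals, so the pairing condition fixes the coproduct completely.\<close>

lemma pre_lie_associated_via_iff:
  "pre_lie_associated_via sV sA i M B \<longleftrightarrow> bi_mult B = m \<and> bi_comult B = A.comul n"
  (is "?l \<longleftrightarrow> ?r")
proof
  assume ?l
  then have m: "\<And>x y. i (bi_mult B x y) = i (m x y)"
    and t: "\<And>x. bi_comult B x \<in> tensor_space sA"
    and c: "\<And>x a b. bi_comult B x (A.coord_form a) (A.coord_form b) = A.coord_form (n a b) x"
    by (auto simp: pre_lie_associated_via_def mult_i mult_j dual_functional_j b_M)
  have "bi_comult B x = A.comul n x" for x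
    by (rule A.tensor_eqI) (auto simp: c A.tensor_space_outside[OF t])
  then show ?r
    using m by (auto simp: frame_inj fun_eq_iff)
next
  assume ?r
  then show ?l
    using A.comul_linear(2)[OF bilinear_n]
    by (auto simp: pre_lie_associated_via_def mult_i mult_j dual_functional_j linear_frame(1)
        inj_on_def frame_inj A_M b_M)
qed

lemma associated_operators_iff:
  "(\<forall>x. i (bi_P B x) = mt_P M (i x)) \<and>
      (\<forall>x. \<forall>u\<in>mt_b M. dual_functional M i u (bi_S B x) = dual_functional M i (mt_P M u) x)
    \<longleftrightarrow> bi_P B = P \<and> bi_S B = P"
proof -
  have "(\<forall>a. A.coord_form a (bi_S B x) = A.coord_form a (P x)) \<longleftrightarrow> bi_S B x = P x" for x
    by (auto intro: A.coord_form_eqI')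
  then show ?thesis
    by (simp add: b_M P_i P_j frame_inj dual_functional_j A.coord_form_dual_map[OF linear_P] fun_eq_iff)
qed

end

definition manin_map ::
    "('k::field \<Rightarrow> 'v::ab_group_add \<Rightarrow> 'v) \<Rightarrow> ('v \<Rightarrow> 'v) \<Rightarrow> ('k, 'v) manin_data
      \<Rightarrow> ('k, 'v) manin_data \<Rightarrow> bool" where
  "manin_map s \<phi> M M' \<longleftrightarrow> Vector_Spaces.linear s s \<phi> \<and> bij \<phi> \<and>
    (\<forall>x y. \<phi> (mt_mult M x y) = mt_mult M' (\<phi> x) (\<phi> y)) \<and>
    (\<forall>x. \<phi> (mt_P M x) = mt_P M' (\<phi> x)) \<and>
    (\<forall>x y. mt_form M' (\<phi> x) (\<phi> y) = mt_form M x y) \<and>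
    \<phi> ` mt_A M = mt_A M' \<and> \<phi> ` mt_b M = mt_b M'"

lemma manin_iso_iff:
  "(M, M') \<in> manin_iso s \<longleftrightarrow>
    M \<in> manin_triples s \<and> M' \<in> manin_triples s \<and> (\<exists>\<phi>. manin_map s \<phi> M M')"
  by (simp only: manin_iso_def manin_map_def mem_Collect_eq case_prod_conv)

lemma manin_mapD:
  assumes "manin_map s \<phi> M M'"
  shows "Vector_Spaces.linear s s \<phi>" "bij \<phi>"
    "\<phi> (mt_mult M x y) = mt_mult M' (\<phi> x) (\<phi> y)"
    "mt_form M' (\<phi> x) (\<phi> y) = mt_form M x y"
    "\<phi> ` mt_A M = mt_A M'" "\<phi> ` mt_b M = mt_b M'"
    "\<phi> (mt_P M x) = mt_P M' (\<phi> x)"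
  using assms by (simp_all add: manin_map_def)

text \<open>The isomorphism identifies vectors with equal coordinates in the two frames.\<close>

lemma framed_isomorphism:
  assumes "framed_manin sA basisA sV i j p q M m n P"
    and "framed_manin sA basisA sV i' j' p' q' M' m n P"
    and mem: "M \<in> manin_triples sV" "M' \<in> manin_triples sV"
  shows "(M, M') \<in> manin_iso sV"
proof -
  interpret F: framed_manin sA basisA sV i j p q M m n P
    by fact
  interpret F': framed_manin sA basisA sV i' j' p' q' M' m n P
    by fact
  define \<phi> where "\<phi> v = i' (p v) + j' (q v)" for v
  define \<psi> where "\<psi> v = i (p' v) + j (q' v)" for v
  have \<phi>: "p' (\<phi> v) = p v" "q' (\<phi> v) = q v" and \<psi>: "p (\<psi> v) = p' v" "q (\<psi> v) = q' v" for v
    by (simp_all add: \<phi>_def \<psi>_def F.frame_linear_simps F'.frame_linear_simps)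
  have inv: "\<phi> (\<psi> v) = v" "\<psi> (\<phi> v) = v" for v
    by (rule F'.frame_eqI, simp_all add: \<phi> \<psi>) (rule F.frame_eqI, simp_all add: \<phi> \<psi>)
  then have bij: "bij \<phi>"
    by (intro o_bij[of \<psi>]) (simp_all add: fun_eq_iff)
  have lin: "Vector_Spaces.linear sV sV \<phi>"
    by (intro linearI F.V.vector_space_axioms F'.frame_eqI)
      (simp_all add: \<phi> F.frame_linear_simps F'.frame_linear_simps)
  have hyp: "F'.hyp (\<phi> v) (\<phi> w) = F.hyp v w" for v w
    by (simp add: F.hyp_def F'.hyp_def \<phi>)
  have mult: "\<phi> (mt_mult M v w) = mt_mult M' (\<phi> v) (\<phi> w)" for v w
  proof (rule F'.hyp_nondegenerate)
    fix u
    \<comment> \<open>By \<open>hyp_mult\<close> both sides are the same expression in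
      \<open>m\<close>, \<open>n\<close> and coordinates; every test vector \<open>u\<close> has the
      form \<open>\<phi> (\<psi> u)\<close>.\<close>
    have "F'.hyp (\<phi> (mt_mult M v w)) (\<phi> (\<psi> u)) = F'.hyp (mt_mult M' (\<phi> v) (\<phi> w)) (\<phi> (\<psi> u))"
      unfolding hyp unfolding F.hyp_mult F'.hyp_mult \<phi> ..
    then show "F'.hyp (\<phi> (mt_mult M v w)) u = F'.hyp (mt_mult M' (\<phi> v) (\<phi> w)) u"
      by (simp add: inv)
  qed
  have im: "\<phi> (i x) = i' x" "\<phi> (j a) = j' a" for x a
    by (simp_all add: \<phi>_def F'.frame_linear_simps)
  have "\<phi> (mt_P M v) = mt_P M' (\<phi> v)" for v
    by (rule F'.frame_eqI) (simp_all add: \<phi> F.P_M_components F'.P_M_components)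
  moreover have "\<phi> ` mt_A M = mt_A M'" "\<phi> ` mt_b M = mt_b M'"
    by (simp_all add: image_image im F.A_M F'.A_M F.b_M F'.b_M)
  ultimately show ?thesis
    unfolding manin_iso_iff manin_map_def F.form_M F'.form_M
    using mem lin bij mult hyp by blast
qed

definition pre_lie_bialgebra_iso ::
    "('k::field \<Rightarrow> 'a::ab_group_add \<Rightarrow> 'a) \<Rightarrow> ('a \<Rightarrow> 'a) \<Rightarrow> ('k, 'a) bialgebra_data
      \<Rightarrow> ('k, 'a) bialgebra_data \<Rightarrow> bool" where
  "pre_lie_bialgebra_iso s \<phi> B B' \<longleftrightarrow> Vector_Spaces.linear s s \<phi> \<and> bij \<phi> \<and>
    (\<forall>x y. \<phi> (bi_mult B x y) = bi_mult B' (\<phi> x) (\<phi> y)) \<and>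
    (\<forall>x. tensor_map s \<phi> \<phi> (bi_comult B x) = bi_comult B' (\<phi> x))"

text \<open>Since \<open>\<phi>\<close> preserves the form, \<open>\<phi> u\<close> induces through
  \<open>\<phi> \<circ> i\<close> the same functional that \<open>u\<close> induces through
  \<open>i\<close>.\<close>

lemma pre_lie_associated_via_manin_iso:
  assumes via: "pre_lie_associated_via sV sA i M B"
    and map: "manin_map sV \<phi> M M'"
  shows "pre_lie_associated_via sV sA (\<phi> \<circ> i) M' B"
proof -
  note \<phi> = manin_mapD[OF map]
  have df: "dual_functional M' (\<phi> \<circ> i) (\<phi> u) = dual_functional M i u" for u
    by (simp add: dual_functional_def \<phi>(4))
  have "bi_comult B x (dual_functional M' (\<phi> \<circ> i) u) (dual_functional M' (\<phi> \<circ> i) v)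
      = dual_functional M' (\<phi> \<circ> i) (mt_mult M' u v) x"
    if "u \<in> mt_b M'" "v \<in> mt_b M'" for u v x
  proof -
    have "u \<in> \<phi> ` mt_b M" "v \<in> \<phi> ` mt_b M"
      using that by (simp_all only: \<phi>(6))
    then obtain u' v' where u': "u' \<in> mt_b M" "u = \<phi> u'" "v' \<in> mt_b M" "v = \<phi> v'"
      by blast
    have "bi_comult B x (dual_functional M i u') (dual_functional M i v')
        = dual_functional M i (mt_mult M u' v') x"
      using via u'(1,3) unfolding pre_lie_associated_via_def by blast
    then show ?thesis
      by (simp only: u'(2,4) \<phi>(3)[symmetric] df)
  qed
  moreover have "inj (\<phi> \<circ> i)"
    using via \<phi>(2) by (auto simp: pre_lie_associated_via_def bij_is_inj intro: inj_compose)
  moreover have "range i = mt_A M"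
    using via by (simp add: pre_lie_associated_via_def)
  then have "range (\<phi> \<circ> i) = mt_A M'"
    by (simp only: image_comp[symmetric] \<phi>(5))
  moreover have "Vector_Spaces.linear sA sV (\<phi> \<circ> i)"
    using via \<phi>(1) Vector_Spaces.linear_compose unfolding pre_lie_associated_via_def by blast
  moreover have "(\<phi> \<circ> i) (bi_mult B x y) = mt_mult M' ((\<phi> \<circ> i) x) ((\<phi> \<circ> i) y)" for x y
    using via by (simp add: pre_lie_associated_via_def \<phi>(3))
  moreover have "bi_comult B x \<in> tensor_space sA" for x
    using via by (simp add: pre_lie_associated_via_def)
  ultimately show ?thesis
    unfolding pre_lie_associated_via_def by blast
qed

lemma associated_manin_iso:
  assumes "associated sV sA M B" "(M, M') \<in> manin_iso sV"
  shows "associated sV sA M' B"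
proof -
  obtain i where i: "pre_lie_associated_via sV sA i M B" "\<And>x. i (bi_P B x) = mt_P M (i x)"
    "\<And>x u. u \<in> mt_b M \<Longrightarrow> dual_functional M i u (bi_S B x) = dual_functional M i (mt_P M u) x"
    using assms(1) unfolding associated_def by blast
  obtain \<phi> where map: "manin_map sV \<phi> M M'"
    using assms(2) unfolding manin_iso_iff by blast
  note \<phi> = manin_mapD[OF map]
  have df: "dual_functional M' (\<phi> \<circ> i) (\<phi> u) = dual_functional M i u" for u
    by (simp add: dual_functional_def \<phi>(4))
  have "dual_functional M' (\<phi> \<circ> i) u (bi_S B x) = dual_functional M' (\<phi> \<circ> i) (mt_P M' u) x"
    if u: "u \<in> mt_b M'" for u x
  proof -
    obtain u' where "u' \<in> mt_b M" "u = \<phi> u'"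
      using u unfolding \<phi>(6)[symmetric] by blast
    then show ?thesis
      by (simp only: \<phi>(7)[symmetric] df i(3))
  qed
  moreover have "(\<phi> \<circ> i) (bi_P B x) = mt_P M' ((\<phi> \<circ> i) x)" for x
    by (simp add: i(2) \<phi>(7))
  ultimately show ?thesis
    using pre_lie_associated_via_manin_iso[OF i(1) map] unfolding associated_def by blast
qed

lemma pre_lie_associated_manin_iso:
  assumes "pre_lie_associated sV sA M B" "(M, M') \<in> manin_iso sV"
  shows "pre_lie_associated sV sA M' B"
proof -
  obtain \<phi> where map: "manin_map sV \<phi> M M'"
    using assms(2) unfolding manin_iso_iff by blast
  show ?thesis
    using assms(1) pre_lie_associated_via_manin_iso[OF _ map] unfolding pre_lie_associated_def by blast
qed

context half_dimensional
begin

lemma manin_structure: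
  assumes M: "M \<in> manin_triples sV"
    and i: "Vector_Spaces.linear sA sV i" "inj i" "range i = mt_A M"
  obtains j p q m n P where "framed_manin sA basisA sV i j p q M m n P"
proof -
  obtain j p q where fr: "framed sA basisA sV i j p q" and j: "range j = mt_b M"
    and form: "mt_form M = framed.hyp sA basisA p q"
    using manin_frame[OF M i] by blast
  interpret framed sA basisA sV i j p q
    by (rule fr)
  have i_p: "i (p v) = v" if "v \<in> mt_A M" for v
    using that i(3) by (metis frame_simps(1) rangeE)
  have j_q: "j (q v) = v" if "v \<in> mt_b M" for v
    using that j by (metis frame_simps(4) rangeE)
  have mem: "i x \<in> mt_A M" "j x \<in> mt_b M" for x
    using i(3) j by blast+
  define m where "m x y = p (mt_mult M (i x) (i y))" for x y
  define n where "n x y = q (mt_mult M (j x) (j y))" for x y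
  define P where "P x = p (mt_P M (i x))" for x
  have "framed_product sA basisA sV i j p q (mt_mult M) m n"
  proof
    show "hyp (mt_mult M u v) w + hyp v (mt_mult M u w - mt_mult M w u) = 0" for u v w
      using manin_mult(2)[OF M] by (simp add: form)
  qed (simp_all add: manin_mult(1)[OF M] m_def n_def i_p j_q mem manin_closed[OF M])
  moreover have linP: "Vector_Spaces.linear sA sA P"
    by (intro linearI A.vector_space_axioms)
      (simp_all add: P_def frame_linear_simps linear_simps[OF manin_P(1)[OF M]])
  moreover have P_i: "mt_P M (i x) = i (P x)" for x
    by (simp add: P_def i_p mem manin_closed[OF M])
  moreover have "mt_P M (j a) = j (A.dual_map P a)" for a
  proof -
    have "q (mt_P M (j a)) = A.dual_map P a"
    proof (rule A.coord_form_eqI)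
      fix x
      have "A.coord_form (q (mt_P M (j a))) x = mt_form M (mt_P M (j a)) (i x)"
        by (simp add: form form_q)
      also have "\<dots> = mt_form M (j a) (i (P x))"
        by (simp only: manin_P(2)[OF M] P_i)
      finally show "A.coord_form (q (mt_P M (j a))) x = A.coord_form (A.dual_map P a) x"
        by (simp add: A.coord_form_dual_map[OF linP] form)
    qed
    then show ?thesis
      using j_q[of "mt_P M (j a)"] manin_closed(4)[OF M mem(2)[of a]] by simp
  qed
  ultimately have "framed_manin sA basisA sV i j p q M m n P"
    using manin_P(1)[OF M] form i(3) j by (simp add: framed_manin_def framed_manin_axioms_def)
  then show ?thesis
    by (rule that)
qed

lemma associated_structure:
  assumes M: "M \<in> manin_triples sV" and B: "associated sV sA M B"
  obtains i j p q n where
    "framed_manin sA basisA sV i j p q M (bi_mult B) n (bi_P B)"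
    "bi_comult B = A.comul n" "bi_S B = bi_P B"
proof -
  obtain i where via: "pre_lie_associated_via sV sA i M B"
    and ops: "(\<forall>x. i (bi_P B x) = mt_P M (i x)) \<and>
      (\<forall>x. \<forall>u\<in>mt_b M. dual_functional M i u (bi_S B x) = dual_functional M i (mt_P M u) x)"
    using B unfolding associated_def by blast
  have i: "Vector_Spaces.linear sA sV i" "inj i" "range i = mt_A M"
    using via unfolding pre_lie_associated_via_def by blast+
  obtain j p q m n P where fm: "framed_manin sA basisA sV i j p q M m n P"
    by (rule manin_structure[OF M i])
  interpret framed_manin sA basisA sV i j p q M m n P
    by (rule fm)
  show ?thesis
    using that[of i j p q n] fm via ops pre_lie_associated_via_iff[of B] associated_operators_iff[of B]
    by simp
qed

lemma associated_bialgebra: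
  assumes M: "M \<in> manin_triples sV" and B: "associated sV sA M B"
  shows "B \<in> averaging_pre_lie_bialgebras sA" "bi_S B = bi_P B"
proof -
  obtain i j p q n where fm: "framed_manin sA basisA sV i j p q M (bi_mult B) n (bi_P B)"
    and B': "bi_comult B = A.comul n" "bi_S B = bi_P B"
    by (rule associated_structure[OF M B])
  interpret framed_manin sA basisA sV i j p q M "bi_mult B" n "bi_P B"
    by (rule fm)
  have ev: "even (vector_space.dim sV (UNIV :: 'v set))"
    using dim_double by simp
  have "\<lparr>bi_mult = bi_mult B, bi_comult = A.comul n, bi_P = bi_P B, bi_S = bi_P B\<rparr>
      \<in> averaging_pre_lie_bialgebras sA"
    using manin_triple_iff[OF ev] M by (simp add: A.averaging_bialgebra_comul[OF bilinear_n linear_P])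
  also have "\<lparr>bi_mult = bi_mult B, bi_comult = A.comul n, bi_P = bi_P B, bi_S = bi_P B\<rparr> = B"
    by (simp add: B'[symmetric])
  finally show "B \<in> averaging_pre_lie_bialgebras sA" .
  show "bi_S B = bi_P B"
    by fact
qed

lemma associated_exists_bialgebra:
  assumes M: "M \<in> manin_triples sV"
  shows "\<exists>B. associated sV sA M B"
proof -
  obtain i where i: "Vector_Spaces.linear sA sV i" "inj i" "range i = mt_A M"
    using mt_A_isomorphism[OF M] by blast
  obtain j p q m n P where fm: "framed_manin sA basisA sV i j p q M m n P"
    by (rule manin_structure[OF M i])
  interpret framed_manin sA basisA sV i j p q M m n P
    by (rule fm)
  let ?B = "\<lparr>bi_mult = m, bi_comult = A.comul n, bi_P = P, bi_S = P\<rparr>"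
  have "pre_lie_associated_via sV sA i M ?B"
    by (simp add: pre_lie_associated_via_iff)
  moreover have "(\<forall>x. i (bi_P ?B x) = mt_P M (i x)) \<and>
      (\<forall>x. \<forall>u\<in>mt_b M. dual_functional M i u (bi_S ?B x) = dual_functional M i (mt_P M u) x)"
    by (subst associated_operators_iff) simp
  ultimately show ?thesis
    unfolding associated_def by blast
qed

text \<open>\<open>P\<close> is kept apart from the operators of \<open>B\<close> so that one
  construction serves both relations: with \<open>P = bi_P B\<close> for \<open>associated\<close>,
  with the identity for \<open>pre_lie_associated\<close>.\<close>

lemma associated_double_exists:
  assumes n: "bilinear_map sA sA n" and P: "Vector_Spaces.linear sA sA P"
    and d: "A.dual_products m n" "averaging_pre_lie_algebra sA m P"
      "averaging_pre_lie_algebra sA n (A.dual_map P)"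
    and B: "bi_mult B = m" "bi_comult B = A.comul n"
  shows "\<exists>M\<in>manin_triples sV. pre_lie_associated sV sA M B \<and>
    (bi_P B = P \<and> bi_S B = P \<longrightarrow> associated sV sA M B)"
proof -
  obtain i j p q where fr: "framed sA basisA sV i j p q"
    using frame_exists by blast
  interpret F: framed sA basisA sV i j p q
    by (rule fr)
  have m: "bilinear_map sA sA m"
    using d(1) by (simp add: A.dual_products_def pre_lie_algebra_def)
  interpret framed_manin sA basisA sV i j p q "F.double m n P" m n P
    by (rule F.framed_manin_double[OF m n P])
  have ev: "even (vector_space.dim sV (UNIV :: 'v set))"
    using dim_double by simp
  have "F.double m n P \<in> manin_triples sV"
    using d manin_triple_iff[OF ev] by blast
  moreover have via: "pre_lie_associated_via sV sA i (F.double m n P) B"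
    using B pre_lie_associated_via_iff by blast
  moreover have "associated sV sA (F.double m n P) B" if "bi_P B = P \<and> bi_S B = P"
    using associated_operators_iff[of B] that via
    unfolding associated_def by blast
  ultimately show ?thesis
    unfolding pre_lie_associated_def by blast
qed

lemma bialgebra_structure:
  assumes B: "B \<in> averaging_pre_lie_bialgebras sA"
  obtains n where "bilinear_map sA sA n" "bi_comult B = A.comul n"
    "A.dual_products (bi_mult B) n"
    "averaging_pre_lie_algebra sA (bi_mult B) (bi_P B)"
    "averaging_pre_lie_algebra sA n (A.dual_map (bi_S B))"
    "Vector_Spaces.linear sA sA (bi_P B)" "Vector_Spaces.linear sA sA (bi_S B)"
proof -
  note B' = B[unfolded averaging_pre_lie_bialgebras_def mem_Collect_eq Let_def]
  have lin: "Vector_Spaces.linear sA sA (bi_P B)" "Vector_Spaces.linear sA sA (bi_S B)"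
    using B' unfolding averaging_pre_lie_algebra_def averaging_pre_lie_coalgebra_def by blast+
  have "Vector_Spaces.linear sA tensor_scale (bi_comult B)" "\<And>x. bi_comult B x \<in> tensor_space sA"
    using B' unfolding averaging_pre_lie_coalgebra_def pre_lie_coalgebra_def by blast+
  then obtain n where n: "bilinear_map sA sA n" "bi_comult B = A.comul n"
    by (rule A.comul_exists)
  have "A.dual_products (bi_mult B) n"
    using B' unfolding n(2) A.pre_lie_bialgebra_comul[OF n(1)] by blast
  moreover have "averaging_pre_lie_algebra sA n (A.dual_map (bi_S B))"
    using B' unfolding n(2) A.averaging_coalgebra_comul[OF n(1) lin(2)] by blast
  moreover have "averaging_pre_lie_algebra sA (bi_mult B) (bi_P B)"
    using B' by blast
  ultimately show ?thesis
    using that n lin by blast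
qed

lemma associated_exists_manin:
  assumes "B \<in> averaging_pre_lie_bialgebras sA" "bi_S B = bi_P B"
  shows "\<exists>M\<in>manin_triples sV. associated sV sA M B"
proof -
  obtain n where "bilinear_map sA sA n" "bi_comult B = A.comul n"
    "A.dual_products (bi_mult B) n"
    "averaging_pre_lie_algebra sA (bi_mult B) (bi_P B)"
    "averaging_pre_lie_algebra sA n (A.dual_map (bi_S B))"
    "Vector_Spaces.linear sA sA (bi_P B)"
    by (rule bialgebra_structure[OF assms(1)]) blast
  then show ?thesis
    using associated_double_exists[of n "bi_P B" "bi_mult B" B] assms(2) by auto
qed

text \<open>If \<open>S\<close> differs from \<open>P\<close>, the operators of \<open>B\<close> fit
  no triple. The identity is averaging for every pre-Lie product and takes their place.\<close>

lemma pre_lie_associated_exists_manin: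
  assumes "B \<in> averaging_pre_lie_bialgebras sA"
  shows "\<exists>M\<in>manin_triples sV. pre_lie_associated sV sA M B"
proof -
  obtain n where n: "bilinear_map sA sA n" "bi_comult B = A.comul n"
    "A.dual_products (bi_mult B) n"
    by (rule bialgebra_structure[OF assms]) blast
  then have "averaging_pre_lie_algebra sA (bi_mult B) (\<lambda>x. x)"
    "averaging_pre_lie_algebra sA n (A.dual_map (\<lambda>x. x))"
    by (simp_all add: averaging_pre_lie_algebra_def A.dual_products_def A.linear_ident
        A.linear_dual_map)
  then show ?thesis
    using associated_double_exists[of n "\<lambda>x. x" "bi_mult B" B] n A.linear_ident by blast
qed

text \<open>In frames adapted to \<open>B\<close> both triples have the product and the operator of
  \<open>B\<close>, and \<open>comul_inject\<close> shows that the dual products agree too.\<close>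

lemma associated_imp_manin_iso:
  assumes M: "M \<in> manin_triples sV" "M' \<in> manin_triples sV"
    and B: "associated sV sA M B" "associated sV sA M' B"
  shows "(M, M') \<in> manin_iso sV"
proof -
  obtain i j p q n where fm: "framed_manin sA basisA sV i j p q M (bi_mult B) n (bi_P B)"
    and n: "bi_comult B = A.comul n"
    by (rule associated_structure[OF M(1) B(1)])
  obtain i' j' p' q' n' where fm': "framed_manin sA basisA sV i' j' p' q' M' (bi_mult B) n' (bi_P B)"
    and n': "bi_comult B = A.comul n'"
    by (rule associated_structure[OF M(2) B(2)])
  have "n' = n"
    by (rule A.comul_inject) (simp only: n[symmetric] n'[symmetric])
  then show ?thesis
    using framed_isomorphism[OF fm _ M] fm' by blast
qed

lemma pre_lie_associated_via_bialgebra_iso: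
  assumes M: "M \<in> manin_triples sV" and via: "pre_lie_associated_via sV sA i M B"
    and \<phi>: "pre_lie_bialgebra_iso sA \<phi> B B'" and tens: "\<And>x. bi_comult B' x \<in> tensor_space sA"
  shows "pre_lie_associated_via sV sA (i \<circ> inv \<phi>) M B'"
proof -
  note via' = via[unfolded pre_lie_associated_via_def]
  have i: "Vector_Spaces.linear sA sV i" "inj i" "range i = mt_A M"
    and i_mult: "i (bi_mult B x y) = mt_mult M (i x) (i y)"
    and i_comult: "u \<in> mt_b M \<Longrightarrow> v \<in> mt_b M \<Longrightarrow>
      bi_comult B x (dual_functional M i u) (dual_functional M i v) = dual_functional M i (mt_mult M u v) x"
    for x y u v
    using via' by simp_all
  have lin: "Vector_Spaces.linear sA sA \<phi>" and bij: "bij \<phi>"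
    and mult: "\<phi> (bi_mult B x y) = bi_mult B' (\<phi> x) (\<phi> y)"
    and comult: "tensor_map sA \<phi> \<phi> (bi_comult B x) = bi_comult B' (\<phi> x)" for x y
    using \<phi> by (simp_all add: pre_lie_bialgebra_iso_def)
  have inv: "\<phi> (inv \<phi> x) = x" "inv \<phi> (\<phi> x) = x" for x
    using bij by (simp_all add: bij_is_surj surj_f_inv_f bij_is_inj)
  have lin': "Vector_Spaces.linear sA sV (i \<circ> inv \<phi>)"
    using linear_inv[OF lin bij] i(1) by (rule Vector_Spaces.linear_compose)
  have inj': "inj (i \<circ> inv \<phi>)"
    using i(2) bij by (intro inj_compose) (simp_all add: bij_imp_bij_inv bij_is_inj)
  have range': "range (i \<circ> inv \<phi>) = mt_A M"
    using i(3) bij by (metis bij_imp_bij_inv bij_is_surj fun.set_map)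
  have df: "dual_functional M (i \<circ> inv \<phi>) u \<circ> \<phi> = dual_functional M i u" for u
    by (simp add: dual_functional_def comp_def inv)
  have "bi_comult B' x (dual_functional M (i \<circ> inv \<phi>) u) (dual_functional M (i \<circ> inv \<phi>) v)
      = dual_functional M (i \<circ> inv \<phi>) (mt_mult M u v) x"
    if uv: "u \<in> mt_b M" "v \<in> mt_b M" for u v x
  proof -
    have "bi_comult B' x = tensor_map sA \<phi> \<phi> (bi_comult B (inv \<phi> x))"
      by (simp add: comult inv)
    then have "bi_comult B' x (dual_functional M (i \<circ> inv \<phi>) u) (dual_functional M (i \<circ> inv \<phi>) v)
        = bi_comult B (inv \<phi> x) (dual_functional M i u) (dual_functional M i v)"
      by (simp add: tensor_map_def dual_functional_dual[OF M lin' inj' range'] df)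
    also have "\<dots> = dual_functional M i (mt_mult M u v) (inv \<phi> x)"
      by (rule i_comult[OF uv])
    finally show ?thesis
      by (simp add: dual_functional_def)
  qed
  moreover have "(i \<circ> inv \<phi>) (bi_mult B' x y) = mt_mult M ((i \<circ> inv \<phi>) x) ((i \<circ> inv \<phi>) y)" for x y
  proof -
    have "bi_mult B' x y = \<phi> (bi_mult B (inv \<phi> x) (inv \<phi> y))"
      by (simp add: mult inv)
    then show ?thesis
      by (simp add: i_mult inv)
  qed
  ultimately show ?thesis
    using lin' inj' range' tens unfolding pre_lie_associated_via_def by simp
qed

text \<open>Both carriers are identified with the same subspace of \<open>M\<close>, which gives
  \<open>\<phi>\<close>. It respects the coproducts because every functional is represented by a
  vector of \<open>b\<close>, where both coproducts are dual to one product.\<close>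

lemma pre_lie_associated_via_unique:
  assumes M: "M \<in> manin_triples sV"
    and via: "pre_lie_associated_via sV sA i M B" "pre_lie_associated_via sV sA i' M B'"
  obtains \<phi> where "pre_lie_bialgebra_iso sA \<phi> B B'" "\<And>x. i' (\<phi> x) = i x"
proof -
  have i: "Vector_Spaces.linear sA sV i" "inj i" "range i = mt_A M"
    and i_mult: "i (bi_mult B x y) = mt_mult M (i x) (i y)"
    and i_tens: "bi_comult B x \<in> tensor_space sA"
    and i_comult: "u \<in> mt_b M \<Longrightarrow> v \<in> mt_b M \<Longrightarrow>
      bi_comult B x (dual_functional M i u) (dual_functional M i v) = dual_functional M i (mt_mult M u v) x"
    for x y u v
    using via(1)[unfolded pre_lie_associated_via_def] by simp_all
  have i': "Vector_Spaces.linear sA sV i'" "inj i'" "range i' = mt_A M"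
    and i'_mult: "i' (bi_mult B' x y) = mt_mult M (i' x) (i' y)"
    and i'_tens: "bi_comult B' x \<in> tensor_space sA"
    and i'_comult: "u \<in> mt_b M \<Longrightarrow> v \<in> mt_b M \<Longrightarrow>
      bi_comult B' x (dual_functional M i' u) (dual_functional M i' v) = dual_functional M i' (mt_mult M u v) x"
    for x y u v
    using via(2)[unfolded pre_lie_associated_via_def] by simp_all
  define \<phi> where "\<phi> = inv i' \<circ> i"
  define \<psi> where "\<psi> = inv i \<circ> i'"
  have i'\<phi>: "i' (\<phi> x) = i x" for x
    unfolding \<phi>_def using i'(3) i(3) by (metis comp_apply f_inv_into_f rangeI)
  have i\<psi>: "i (\<psi> x) = i' x" for x
    unfolding \<psi>_def using i'(3) i(3) by (metis comp_apply f_inv_into_f rangeI)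
  have "\<phi> (\<psi> x) = x" "\<psi> (\<phi> x) = x" for x
    by (rule injD[OF i'(2)], simp add: i'\<phi> i\<psi>) (rule injD[OF i(2)], simp add: i'\<phi> i\<psi>)
  then have bij: "bij \<phi>"
    by (intro o_bij[of \<psi>]) (simp_all add: fun_eq_iff)
  have lin: "Vector_Spaces.linear sA sA \<phi>"
    by (intro linearI A.vector_space_axioms injD[OF i'(2)])
      (simp_all add: linear_simps[OF i'(1)] linear_simps[OF i(1)] i'\<phi>)
  have "\<phi> (bi_mult B x y) = bi_mult B' (\<phi> x) (\<phi> y)" for x y
    by (rule injD[OF i'(2)]) (simp add: i'\<phi> i_mult i'_mult)
  moreover have "tensor_map sA \<phi> \<phi> (bi_comult B x) = bi_comult B' (\<phi> x)" for x
  proof (intro A.tensor_eqI)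
    fix a b
    obtain u v where u: "u \<in> mt_b M" "dual_functional M i' u = A.coord_form a"
      and v: "v \<in> mt_b M" "dual_functional M i' v = A.coord_form b"
      using functional_representable[OF M i' A.coord_form_dual] by blast
    have df: "dual_functional M i' w \<circ> \<phi> = dual_functional M i w" for w
      by (simp add: dual_functional_def comp_def i'\<phi>)
    have "tensor_map sA \<phi> \<phi> (bi_comult B x) (A.coord_form a) (A.coord_form b)
        = bi_comult B x (dual_functional M i u) (dual_functional M i v)"
      by (simp add: tensor_map_def u(2)[symmetric] v(2)[symmetric] df dual_functional_dual[OF M i'])
    also have "\<dots> = dual_functional M i (mt_mult M u v) x"
      by (rule i_comult[OF u(1) v(1)])
    also have "\<dots> = dual_functional M i' (mt_mult M u v) (\<phi> x)"
      by (simp add: dual_functional_def i'\<phi>)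
    also have "\<dots> = bi_comult B' (\<phi> x) (dual_functional M i' u) (dual_functional M i' v)"
      by (rule i'_comult[OF u(1) v(1), symmetric])
    finally show "tensor_map sA \<phi> \<phi> (bi_comult B x) (A.coord_form a) (A.coord_form b)
        = bi_comult B' (\<phi> x) (A.coord_form a) (A.coord_form b)"
      by (simp only: u(2) v(2))
  qed (simp_all add: A.tensor_space_outside[OF i'_tens])
  ultimately show ?thesis
    using that[of \<phi>] lin bij i'\<phi> unfolding pre_lie_bialgebra_iso_def by simp
qed

end

lemma bialgebra_iso_iff:
  "(B, B') \<in> bialgebra_iso s \<longleftrightarrow>
    B \<in> averaging_pre_lie_bialgebras s \<and> B' \<in> averaging_pre_lie_bialgebras s \<and>
    (\<exists>\<phi>. pre_lie_bialgebra_iso s \<phi> B B' \<and> (\<forall>x. \<phi> (bi_P B x) = bi_P B' (\<phi> x)) \<and>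
      (\<forall>x. \<phi> (bi_S B x) = bi_S B' (\<phi> x)))"
  by (simp only: bialgebra_iso_def pre_lie_bialgebra_iso_def mem_Collect_eq case_prod_conv conj_assoc)

lemma bialgebra_comult_tensor:
  "B \<in> averaging_pre_lie_bialgebras s \<Longrightarrow> bi_comult B x \<in> tensor_space s"
  by (simp add: averaging_pre_lie_bialgebras_def Let_def averaging_pre_lie_coalgebra_def
      pre_lie_coalgebra_def)

section \<open>Invariance of the two relations under isomorphism\<close>

context half_dimensional
begin

text \<open>Compatibility with \<open>S\<close> follows from that with \<open>P\<close>, as
  \<open>S = P\<close> on both sides.\<close>

lemma associated_imp_bialgebra_iso:
  assumes M: "M \<in> manin_triples sV" and B: "associated sV sA M B" "associated sV sA M B'"
  shows "(B, B') \<in> bialgebra_iso sA"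
proof -
  obtain i where via: "pre_lie_associated_via sV sA i M B"
    and P: "\<And>x. i (bi_P B x) = mt_P M (i x)"
    using B(1) unfolding associated_def by blast
  obtain i' where via': "pre_lie_associated_via sV sA i' M B'"
    and P': "\<And>x. i' (bi_P B' x) = mt_P M (i' x)"
    using B(2) unfolding associated_def by blast
  obtain \<phi> where \<phi>: "pre_lie_bialgebra_iso sA \<phi> B B'" "\<And>x. i' (\<phi> x) = i x"
    by (rule pre_lie_associated_via_unique[OF M via via'], rule that)
  have "inj i'"
    using via' by (simp add: pre_lie_associated_via_def)
  then have "\<phi> (bi_P B x) = bi_P B' (\<phi> x)" for x
    by (rule injD) (simp add: \<phi>(2) P P')
  then show ?thesis
    using \<phi>(1) associated_bialgebra[OF M B(1)] associated_bialgebra[OF M B(2)]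
    unfolding bialgebra_iso_iff by auto
qed

text \<open>Two bialgebras related to one triple have isomorphic pre-Lie parts, so any triple
  related to one is related to the other. The relation is thus a disjoint union of
  rectangles.\<close>

lemma pre_lie_associated_difunctional:
  assumes M: "M \<in> manin_triples sV" "M' \<in> manin_triples sV"
    and B: "pre_lie_associated sV sA M B" "pre_lie_associated sV sA M B'" "pre_lie_associated sV sA M' B"
  shows "pre_lie_associated sV sA M' B'"
proof -
  obtain i i' i'' where via: "pre_lie_associated_via sV sA i M B" "pre_lie_associated_via sV sA i' M B'"
    "pre_lie_associated_via sV sA i'' M' B"
    using B unfolding pre_lie_associated_def by blast
  obtain \<phi> where \<phi>: "pre_lie_bialgebra_iso sA \<phi> B B'"
    using pre_lie_associated_via_unique[OF M(1) via(1,2)] by blast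
  have "bi_comult B' x \<in> tensor_space sA" for x
    using via(2) by (simp add: pre_lie_associated_via_def)
  then show ?thesis
    using pre_lie_associated_via_bialgebra_iso[OF M(2) via(3) \<phi>] unfolding pre_lie_associated_def by blast
qed

lemma pre_lie_associated_bialgebra_iso:
  assumes M: "M \<in> manin_triples sV" and B: "pre_lie_associated sV sA M B"
    and iso: "(B, B') \<in> bialgebra_iso sA"
  shows "pre_lie_associated sV sA M B'"
proof -
  obtain i where via: "pre_lie_associated_via sV sA i M B"
    using B unfolding pre_lie_associated_def by blast
  obtain \<phi> where \<phi>: "pre_lie_bialgebra_iso sA \<phi> B B'" and "B' \<in> averaging_pre_lie_bialgebras sA"
    using iso unfolding bialgebra_iso_iff by blast
  then show ?thesis
    using pre_lie_associated_via_bialgebra_iso[OF M via \<phi> bialgebra_comult_tensor]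
    unfolding pre_lie_associated_def by blast
qed

lemma associated_bialgebra_iso:
  assumes M: "M \<in> manin_triples sV" and B: "associated sV sA M B"
    and iso: "(B, B') \<in> bialgebra_iso sA"
  shows "associated sV sA M B'"
proof -
  obtain i where via: "pre_lie_associated_via sV sA i M B"
    and P: "\<And>x. i (bi_P B x) = mt_P M (i x)"
    and S: "\<And>x u. u \<in> mt_b M \<Longrightarrow> dual_functional M i u (bi_S B x) = dual_functional M i (mt_P M u) x"
    using B unfolding associated_def by blast
  obtain \<phi> where \<phi>: "pre_lie_bialgebra_iso sA \<phi> B B'" and B': "B' \<in> averaging_pre_lie_bialgebras sA"
    and \<phi>P: "\<And>x. \<phi> (bi_P B x) = bi_P B' (\<phi> x)" and \<phi>S: "\<And>x. \<phi> (bi_S B x) = bi_S B' (\<phi> x)"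
    using iso unfolding bialgebra_iso_iff by blast
  have "bij \<phi>"
    using \<phi> by (simp add: pre_lie_bialgebra_iso_def)
  then have inv: "\<phi> (inv \<phi> x) = x" "inv \<phi> (\<phi> x) = x" for x
    by (simp_all add: bij_is_surj surj_f_inv_f bij_is_inj)
  have P'': "bi_P B' x = \<phi> (bi_P B (inv \<phi> x))" and S'': "bi_S B' x = \<phi> (bi_S B (inv \<phi> x))" for x
    by (simp_all add: \<phi>P \<phi>S inv)
  have "(i \<circ> inv \<phi>) (bi_P B' x) = mt_P M ((i \<circ> inv \<phi>) x)" for x
    by (simp add: P'' inv P)
  moreover have "dual_functional M (i \<circ> inv \<phi>) u (bi_S B' x) = dual_functional M (i \<circ> inv \<phi>) (mt_P M u) x"
    if "u \<in> mt_b M" for u x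
    using S[OF that, of "inv \<phi> x"] by (simp add: S'' inv dual_functional_def)
  ultimately show ?thesis
    using pre_lie_associated_via_bialgebra_iso[OF M via \<phi> bialgebra_comult_tensor[OF B']]
    unfolding associated_def by blast
qed

lemma equiv_manin_iso: "equiv (manin_triples sV) (manin_iso sV)"
proof (intro equivI refl_onI symI transI)
  show "manin_iso sV \<subseteq> manin_triples sV \<times> manin_triples sV"
    by (auto simp: manin_iso_iff)
next
  fix M
  assume "M \<in> manin_triples sV"
  moreover have "manin_map sV id M M"
    by (simp add: manin_map_def V.linear_id)
  ultimately show "(M, M) \<in> manin_iso sV"
    unfolding manin_iso_iff by blast
next
  fix M M'
  assume "(M, M') \<in> manin_iso sV"
  then obtain \<phi> where \<phi>: "manin_map sV \<phi> M M'" and M: "M \<in> manin_triples sV" "M' \<in> manin_triples sV"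
    unfolding manin_iso_iff by blast
  note \<phi>D = manin_mapD[OF \<phi>]
  have inv: "\<phi> (inv \<phi> x) = x" "inv \<phi> (\<phi> x) = x" for x
    using \<phi>D(2) by (simp_all add: bij_is_surj surj_f_inv_f bij_is_inj)
  have "manin_map sV (inv \<phi>) M' M"
    unfolding manin_map_def
  proof (intro conjI allI)
    show "Vector_Spaces.linear sV sV (inv \<phi>)" "bij (inv \<phi>)"
      by (rule linear_inv[OF \<phi>D(1,2)], rule bij_imp_bij_inv[OF \<phi>D(2)])
    show "inv \<phi> ` mt_A M' = mt_A M" "inv \<phi> ` mt_b M' = mt_b M"
      unfolding \<phi>D(5,6)[symmetric] by (simp_all add: image_image inv)
    show "inv \<phi> (mt_mult M' x y) = mt_mult M (inv \<phi> x) (inv \<phi> y)" for x y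
      using \<phi>D(3)[of "inv \<phi> x" "inv \<phi> y"] by (metis inv)
    show "inv \<phi> (mt_P M' x) = mt_P M (inv \<phi> x)" for x
      using \<phi>D(7)[of "inv \<phi> x"] by (metis inv)
    show "mt_form M (inv \<phi> x) (inv \<phi> y) = mt_form M' x y" for x y
      using \<phi>D(4)[of "inv \<phi> x" "inv \<phi> y"] by (simp add: inv)
  qed
  then show "(M', M) \<in> manin_iso sV"
    unfolding manin_iso_iff using M by blast
next
  fix M M' M''
  assume "(M, M') \<in> manin_iso sV" "(M', M'') \<in> manin_iso sV"
  then obtain \<phi> \<psi> where \<phi>: "manin_map sV \<phi> M M'" and \<psi>: "manin_map sV \<psi> M' M''"
    and M: "M \<in> manin_triples sV" "M'' \<in> manin_triples sV"
    unfolding manin_iso_iff by blast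
  have "manin_map sV (\<psi> \<circ> \<phi>) M M''"
    unfolding manin_map_def
    using Vector_Spaces.linear_compose[OF manin_mapD(1)[OF \<phi>] manin_mapD(1)[OF \<psi>]]
      bij_comp[OF manin_mapD(2)[OF \<phi>] manin_mapD(2)[OF \<psi>]]
    unfolding image_comp[symmetric]
    by (simp add: manin_mapD[OF \<phi>] manin_mapD[OF \<psi>])
  then show "(M, M'') \<in> manin_iso sV"
    unfolding manin_iso_iff using M by blast
qed

lemma tensor_map_compose:
  assumes "Vector_Spaces.linear sA sA \<psi>"
  shows "tensor_map sA \<psi> \<psi> (tensor_map sA \<phi> \<phi> t) = tensor_map sA (\<psi> \<circ> \<phi>) (\<psi> \<circ> \<phi>) t"
  by (auto simp: tensor_map_def fun_eq_iff dual_space_compose[OF assms] comp_assoc)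

lemma tensor_map_id:
  "t \<in> tensor_space sA \<Longrightarrow> tensor_map sA (\<lambda>x. x) (\<lambda>x. x) t = t"
  by (auto simp: tensor_map_def fun_eq_iff comp_def A.tensor_space_outside)

lemma equiv_bialgebra_iso: "equiv (averaging_pre_lie_bialgebras sA) (bialgebra_iso sA)"
proof (intro equivI refl_onI symI transI)
  show "bialgebra_iso sA \<subseteq> averaging_pre_lie_bialgebras sA \<times> averaging_pre_lie_bialgebras sA"
    by (auto simp: bialgebra_iso_iff)
next
  fix B
  assume B: "B \<in> averaging_pre_lie_bialgebras sA"
  have "bij (\<lambda>x :: 'a. x)"
    using bij_id by (simp add: id_def)
  then have "pre_lie_bialgebra_iso sA (\<lambda>x. x) B B"
    by (simp add: pre_lie_bialgebra_iso_def A.linear_ident tensor_map_id bialgebra_comult_tensor[OF B])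
  then show "(B, B) \<in> bialgebra_iso sA"
    unfolding bialgebra_iso_iff using B by (intro conjI exI[of _ "\<lambda>x. x"]) simp_all
next
  fix B B'
  assume "(B, B') \<in> bialgebra_iso sA"
  then obtain \<phi> where \<phi>: "pre_lie_bialgebra_iso sA \<phi> B B'"
    and B: "B \<in> averaging_pre_lie_bialgebras sA" "B' \<in> averaging_pre_lie_bialgebras sA"
    and ops: "\<And>x. \<phi> (bi_P B x) = bi_P B' (\<phi> x)" "\<And>x. \<phi> (bi_S B x) = bi_S B' (\<phi> x)"
    unfolding bialgebra_iso_iff by blast
  have lin: "Vector_Spaces.linear sA sA \<phi>" and bij: "bij \<phi>"
    and mult: "\<phi> (bi_mult B x y) = bi_mult B' (\<phi> x) (\<phi> y)"
    and comult: "tensor_map sA \<phi> \<phi> (bi_comult B x) = bi_comult B' (\<phi> x)" for x y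
    using \<phi> by (simp_all add: pre_lie_bialgebra_iso_def)
  have inv: "\<phi> (inv \<phi> x) = x" "inv \<phi> (\<phi> x) = x" for x
    using bij by (simp_all add: bij_is_surj surj_f_inv_f bij_is_inj)
  have lin': "Vector_Spaces.linear sA sA (inv \<phi>)"
    by (rule linear_inv[OF lin bij])
  have comp: "inv \<phi> \<circ> \<phi> = (\<lambda>x. x)"
    by (simp add: fun_eq_iff inv)
  have "tensor_map sA (inv \<phi>) (inv \<phi>) (bi_comult B' x) = bi_comult B (inv \<phi> x)" for x
    using comult[of "inv \<phi> x", symmetric]
    by (simp add: inv tensor_map_compose[OF lin'] comp tensor_map_id bialgebra_comult_tensor[OF B(1)])
  moreover have "inv \<phi> (bi_mult B' x y) = bi_mult B (inv \<phi> x) (inv \<phi> y)" for x y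
    using mult[of "inv \<phi> x" "inv \<phi> y"] by (metis inv)
  ultimately have "pre_lie_bialgebra_iso sA (inv \<phi>) B' B"
    unfolding pre_lie_bialgebra_iso_def using lin' bij_imp_bij_inv[OF bij] by blast
  moreover have "inv \<phi> (bi_P B' x) = bi_P B (inv \<phi> x)" "inv \<phi> (bi_S B' x) = bi_S B (inv \<phi> x)" for x
    using ops[of "inv \<phi> x"] by (metis inv)+
  ultimately show "(B', B) \<in> bialgebra_iso sA"
    unfolding bialgebra_iso_iff using B by blast
next
  fix B B' B''
  assume "(B, B') \<in> bialgebra_iso sA" "(B', B'') \<in> bialgebra_iso sA"
  then obtain \<phi> \<psi> where \<phi>: "pre_lie_bialgebra_iso sA \<phi> B B'" and \<psi>: "pre_lie_bialgebra_iso sA \<psi> B' B''"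
    and B: "B \<in> averaging_pre_lie_bialgebras sA" "B'' \<in> averaging_pre_lie_bialgebras sA"
    and ops: "\<And>x. \<phi> (bi_P B x) = bi_P B' (\<phi> x)" "\<And>x. \<phi> (bi_S B x) = bi_S B' (\<phi> x)"
      "\<And>x. \<psi> (bi_P B' x) = bi_P B'' (\<psi> x)" "\<And>x. \<psi> (bi_S B' x) = bi_S B'' (\<psi> x)"
    unfolding bialgebra_iso_iff by blast
  have lin: "Vector_Spaces.linear sA sA \<phi>" "Vector_Spaces.linear sA sA \<psi>" and bij: "bij \<phi>" "bij \<psi>"
    and mult: "\<phi> (bi_mult B x y) = bi_mult B' (\<phi> x) (\<phi> y)" "\<psi> (bi_mult B' x y) = bi_mult B'' (\<psi> x) (\<psi> y)"
    and comult: "bi_comult B' (\<phi> x) = tensor_map sA \<phi> \<phi> (bi_comult B x)"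
      "bi_comult B'' (\<psi> x) = tensor_map sA \<psi> \<psi> (bi_comult B' x)" for x y
    using \<phi> \<psi> by (simp_all add: pre_lie_bialgebra_iso_def)
  have "pre_lie_bialgebra_iso sA (\<psi> \<circ> \<phi>) B B''"
    unfolding pre_lie_bialgebra_iso_def
    using Vector_Spaces.linear_compose[OF lin] bij_comp[OF bij]
    by (simp add: mult comult tensor_map_compose[OF lin(2)])
  moreover have "(\<psi> \<circ> \<phi>) (bi_P B x) = bi_P B'' ((\<psi> \<circ> \<phi>) x)" "(\<psi> \<circ> \<phi>) (bi_S B x) = bi_S B'' ((\<psi> \<circ> \<phi>) x)" for x
    by (simp_all add: ops)
  ultimately show "(B, B'') \<in> bialgebra_iso sA"
    unfolding bialgebra_iso_iff using B by blast
qed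

end

section \<open>Bijections between quotients\<close>

text \<open>A relation that is invariant under both equivalences and one-to-one up to them sends a
  class to the set of all partners of its members. \<open>Z\<close> is closed under
  \<open>s\<close>, because equivalent elements share a partner.\<close>

lemma bij_betw_quotients:
  assumes r: "equiv X r" and s: "equiv Y s" and Z: "Z \<subseteq> Y"
    and range: "\<And>M B. M \<in> X \<Longrightarrow> R M B \<Longrightarrow> B \<in> Z"
    and left_total: "\<And>M. M \<in> X \<Longrightarrow> \<exists>B. R M B"
    and right_total: "\<And>B. B \<in> Z \<Longrightarrow> \<exists>M\<in>X. R M B"
    and left_iso: "\<And>M M' B. M \<in> X \<Longrightarrow> R M B \<Longrightarrow> (M, M') \<in> r \<Longrightarrow> R M' B"
    and right_iso: "\<And>M B B'. M \<in> X \<Longrightarrow> R M B \<Longrightarrow> (B, B') \<in> s \<Longrightarrow> R M B'"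
    and right_unique: "\<And>M B B'. M \<in> X \<Longrightarrow> R M B \<Longrightarrow> R M B' \<Longrightarrow> (B, B') \<in> s"
    and left_unique: "\<And>M M' B. M \<in> X \<Longrightarrow> M' \<in> X \<Longrightarrow> R M B \<Longrightarrow> R M' B \<Longrightarrow> (M, M') \<in> r"
  shows "bij_betw (\<lambda>C. {B. \<exists>M\<in>C. R M B}) (X // r) (Z // s)"
proof -
  have cls: "{B'. \<exists>M'\<in>r``{M}. R M' B'} = s``{B}" if M: "M \<in> X" and B: "R M B" for M B
  proof (intro equalityI subsetI)
    fix B'
    assume "B' \<in> {B'. \<exists>M'\<in>r``{M}. R M' B'}"
    then obtain M' where M': "(M, M') \<in> r" "R M' B'"
      by blast
    then have "M' \<in> X" "R M' B"
      using left_iso[OF M B] r unfolding equiv_def by blast+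
    then show "B' \<in> s``{B}"
      using right_unique M'(2) by blast
  next
    fix B'
    assume "B' \<in> s``{B}"
    then have "R M B'"
      using right_iso[OF M B] by blast
    moreover have "M \<in> r``{M}"
      using r M by (rule equiv_class_self)
    ultimately show "B' \<in> {B'. \<exists>M'\<in>r``{M}. R M' B'}"
      by blast
  qed
  have "inj_on (\<lambda>C. {B. \<exists>M\<in>C. R M B}) (X // r)"
  proof (rule inj_onI)
    fix C C'
    assume "C \<in> X // r" "C' \<in> X // r" and eq: "{B. \<exists>M\<in>C. R M B} = {B. \<exists>M\<in>C'. R M B}"
    then obtain M M' where M: "M \<in> X" "C = r``{M}" "M' \<in> X" "C' = r``{M'}"
      by (auto elim!: quotientE)
    obtain B B' where B: "R M B" "R M' B'"
      using left_total M by blast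
    then have "s``{B} = s``{B'}"
      using eq cls M by simp
    then have "(B', B) \<in> s"
      using eq_equiv_class[OF _ s, of B' B] range[OF M(1) B(1)] Z by auto
    then have "R M' B"
      using right_iso[OF M(3) B(2)] by blast
    then have "(M, M') \<in> r"
      using left_unique[OF M(1,3) B(1)] by blast
    then show "C = C'"
      using equiv_class_eq[OF r] M by blast
  qed
  moreover have "(\<lambda>C. {B. \<exists>M\<in>C. R M B}) ` (X // r) = Z // s"
  proof (intro equalityI subsetI)
    fix D
    assume "D \<in> (\<lambda>C. {B. \<exists>M\<in>C. R M B}) ` (X // r)"
    then obtain M where M: "M \<in> X" "D = {B. \<exists>M\<in>r``{M}. R M B}"
      by (auto elim!: quotientE)
    obtain B where B: "R M B"
      using left_total M by blast
    then have "D = s``{B}"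
      using cls M by simp
    then show "D \<in> Z // s"
      using range[OF M(1) B] by (simp add: quotientI)
  next
    fix D
    assume "D \<in> Z // s"
    then obtain B where B: "B \<in> Z" "D = s``{B}"
      by (auto elim!: quotientE)
    obtain M where M: "M \<in> X" "R M B"
      using right_total B by blast
    then have "D = {B. \<exists>M\<in>r``{M}. R M B}"
      using cls B by simp
    then show "D \<in> (\<lambda>C. {B. \<exists>M\<in>C. R M B}) ` (X // r)"
      using quotientI[OF M(1)] by blast
  qed
  ultimately show ?thesis
    unfolding bij_betw_def by blast
qed

text \<open>A difunctional relation cuts \<open>U\<close> and \<open>D\<close> into matching blocks;
  \<open>N u\<close> is the block of \<open>D\<close> that belongs to \<open>u\<close>. A bijection
  is chosen once for each block, which is why \<open>g\<close> is indexed by the block and not by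
  \<open>u\<close>, and the choices are glued.\<close>

lemma bijection_of_fibres:
  assumes left_total: "\<And>u. u \<in> U \<Longrightarrow> \<exists>d\<in>D. \<rho> u d"
    and right_total: "\<And>d. d \<in> D \<Longrightarrow> \<exists>u\<in>U. \<rho> u d"
    and difunctional: "\<And>u u' d d'. u \<in> U \<Longrightarrow> u' \<in> U \<Longrightarrow> d \<in> D \<Longrightarrow> d' \<in> D \<Longrightarrow>
      \<rho> u d \<Longrightarrow> \<rho> u d' \<Longrightarrow> \<rho> u' d \<Longrightarrow> \<rho> u' d'"
    and fibres: "\<And>u d. u \<in> U \<Longrightarrow> d \<in> D \<Longrightarrow> \<rho> u d \<Longrightarrow> {u'\<in>U. \<rho> u' d} \<approx> {d'\<in>D. \<rho> u d'}"
  shows "\<exists>F. bij_betw F U D \<and> (\<forall>u\<in>U. \<rho> u (F u))"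
proof -
  define N where "N u = {d\<in>D. \<rho> u d}" for u
  have N_eq: "N u = N u'" if "u \<in> U" "u' \<in> U" "d \<in> N u" "d \<in> N u'" for u u' d
    using that difunctional unfolding N_def by blast
  have "\<exists>g. bij_betw g {u'\<in>U. N u' = N u} (N u)" if u: "u \<in> U" for u
  proof -
    obtain d where d: "d \<in> D" "\<rho> u d"
      using left_total[OF u] by blast
    have "{u'\<in>U. N u' = N u} = {u'\<in>U. \<rho> u' d}"
      using N_eq u d unfolding N_def by blast
    then show ?thesis
      using fibres[OF u d] unfolding N_def eqpoll_def by simp
  qed
  then have "\<forall>K\<in>N ` U. \<exists>g. bij_betw g {u'\<in>U. N u' = K} K"
    by blast
  from bchoice[OF this] obtain g where "\<forall>K\<in>N ` U. bij_betw (g K) {u'\<in>U. N u' = K} K" ..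
  then have g: "bij_betw (g (N u)) {u'\<in>U. N u' = N u} (N u)" if "u \<in> U" for u
    using that by blast
  define F where "F u = g (N u) u" for u
  have F_mem: "F u \<in> N u" if "u \<in> U" for u
    using bij_betwE[OF g[OF that]] that by (simp add: F_def)
  have "inj_on F U"
  proof (rule inj_onI)
    fix u u'
    assume u: "u \<in> U" "u' \<in> U" "F u = F u'"
    then have "N u = N u'"
      using N_eq F_mem by metis
    then show "u = u'"
      using bij_betw_imp_inj_on[OF g[OF u(1)]] u by (auto simp: F_def inj_on_def)
  qed
  moreover have "F ` U = D"
  proof (intro equalityI subsetI)
    fix d
    assume "d \<in> F ` U"
    then show "d \<in> D"
      using F_mem by (auto simp: N_def)
  next
    fix d
    assume d: "d \<in> D"
    then obtain u where u: "u \<in> U" "d \<in> N u"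
      using right_total unfolding N_def by blast
    then have "d \<in> g (N u) ` {u'\<in>U. N u' = N u}"
      by (simp add: bij_betw_imp_surj_on[OF g])
    then obtain u' where "u' \<in> U" "N u' = N u" "g (N u) u' = d"
      by blast
    then have "F u' = d" "u' \<in> U"
      by (simp_all add: F_def)
    then show "d \<in> F ` U"
      by blast
  qed
  moreover have "\<forall>u\<in>U. \<rho> u (F u)"
    using F_mem by (simp add: N_def)
  ultimately show ?thesis
    unfolding bij_betw_def by blast
qed

section \<open>Counting\<close>

lemma times_lepoll_infinite:
  assumes "A \<lesssim> K" "B \<lesssim> K" "infinite K"
  shows "A \<times> B \<lesssim> K"
proof -
  have "\<exists>f. bij_betw f (K \<times> K) K"
    using card_of_Times_same_infinite[OF assms(3)] by (simp only: card_of_ordIso)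
  then have "K \<times> K \<lesssim> K"
    using eqpoll_imp_lepoll unfolding eqpoll_def by blast
  then show ?thesis
    using times_lepoll_mono[OF assms(1,2)] lepoll_trans by blast
qed

lemma PiE_lepoll_infinite:
  assumes "finite I" "T \<lesssim> K" "infinite K"
  shows "(I \<rightarrow>\<^sub>E T) \<lesssim> K"
  using assms(1)
proof (induction I)
  case empty
  show ?case
    using assms(3) by (simp add: finite_lepoll_infinite)
next
  case (insert x I)
  have "(insert x I \<rightarrow>\<^sub>E T) = (\<lambda>(y, g). g(x := y)) ` (T \<times> (I \<rightarrow>\<^sub>E T))"
    by (rule PiE_insert_eq)
  also have "\<dots> \<lesssim> T \<times> (I \<rightarrow>\<^sub>E T)"
    by (rule image_lepoll)
  also have "\<dots> \<lesssim> K"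
    using times_lepoll_infinite[OF assms(2) insert.IH assms(3)] .
  finally show ?case .
qed

lemma lepoll_of_inj:
  assumes "\<And>x. x \<in> X \<Longrightarrow> f x \<in> T" "\<And>x y. x \<in> X \<Longrightarrow> y \<in> X \<Longrightarrow> f x = f y \<Longrightarrow> x = y" "T \<lesssim> K"
  shows "X \<lesssim> K"
proof -
  have "X \<lesssim> T"
    unfolding lepoll_def using assms(1,2) by (intro exI[of _ f]) (auto simp: inj_on_def)
  then show ?thesis
    using assms(3) by (rule lepoll_trans)
qed

section \<open>The number of vectors, linear maps and bilinear maps\<close>

context finite_dimensional_vector_space
begin

lemma linear_eq_on_Basis:
  assumes "Vector_Spaces.linear scale scale f" "Vector_Spaces.linear scale scale g"
    and "restrict f Basis = restrict g Basis"
  shows "f = g"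
proof
  fix x
  have e: "f e = g e" if "e \<in> Basis" for e
    using fun_cong[OF assms(3), of e] that by simp
  have "f (\<Sum>e\<in>Basis. coord_form x e *s e) = (\<Sum>e\<in>Basis. coord_form x e *s f e)"
    by (simp add: linear_simps(5,6)[OF assms(1)])
  also have "\<dots> = (\<Sum>e\<in>Basis. coord_form x e *s g e)"
    by (intro sum.cong) (simp_all add: e)
  also have "\<dots> = g (\<Sum>e\<in>Basis. coord_form x e *s e)"
    by (simp add: linear_simps(5,6)[OF assms(2)])
  finally have "f (\<Sum>e\<in>Basis. coord_form x e *s e) = g (\<Sum>e\<in>Basis. coord_form x e *s e)" .
  then show "f x = g x"
    by (simp only: coord_form_expand[symmetric])
qed

context
  assumes infinite_scalars: "infinite (UNIV :: 'a set)"
begin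

text \<open>A vector is a finite family of scalars. The same restriction to the basis then bounds
  linear maps by families of vectors, and bilinear maps by families of linear maps.\<close>

lemma vectors_lepoll: "(UNIV :: 'b set) \<lesssim> (UNIV :: 'a set)"
proof (rule lepoll_of_inj[where f = "\<lambda>x. restrict (coord_form x) Basis"])
  show "restrict (coord_form x) Basis \<in> Basis \<rightarrow>\<^sub>E (UNIV :: 'a set)" for x
    by simp
  show "x = y" if "restrict (coord_form x) Basis = restrict (coord_form y) Basis" for x y
  proof -
    have "coord_form x e = coord_form y e" if "e \<in> Basis" for e
      using fun_cong[OF \<open>restrict _ _ = _\<close>, of e] that by simp
    then have "(\<Sum>e\<in>Basis. coord_form x e *s e) = (\<Sum>e\<in>Basis. coord_form y e *s e)"
      by (intro sum.cong) simp_all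
    then show ?thesis
      by (simp only: coord_form_expand[symmetric])
  qed
  show "(Basis \<rightarrow>\<^sub>E (UNIV :: 'a set)) \<lesssim> (UNIV :: 'a set)"
    by (rule PiE_lepoll_infinite[OF finite_Basis lepoll_refl infinite_scalars])
qed

lemma linear_maps_lepoll: "{f. Vector_Spaces.linear scale scale f} \<lesssim> (UNIV :: 'a set)"
proof (rule lepoll_of_inj[where f = "\<lambda>f. restrict f Basis"])
  show "restrict f Basis \<in> Basis \<rightarrow>\<^sub>E (UNIV :: 'b set)" for f
    by simp
  show "(Basis \<rightarrow>\<^sub>E (UNIV :: 'b set)) \<lesssim> (UNIV :: 'a set)"
    by (rule PiE_lepoll_infinite[OF finite_Basis vectors_lepoll infinite_scalars])
  show "f = g" if "f \<in> {f. Vector_Spaces.linear scale scale f}"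
    "g \<in> {f. Vector_Spaces.linear scale scale f}" "restrict f Basis = restrict g Basis" for f g
    by (rule linear_eq_on_Basis[OF that(1,2)[unfolded mem_Collect_eq] that(3)])
qed

lemma bilinear_maps_lepoll: "{m. bilinear_map scale scale m} \<lesssim> (UNIV :: 'a set)"
proof (rule lepoll_of_inj[where f = "\<lambda>f. restrict f Basis"])
  show "restrict m Basis \<in> Basis \<rightarrow>\<^sub>E {f. Vector_Spaces.linear scale scale f}"
    if "m \<in> {m. bilinear_map scale scale m}" for m
    using that by (simp add: bilinear_mapD(3))
  show "(Basis \<rightarrow>\<^sub>E {f. Vector_Spaces.linear scale scale f}) \<lesssim> (UNIV :: 'a set)"
    by (rule PiE_lepoll_infinite[OF finite_Basis linear_maps_lepoll infinite_scalars])
  fix m m'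
  assume m: "m \<in> {m. bilinear_map scale scale m}" "m' \<in> {m. bilinear_map scale scale m}"
    and eq: "restrict m Basis = restrict m' Basis"
  have "(\<lambda>x. m x y) = (\<lambda>x. m' x y)" for y
  proof (rule linear_eq_on_Basis)
    have "m e = m' e" if "e \<in> Basis" for e
      using fun_cong[OF eq, of e] that by simp
    then show "restrict (\<lambda>x. m x y) Basis = restrict (\<lambda>x. m' x y) Basis"
      by (intro restrict_ext) simp
  qed (use m in \<open>simp_all add: bilinear_mapD(1)\<close>)
  then show "m = m'"
    by (simp add: fun_eq_iff)
qed

end
end

section \<open>Comparison of the two sets of classes over one pre-Lie bialgebra\<close>

context half_dimensional
begin

lemma bialgebras_lepoll:
  assumes inf: "infinite (UNIV :: 'k set)"
  shows "averaging_pre_lie_bialgebras sA \<lesssim> (UNIV :: 'k set)"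
proof -
  let ?L = "{f. Vector_Spaces.linear sA sA f}" and ?M = "{m. bilinear_map sA sA m}"
  have "averaging_pre_lie_bialgebras sA \<subseteq>
      (\<lambda>((m, n), (P, S)). \<lparr>bi_mult = m, bi_comult = A.comul n, bi_P = P, bi_S = S\<rparr>)
        ` ((?M \<times> ?M) \<times> (?L \<times> ?L))" (is "_ \<subseteq> ?f ` _")
  proof
    fix B
    assume "B \<in> averaging_pre_lie_bialgebras sA"
    then obtain n where "bilinear_map sA sA n" "bi_comult B = A.comul n"
      "A.dual_products (bi_mult B) n"
      "Vector_Spaces.linear sA sA (bi_P B)" "Vector_Spaces.linear sA sA (bi_S B)"
      by (rule bialgebra_structure)
    then show "B \<in> ?f ` ((?M \<times> ?M) \<times> (?L \<times> ?L))"
      by (intro image_eqI[of _ _ "((bi_mult B, n), (bi_P B, bi_S B))"])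
        (auto simp: A.dual_products_def pre_lie_algebra_def)
  qed
  then have "averaging_pre_lie_bialgebras sA \<lesssim> (?M \<times> ?M) \<times> (?L \<times> ?L)"
    by (rule subset_image_lepoll)
  also have "\<dots> \<lesssim> (UNIV :: 'k set)"
    by (intro times_lepoll_infinite A.bilinear_maps_lepoll A.linear_maps_lepoll inf)
  finally show ?thesis .
qed

text \<open>The bound is by homotheties and not by scalars, to include the zero space: there all
  homotheties coincide, but at most one bialgebra exists. Otherwise a nonzero vector of
  \<open>V\<close> recovers the scalar from the homothety.\<close>

lemma bialgebras_lepoll_homotheties:
  assumes inf: "infinite (UNIV :: 'k set)"
  shows "averaging_pre_lie_bialgebras sA \<lesssim> range sV"
proof (cases "\<forall>x :: 'a. x = 0")
  case True
  have "B = B'" if B: "B \<in> averaging_pre_lie_bialgebras sA"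
    and B': "B' \<in> averaging_pre_lie_bialgebras sA" for B B'
  proof -
    obtain n where n: "bi_comult B = A.comul n"
      by (rule bialgebra_structure[OF B])
    obtain n' where n': "bi_comult B' = A.comul n'"
      by (rule bialgebra_structure[OF B'])
    have eq1: "f = g" for f g :: "'a \<Rightarrow> 'a"
    proof
      show "f x = g x" for x
        using True[rule_format, of "f x"] True[rule_format, of "g x"] by simp
    qed
    have eq2: "f = g" for f g :: "'a \<Rightarrow> 'a \<Rightarrow> 'a"
      by (rule ext, rule eq1)
    have "bi_comult B = bi_comult B'"
      unfolding n n' by (rule arg_cong[of n n' A.comul, OF eq2])
    moreover have "bi_mult B = bi_mult B'"
      by (rule eq2)
    moreover have "bi_P B = bi_P B'" "bi_S B = bi_S B'"
      by (rule eq1)+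
    ultimately show ?thesis
      by simp
  qed
  then have "inj_on (\<lambda>B. sV 0) (averaging_pre_lie_bialgebras sA)"
    by (simp add: inj_on_def)
  then show ?thesis
    unfolding lepoll_def by blast
next
  case False
  then obtain x :: 'a where x: "x \<noteq> 0"
    by blast
  obtain i j p q where "framed sA basisA sV i j p q"
    using frame_exists by blast
  then interpret framed sA basisA sV i j p q .
  have "i x \<noteq> 0"
    using x by (metis frame_simps(1) frame_linear_simps(15))
  then have "inj sV"
    by (intro injI) (metis V.scale_right_imp_eq)
  then have "(UNIV :: 'k set) \<lesssim> range sV"
    unfolding lepoll_def by blast
  then show ?thesis
    using bialgebras_lepoll[OF inf] lepoll_trans by blast
qed

text \<open>A homothety is averaging for every bilinear product, self-adjoint for every bilinear
  form, and preserves every subspace.\<close>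

lemma manin_homothety:
  assumes M: "M \<in> manin_triples sV"
  shows "M\<lparr>mt_P := sV c\<rparr> \<in> manin_triples sV"
proof -
  note m = bilinear_map_simps[OF manin_mult(1)[OF M]] and f = manin_form_simps[OF M]
  note M' = M[unfolded manin_triples_def mem_Collect_eq Let_def quadratic_averaging_pre_lie_algebra_def]
  have sel: "mt_mult (M\<lparr>mt_P := g\<rparr>) = mt_mult M" "mt_P (M\<lparr>mt_P := g\<rparr>) = g"
    "mt_form (M\<lparr>mt_P := g\<rparr>) = mt_form M" "mt_A (M\<lparr>mt_P := g\<rparr>) = mt_A M"
    "mt_b (M\<lparr>mt_P := g\<rparr>) = mt_b M" for g
    by simp_all
  have "pre_lie_algebra sV (mt_mult M)"
    using M' unfolding averaging_pre_lie_algebra_def by blast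
  then have "averaging_pre_lie_algebra sV (mt_mult M) (sV c)"
    unfolding averaging_pre_lie_algebra_def using V.linear_scale_self by (simp add: m)
  moreover have sub: "averaging_pre_lie_subalgebra sV (mt_mult M) (sV c) U"
    if "averaging_pre_lie_subalgebra sV (mt_mult M) (mt_P M) U" for U
    using that V.subspace_scale by (simp add: averaging_pre_lie_subalgebra_def)
  have "averaging_pre_lie_subalgebra sV (mt_mult M) (sV c) (mt_A M)"
    "averaging_pre_lie_subalgebra sV (mt_mult M) (sV c) (mt_b M)"
    by (rule sub, use M' in blast)+
  moreover have "\<forall>x y. mt_form M (sV c x) y - mt_form M x (sV c y) = 0"
    by (simp add: f)
  ultimately show ?thesis
    unfolding manin_triples_def mem_Collect_eq Let_def quadratic_averaging_pre_lie_algebra_def sel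
    by (intro conjI) (use M' in blast)+
qed

text \<open>A linear isomorphism commutes with scalars, so it cannot carry one homothety to a
  different one.\<close>

lemma homotheties_lepoll:
  assumes M: "M \<in> manin_triples sV"
  shows "range sV \<lesssim> (\<lambda>f. manin_iso sV `` {M\<lparr>mt_P := f\<rparr>}) ` range sV"
proof -
  have "inj_on (\<lambda>f. manin_iso sV `` {M\<lparr>mt_P := f\<rparr>}) (range sV)"
  proof (rule inj_onI)
    fix f g
    assume "f \<in> range sV" "g \<in> range sV"
      and eq: "manin_iso sV `` {M\<lparr>mt_P := f\<rparr>} = manin_iso sV `` {M\<lparr>mt_P := g\<rparr>}"
    then obtain c d where f: "f = sV c" and g: "g = sV d"
      by blast
    have "(M\<lparr>mt_P := f\<rparr>, M\<lparr>mt_P := g\<rparr>) \<in> manin_iso sV"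
      using eq_equiv_class[OF eq equiv_manin_iso] manin_homothety[OF M] by (simp add: g)
    then obtain \<phi> where "manin_map sV \<phi> (M\<lparr>mt_P := f\<rparr>) (M\<lparr>mt_P := g\<rparr>)"
      unfolding manin_iso_iff by blast
    note \<phi> = manin_mapD[OF this]
    have "sV c (\<phi> v) = sV d (\<phi> v)" for v
      using \<phi>(7)[of v] linear_simps(5)[OF \<phi>(1)] by (simp add: f g)
    then show "f = g"
      using \<phi>(2) unfolding f g by (metis bij_is_surj ext surjD)
  qed
  then show ?thesis
    unfolding lepoll_def by blast
qed

lemma pre_lie_associated_update_P [simp]:
  "pre_lie_associated sV sA (M\<lparr>mt_P := f\<rparr>) B \<longleftrightarrow> pre_lie_associated sV sA M B"
  by (simp add: pre_lie_associated_def pre_lie_associated_via_def dual_functional_def)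

lemma associated_imp_pre_lie_associated:
  "associated sV sA M B \<Longrightarrow> pre_lie_associated sV sA M B"
  unfolding associated_def pre_lie_associated_def by blast

lemma associated_bij:
  "bij_betw (\<lambda>C. {B. \<exists>M\<in>C. associated sV sA M B}) (manin_triples sV // manin_iso sV)
    ({B \<in> averaging_pre_lie_bialgebras sA. bi_S B = bi_P B} // bialgebra_iso sA)"
proof (rule bij_betw_quotients[OF equiv_manin_iso equiv_bialgebra_iso])
  show "{B \<in> averaging_pre_lie_bialgebras sA. bi_S B = bi_P B} \<subseteq> averaging_pre_lie_bialgebras sA"
    by blast
  show "B \<in> {B \<in> averaging_pre_lie_bialgebras sA. bi_S B = bi_P B}"
    if "M \<in> manin_triples sV" "associated sV sA M B" for M B
    using associated_bialgebra[OF that] by simp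
  show "\<exists>M\<in>manin_triples sV. associated sV sA M B"
    if "B \<in> {B \<in> averaging_pre_lie_bialgebras sA. bi_S B = bi_P B}" for B
    using that associated_exists_manin by simp
qed (rule associated_exists_bialgebra associated_manin_iso associated_bialgebra_iso
    associated_imp_bialgebra_iso associated_imp_manin_iso; assumption)+

lemma pre_lie_associated_classes:
  assumes M: "M \<in> manin_triples sV" and B: "pre_lie_associated sV sA M B"
    and "(M, M') \<in> manin_iso sV" "(B, B') \<in> bialgebra_iso sA"
  shows "pre_lie_associated sV sA M' B'"
  using pre_lie_associated_manin_iso[OF pre_lie_associated_bialgebra_iso[OF M B]] assms(3,4) by blast

text \<open>If \<open>A \<noteq> 0\<close>, there are at most as many averaging pre-Lie bialgebras as scalars, while the
  homotheties \<open>P = c id\<close> give that many isomorphism classes of Manin triples over a fixed pre-Lie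
  bialgebra. Together with \<open>associated_bij\<close> this compares the fibres in both directions.\<close>

lemma pre_lie_associated_bij:
  assumes inf: "infinite (UNIV :: 'k set)"
  shows "\<exists>F. bij_betw F (manin_triples sV // manin_iso sV)
      (averaging_pre_lie_bialgebras sA // bialgebra_iso sA) \<and>
    (\<forall>C \<in> manin_triples sV // manin_iso sV. \<forall>M \<in> C. \<forall>B \<in> F C. pre_lie_associated sV sA M B)"
proof -
  let ?X = "manin_triples sV" and ?r = "manin_iso sV"
  let ?Y = "averaging_pre_lie_bialgebras sA" and ?s = "bialgebra_iso sA"
  let ?Z = "{B \<in> ?Y. bi_S B = bi_P B}"
  note r = equiv_manin_iso and s = equiv_bialgebra_iso
  \<comment> \<open>All representatives are quantified over; by invariance a single pair decides,
    which is the next fact.\<close>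
  define \<rho> where "\<rho> C D \<longleftrightarrow> (\<forall>M\<in>C. \<forall>B\<in>D. pre_lie_associated sV sA M B)" for C D
  have \<rho>: "\<rho> (?r``{M}) (?s``{B}) \<longleftrightarrow> pre_lie_associated sV sA M B" if "M \<in> ?X" "B \<in> ?Y" for M B
  proof
    show "pre_lie_associated sV sA M B" if "\<rho> (?r``{M}) (?s``{B})"
      using that equiv_class_self[OF r \<open>M \<in> ?X\<close>] equiv_class_self[OF s \<open>B \<in> ?Y\<close>]
      unfolding \<rho>_def by blast
    show "\<rho> (?r``{M}) (?s``{B})" if "pre_lie_associated sV sA M B"
      using pre_lie_associated_classes[OF \<open>M \<in> ?X\<close> that] unfolding \<rho>_def by blast
  qed
  have left_total: "\<exists>D\<in>?Y // ?s. \<rho> C D" if C: "C \<in> ?X // ?r" for C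
  proof -
    obtain M where M: "C = ?r``{M}" "M \<in> ?X"
      using C by (rule quotientE)
    obtain B where B: "associated sV sA M B"
      using associated_exists_bialgebra[OF M(2)] by blast
    have BY: "B \<in> ?Y"
      by (rule associated_bialgebra[OF M(2) B])
    have "\<rho> C (?s``{B})"
      unfolding M(1) \<rho>[OF M(2) BY] by (rule associated_imp_pre_lie_associated[OF B])
    then show ?thesis
      by (rule bexI) (rule quotientI[OF BY])
  qed
  have right_total: "\<exists>C\<in>?X // ?r. \<rho> C D" if D: "D \<in> ?Y // ?s" for D
  proof -
    obtain B where B: "D = ?s``{B}" "B \<in> ?Y"
      using D by (rule quotientE)
    obtain M where M: "M \<in> ?X" "pre_lie_associated sV sA M B"
      using pre_lie_associated_exists_manin[OF B(2)] by blast
    have "\<rho> (?r``{M}) D"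
      unfolding B(1) \<rho>[OF M(1) B(2)] by (rule M(2))
    then show ?thesis
      by (rule bexI) (rule quotientI[OF M(1)])
  qed
  have difunctional: "\<rho> C' D'"
    if C: "C \<in> ?X // ?r" "C' \<in> ?X // ?r" and D: "D \<in> ?Y // ?s" "D' \<in> ?Y // ?s"
      and rel: "\<rho> C D" "\<rho> C D'" "\<rho> C' D" for C C' D D'
  proof -
    obtain M M' where M: "C = ?r``{M}" "M \<in> ?X" "C' = ?r``{M'}" "M' \<in> ?X"
      using C by (auto elim!: quotientE)
    obtain B B' where B: "D = ?s``{B}" "B \<in> ?Y" "D' = ?s``{B'}" "B' \<in> ?Y"
      using D by (auto elim!: quotientE)
    show ?thesis
      using pre_lie_associated_difunctional[OF M(2,4)] rel
      unfolding M(1,3) B(1,3) \<rho>[OF M(2) B(2)] \<rho>[OF M(2) B(4)] \<rho>[OF M(4) B(2)] \<rho>[OF M(4) B(4)]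
      by blast
  qed
  have fibres: "{C'\<in>?X // ?r. \<rho> C' D} \<approx> {D'\<in>?Y // ?s. \<rho> C D'}"
    if C: "C \<in> ?X // ?r" and D: "D \<in> ?Y // ?s" and CD: "\<rho> C D" for C D
  proof (rule lepoll_antisym)
    \<comment> \<open>The natural bijection onto the classes with \<open>S = P\<close> is injective.
      It leaves the pre-Lie part unchanged, so difunctionality keeps the image of the fibre over
      \<open>D\<close> inside the fibre of \<open>C\<close>.\<close>
    define G where "G C = {B. \<exists>M\<in>C. associated sV sA M B}" for C
    have G: "bij_betw G (?X // ?r) (?Z // ?s)"
      unfolding G_def[abs_def] by (rule associated_bij)
    have "\<rho> C (G C')" "G C' \<in> ?Y // ?s" if C': "C' \<in> ?X // ?r" "\<rho> C' D" for C'
    proof -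
      have "G C' \<in> ?Z // ?s"
        using G C'(1) by (rule bij_betwE[THEN bspec])
      then obtain B where B: "G C' = ?s``{B}" "B \<in> ?Z"
        by (rule quotientE)
      then show GY: "G C' \<in> ?Y // ?s"
        by (simp add: quotientI)
      have "B \<in> G C'"
        unfolding B(1) using B(2) by (intro equiv_class_self[OF s]) simp
      then obtain M where M: "M \<in> C'" "associated sV sA M B"
        unfolding G_def by blast
      obtain M0 where "C' = ?r``{M0}"
        using C'(1) by (rule quotientE)
      then have MX: "M \<in> ?X" and MC: "C' = ?r``{M}"
        using M(1) equiv_class_eq_iff[OF r, of M0 M] by auto
      have BY: "B \<in> ?Y"
        using B(2) by simp
      have "\<rho> C' (G C')"
        unfolding MC B(1)[unfolded MC] \<rho>[OF MX BY]
        by (rule associated_imp_pre_lie_associated[OF M(2)])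
      then show "\<rho> C (G C')"
        by (rule difunctional[OF C'(1) C D GY C'(2) _ CD])
    qed
    then show "{C'\<in>?X // ?r. \<rho> C' D} \<lesssim> {D'\<in>?Y // ?s. \<rho> C D'}"
      unfolding lepoll_def
      by (intro exI[of _ G] conjI inj_on_subset[OF bij_betw_imp_inj_on[OF G]]) blast+
    obtain M where M: "C = ?r``{M}" "M \<in> ?X"
      using C by (rule quotientE)
    obtain B where B: "D = ?s``{B}" "B \<in> ?Y"
      using D by (rule quotientE)
    \<comment> \<open>Conversely a crude bound suffices: all bialgebras together are no more than
      the homotheties, and replacing the operator of \<open>M\<close> by these already gives as many
      classes over \<open>D\<close>.\<close>
    have "{D'\<in>?Y // ?s. \<rho> C D'} \<lesssim> ?Y // ?s"
      by (rule subset_imp_lepoll) blast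
    also have "?Y // ?s \<lesssim> ?Y"
      unfolding quotient_def UNION_singleton_eq_range by (rule image_lepoll)
    also have "\<dots> \<lesssim> range sV"
      by (rule bialgebras_lepoll_homotheties[OF inf])
    also have "\<dots> \<lesssim> (\<lambda>f. ?r `` {M\<lparr>mt_P := f\<rparr>}) ` range sV"
      by (rule homotheties_lepoll[OF M(2)])
    also have "\<dots> \<lesssim> {C'\<in>?X // ?r. \<rho> C' D}"
    proof (rule subset_imp_lepoll, clarsimp)
      fix c
      have "M\<lparr>mt_P := sV c\<rparr> \<in> ?X"
        by (rule manin_homothety[OF M(2)])
      moreover have "pre_lie_associated sV sA M B"
        using CD unfolding M(1) B(1) \<rho>[OF M(2) B(2)] .
      ultimately show "?r `` {M\<lparr>mt_P := sV c\<rparr>} \<in> ?X // ?r \<and> \<rho> (?r `` {M\<lparr>mt_P := sV c\<rparr>}) D"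
        by (simp add: B(1) \<rho> B(2) quotientI)
    qed
    finally show "{D'\<in>?Y // ?s. \<rho> C D'} \<lesssim> {C'\<in>?X // ?r. \<rho> C' D}" .
  qed
  have "\<exists>F. bij_betw F (?X // ?r) (?Y // ?s) \<and> (\<forall>C\<in>?X // ?r. \<rho> C (F C))"
    by (intro bijection_of_fibres) (fact left_total right_total difunctional fibres)+
  then show ?thesis
    unfolding \<rho>_def .
qed

end

theorem theorem3p6:
  fixes sV :: "'k::field_char_0 \<Rightarrow> 'v::ab_group_add \<Rightarrow> 'v" and basisV :: "'v set"
    and sA :: "'k \<Rightarrow> 'a::ab_group_add \<Rightarrow> 'a" and basisA :: "'a set"
  assumes "finite_dimensional_vector_space sV basisV"
    and "finite_dimensional_vector_space sA basisA"
    and "vector_space.dim sV (UNIV :: 'v set) = 2 * vector_space.dim sA (UNIV :: 'a set)"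
  shows "(\<exists>F. bij_betw F (manin_triples sV // manin_iso sV)
                (averaging_pre_lie_bialgebras sA // bialgebra_iso sA) \<and>
              (\<forall>C \<in> manin_triples sV // manin_iso sV. \<forall>M \<in> C. \<forall>B \<in> F C.
                pre_lie_associated sV sA M B)) \<and>
         bij_betw (\<lambda>C. {B. \<exists>M\<in>C. associated sV sA M B})
           (manin_triples sV // manin_iso sV)
           ({B \<in> averaging_pre_lie_bialgebras sA. bi_S B = bi_P B} // bialgebra_iso sA)"
proof -
  interpret half_dimensional sA basisA sV basisV
    using assms by (simp add: half_dimensional_def half_dimensional_axioms_def)
  show ?thesis
    using pre_lie_associated_bij[OF infinite_UNIV_char_0] associated_bij by blast
qed

end
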